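(* For every $\epsilon>0$ there exists a distributed algorithm in the LOCAL model that, for every bipartite planar graph $G$, computes in a constant number of rounds (the constant depending only on $\epsilon$) a dominating set of $G$ of size at most $(7+\epsilon)\gamma(G)$.
   Context: All graphs are finite, undirected and simple. In the LOCAL model the input graph is the communication network: each vertex is a processor with a unique identifier; in each synchronous round every vertex may send arbitrary messages to its neighbours and perform arbitrary local computation; at the end each vertex decides whether it belongs to the output set. A dominating set of $G$ is a set $D\subseteq V(G)$ such that every vertex is in $D$ or has a neighbour in $D$; $\gamma(G)$ is the minimum size of a dominating set. *)

theory Defs
  imports "HOL-Analysis.Analysis"
begin

text \<open>Finite simple undirected graphs. Vertices are natural numbers; the vertex name
  serves as its unique identifier in the LOCAL model.\<close>

definition simple_graph :: "nat set \<Rightarrow> (nat \<times> nat) set \<Rightarrow> bool" where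
  "simple_graph V E \<longleftrightarrow> finite V \<and> E \<subseteq> V \<times> V \<and> sym E \<and> (\<forall>x. (x, x) \<notin> E)"

definition dominating_set :: "nat set \<Rightarrow> (nat \<times> nat) set \<Rightarrow> nat set \<Rightarrow> bool" where
  "dominating_set V E D \<longleftrightarrow> D \<subseteq> V \<and> (\<forall>v\<in>V. v \<in> D \<or> (\<exists>u\<in>D. (v, u) \<in> E))"

definition domination_number :: "nat set \<Rightarrow> (nat \<times> nat) set \<Rightarrow> nat" where
  "domination_number V E = Min (card ` {D. dominating_set V E D})"

definition bipartite :: "nat set \<Rightarrow> (nat \<times> nat) set \<Rightarrow> bool" where
  "bipartite V E \<longleftrightarrow> (\<exists>A. \<forall>(u, v)\<in>E. (u \<in> A \<longleftrightarrow> v \<notin> A))"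

definition planar :: "nat set \<Rightarrow> (nat \<times> nat) set \<Rightarrow> bool" where
  "planar V E \<longleftrightarrow>
    (\<exists>(p :: nat \<Rightarrow> complex) (c :: nat \<times> nat \<Rightarrow> real \<Rightarrow> complex).
       inj_on p V \<and>
       (\<forall>(u, v)\<in>E. u < v \<longrightarrow>
          arc (c (u, v)) \<and> pathstart (c (u, v)) = p u \<and> pathfinish (c (u, v)) = p v \<and>
          path_image (c (u, v)) \<inter> p ` V = {p u, p v}) \<and>
       (\<forall>(u, v)\<in>E. \<forall>(u', v')\<in>E. u < v \<longrightarrow> u' < v' \<longrightarrow> (u, v) \<noteq> (u', v') \<longrightarrow>
          path_image (c (u, v)) \<inter> path_image (c (u', v')) \<subseteq> p ` ({u, v} \<inter> {u', v'})))"

definition ball_graph :: "nat set \<Rightarrow> (nat \<times> nat) set \<Rightarrow> nat \<Rightarrow> nat \<Rightarrow> nat set" where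
  "ball_graph V E r v = {u. (v, u) \<in> (Id_on V \<union> E) ^^ r}"

text \<open>The local view of \<open>v\<close> after gathering radius-\<open>r\<close> information in the LOCAL model:
  its own identifier, the identifiers of all vertices within distance \<open>r\<close>, and all edges
  among them. An \<open>r\<close>-round LOCAL algorithm is (up to an additive constant in the number of
  rounds) exactly a function from such views to the output bit.\<close>

definition local_view :: "nat set \<Rightarrow> (nat \<times> nat) set \<Rightarrow> nat \<Rightarrow> nat \<Rightarrow> nat \<times> nat set \<times> (nat \<times> nat) set" where
  "local_view V E r v = (let B = ball_graph V E r v in (v, B, E \<inter> (B \<times> B)))"

definition local_output ::
  "(nat \<times> nat set \<times> (nat \<times> nat) set \<Rightarrow> bool) \<Rightarrow> nat \<Rightarrow> nat set \<Rightarrow> (nat \<times> nat) set \<Rightarrow> nat set" where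
  "local_output A r V E = {v \<in> V. A (local_view V E r v)}"

end

theory Submission
  imports Defs
begin

text \<open>Fix a dominating set \<open>D\<close>. A vertex is \<^emph>\<open>hard\<close> if its neighbourhood is not dominated by boundedly many other vertices.
  Contracting stars around \<open>D\<close> gives a planar minor in which a hard vertex outside \<open>D\<close> has large degree,
  so sparsity leaves only \<open>\<epsilon> |D|\<close> of them; all hard vertices are taken. Among the remaining vertices,
  one that still has many undominated neighbours shares many of them with some partner, and only boundedly
  many partners exist because a large complete bipartite graph with three vertices on one side is too dense.
  Up to \<open>\<epsilon> |D|\<close> exceptions, \<open>D\<close> meets every pair of partners, so a vertex cover of the
  bounded-degree graph of partners costs about \<open>2 |D|\<close> and leaves every vertex with boundedly many
  undominated neighbours. After discarding twins and the few vertices that still have many candidate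
  dominators, the dominating set LP has bounded degree, and rounding it costs a factor \<open>5\<close> because bipartite planar
  graphs have at most twice as many edges as vertices. Both LPs are solved up to a factor \<open>1 + \<epsilon>\<close> by
  constantly many rounds of multiplicative weights.

  The edge bounds come from the topological definition of planarity by a face count. Every new edge closing a cycle
  creates a face by the Jordan curve theorem, an edge borders at most two faces, and the edges bordering a face separate
  the plane, so by Janiszewski's theorem they cannot be removed leaf by leaf.\<close>

section \<open>Separation of the plane by a set and an arc\<close>

text \<open>The ratio is 7 = 2 + 5: vertex cover costs twice and rounding five times the part of
  \<open>D\<close> that is not hard, while a hard member of \<open>D\<close> is paid for once. The
  constants are fixed in the order \<open>k\<close>, \<open>T\<close>, \<open>M\<close>,
  \<open>L\<close>: \<open>k\<close> is large in terms of \<epsilon>, \<open>T\<close> exceeds what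
  \<open>k\<close> vertices can share with a pair, \<open>M\<close> bounds the undominated
  neighbourhoods, and \<open>L\<close> is so large that few vertices have more than \<open>L\<close>
  candidates. Row size and degree of both programs are bounded by these numbers, so the number of
  rounds does not depend on the graph.

  No contraction is ever drawn. Instead \<open>euler_bound\<close> counts along each face only a
  marked set \<open>X\<close> of edges. An unmarked edge stands for a contracted one; it comes with
  a vertex of its own, so both cancel in Euler's inequality. In place of a girth there is the
  condition that an edge set with fewer than \<open>g\<close> marked edges has a vertex of degree
  one.

  That an edge borders at most two faces concerns an arc attached to an arbitrary compact set, which
  need not close a Jordan curve; this is why it is proved with logarithms.\<close>

lemma circle_power_no_log:
  fixes l :: "complex \<Rightarrow> complex" and n :: int
  assumes r: "r > 0" and cont: "continuous_on (sphere a r) l"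
    and l: "\<And>z. z \<in> sphere a r \<Longrightarrow> (z - a) powi n = exp (l z)"
  shows "n = 0"
proof -
  define e where "e t = a + of_real r * exp (\<i> * of_real t)" for t :: real
  have e_in: "e t \<in> sphere a r" for t
    using r by (simp add: e_def dist_norm norm_mult)
  \<comment> \<open>The exponential of \<open>h\<close> is constant, so \<open>h\<close> takes
    values in a discrete set and is constant. Its values at 0 and \<open>2*pi\<close>, where
    \<open>e\<close> agrees, differ by a multiple of \<open>n\<close>.\<close>
  define h where "h t = l (e t) - \<i> * of_int n * of_real t" for t :: real
  have conth: "continuous_on UNIV h"
    unfolding h_def
    by (intro continuous_intros continuous_on_compose2[OF cont])
       (use e_in in \<open>auto simp: e_def intro!: continuous_intros\<close>)
  have exph: "exp (h t) = of_real r powi n" for t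
  proof -
    have "exp (l (e t)) = (of_real r * exp (\<i> * of_real t)) powi n"
      using l[OF e_in[of t]] by (simp add: e_def)
    also have "\<dots> = of_real r powi n * exp (of_int n * (\<i> * of_real t))"
      by (simp add: power_int_mult_distrib exp_power_int)
    finally show ?thesis
      by (simp add: h_def exp_diff mult_ac)
  qed
  have "h constant_on (UNIV :: real set)"
  proof (rule continuous_discrete_range_constant[OF _ conth])
    fix x :: real
    show "\<exists>e>0. \<forall>y. y \<in> UNIV \<and> h y \<noteq> h x \<longrightarrow> e \<le> cmod (h y - h x)"
    proof (intro exI[of _ "2*pi"] conjI allI impI)
      fix y assume ne: "y \<in> UNIV \<and> h y \<noteq> h x"
      have "exp (h y) = exp (h x)" by (simp add: exph)
      then obtain m :: int where m: "h y = h x + of_int (2*m) * of_real pi * \<i>"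
        unfolding exp_eq by auto
      with ne have "m \<noteq> 0" by auto
      then have "1 \<le> \<bar>real_of_int m\<bar>" by linarith
      then show "2*pi \<le> cmod (h y - h x)"
        using m by (simp add: norm_mult)
    qed simp
  qed simp
  then have "h 0 = h (2*pi)" by (auto simp: constant_on_def)
  moreover have "e (2*pi) = e 0" by (simp add: e_def exp_two_pi_i' mult.commute exp_two_pi_i)
  ultimately show ?thesis by (simp add: h_def)
qed

text \<open>The cohomology classes of \<open>z - a\<close>, \<open>z - b\<close>, \<open>z - c\<close> restricted to \<open>X\<close> detect the bounded
  component containing \<open>a\<close>: extending the logarithm into that component would give a nonvanishing
  function on a disc that winds \<open>i\<close> times along the boundary.\<close>

lemma no_log_of_separated_points:
  fixes X :: "complex set" and i j k :: int
  assumes X: "compact X" and aX: "a \<notin> X"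
    and bdd: "bounded (connected_component_set (- X) a)"
    and b: "b \<notin> connected_component_set (- X) a" and c: "c \<notin> connected_component_set (- X) a"
    and bX: "b \<notin> X" "c \<notin> X"
    and g: "continuous_on X g"
    and log: "\<And>z. z \<in> X \<Longrightarrow> (z - a) powi i * (z - b) powi j * (z - c) powi k = exp (g z)"
  shows "i = 0"
proof -
  define A where "A = connected_component_set (- X) a"
  have "open A" unfolding A_def using X by (simp add: compact_imp_closed open_Compl open_connected_component)
  have aA: "a \<in> A" unfolding A_def using aX by simp
  have frA: "frontier A \<subseteq> X"
    unfolding A_def using frontier_of_connected_component_subset[of "-X" a] X
      by (metis compact_imp_closed frontier_complement frontier_subset_closed subset_trans)
  obtain G where contG: "continuous_on UNIV G" and G: "\<And>z. z \<in> X \<Longrightarrow> G z = g z"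
    using Tietze_unbounded[OF g, of UNIV] X by (auto simp: compact_imp_closed)
  have "bounded (X \<union> A)" using bdd X by (simp add: A_def compact_imp_bounded)
  then obtain r where r: "r > 0" "X \<union> A \<subseteq> ball a r"
    by (meson bounded_subset_ballD)
  \<comment> \<open>The factors at \<open>b\<close> and \<open>c\<close> have no zero on
    \<open>closure A\<close>; for this these points must lie outside the component of
    \<open>a\<close>.\<close>
  define u where "u z = exp (G z) * (z - b) powi (-j) * (z - c) powi (-k)" for z
  define H where "H z = (if z \<in> closure A then u z else (z - a) powi i)" for z
  have clA: "closure A \<subseteq> A \<union> X" using frA closure_Un_frontier by blast
  have nzb: "z \<noteq> b" "z \<noteq> c" if "z \<in> closure A" for z
    using that clA b c bX by (auto simp: A_def)
  have cont1: "continuous_on (closure A) u"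
    unfolding u_def using nzb
    by (intro continuous_intros continuous_on_subset[OF contG]) auto
  have cont2: "continuous_on (- A) (\<lambda>z. (z - a) powi i)"
    using aA by (intro continuous_intros) auto
  have agree: "u z = (z - a) powi i" if "z \<in> closure A \<inter> - A" for z
  proof -
    have zX: "z \<in> X" using that clA by auto
    have "z \<noteq> b" "z \<noteq> c" using nzb that by auto
    then show ?thesis
      using log[OF zX] zX by (simp add: u_def G power_int_minus field_simps)
  qed
  have contH: "continuous_on (closure A \<union> - A) H"
    unfolding H_def
  proof (rule continuous_on_cases)
    show "closed (closure A)" "closed (- A)" using \<open>open A\<close> by auto
    show "\<forall>x. x \<in> closure A \<and> x \<notin> closure A \<or> x \<in> - A \<and> x \<in> closure A \<longrightarrow> u x = (x - a) powi i"
      using agree by auto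
  qed (use cont1 cont2 in auto)
  have "closure A \<union> - A = UNIV" using closure_subset by blast
  with contH have contH: "continuous_on (cball a r) H"
    using continuous_on_subset by fastforce
  have Hnz: "H z \<noteq> 0" for z
    using nzb[of z] aA closure_subset[of A] by (auto simp: H_def u_def power_int_eq_0_iff)
  obtain l where l: "continuous_on (cball a r) l" "\<And>z. z \<in> cball a r \<Longrightarrow> H z = exp (l z)"
    using continuous_logarithm_on_cball[OF contH] Hnz by blast
  show ?thesis
  proof (rule circle_power_no_log[of r a l])
    show "continuous_on (sphere a r) l" using l(1) continuous_on_subset by (metis sphere_cball)
    fix z assume z: "z \<in> sphere a r"
    then have "z \<notin> X \<union> A" using r(2) by (metis mem_ball mem_sphere order_less_irrefl subsetD)
    then have "z \<notin> closure A" using clA by blast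
    then have "H z = (z - a) powi i" by (simp add: H_def)
    then show "(z - a) powi i = exp (l z)" using l(2)[of z] z by (simp add: sphere_def cball_def)
  qed (use r in auto)
qed

text \<open>Borsuk's criterion: points in one component of the complement of \<open>K\<close> induce
  homotopic maps from \<open>K\<close> to the circle, so the normalised quotient has a logarithm.
  The modulus contributes a real summand.\<close>

lemma log_quotient_exists:
  fixes K :: "complex set"
  assumes K: "compact K" and ac: "connected_component (- K) a c"
  obtains g where "continuous_on K g" "\<And>z. z \<in> K \<Longrightarrow> (z - a) / (z - c) = exp (g z)"
proof -
  have [simp]: "a \<notin> K" "c \<notin> K"
    by (meson ComplD ac connected_component_in)+
  obtain g where contg: "continuous_on K g"
     and g: "\<And>x. x \<in> K \<Longrightarrow> exp (\<i>* of_real (g x)) = (x - a) /\<^sub>R cmod (x - a) / ((x - c) /\<^sub>R cmod (x - c))"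
    using ac K
    apply (simp add: Borsuk_maps_homotopic_in_connected_component_eq [symmetric])
    apply (subst (asm) homotopic_circlemaps_divide)
    apply (auto simp: inessential_eq_continuous_logarithm_circle)
    done
  define h where "h z = \<i> * of_real (g z) + of_real (ln (cmod (z - a) / cmod (z - c)))" for z
  show ?thesis
  proof
    have "z \<noteq> a" "z \<noteq> c" if "z \<in> K" for z using that by auto
    then show "continuous_on K h"
      unfolding h_def by (intro continuous_intros contg) auto
    fix z assume z: "z \<in> K"
    have ne: "z \<noteq> a" "z \<noteq> c" using z by auto
    then have pos: "cmod (z - a) / cmod (z - c) > 0" by simp
    have "exp (h z) = exp (\<i>* of_real (g z)) * of_real (cmod (z - a) / cmod (z - c))"
      unfolding h_def exp_add exp_of_real exp_ln[OF pos] by simp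
    also have "\<dots> = (z - a) / (z - c)"
      using ne by (simp add: g[OF z] scaleR_conv_of_real field_simps)
    finally show "(z - a) / (z - c) = exp (h z)" by simp
  qed
qed

lemma exp_log_diff:
  assumes "exp x = exp (y::complex)"
  obtains m :: int where "x = y + of_int m * (2 * of_real pi * \<i>)"
proof -
  obtain m :: int where "x = y + of_int (2 * m) * of_real pi * \<i>"
    using assms unfolding exp_eq by force
  then show ?thesis using that[of m] by (simp add: algebra_simps)
qed

text \<open>The obstruction to a logarithm on the union of \<open>K\<close> and an arc meeting it in two points is a
  single integer, so among two independent obstruction classes some combination vanishes.\<close>

lemma arc_splits_into_at_most_two:
  fixes K e :: "complex set"
  assumes K: "compact K" and e: "compact e" and Ke: "K \<inter> e = {p, q}"
    and nonsep: "connected (- e)"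
    and ab: "connected_component (- K) a c" "connected_component (- K) b c"
    and out: "a \<notin> e" "b \<notin> e" "c \<notin> e"
    and sep: "\<not> connected_component (- (K \<union> e)) a b" "\<not> connected_component (- (K \<union> e)) a c"
      "\<not> connected_component (- (K \<union> e)) b c"
  shows False
proof -
  define X where "X = K \<union> e"
  have X: "compact X" using K e by (simp add: X_def compact_Un)
  have notK: "a \<notin> K" "b \<notin> K" "c \<notin> K" using ab by (meson ComplD connected_component_in)+
  have notX: "a \<notin> X" "b \<notin> X" "c \<notin> X" using notK out by (auto simp: X_def)
  obtain g1 where g1: "continuous_on K g1" "\<And>z. z \<in> K \<Longrightarrow> (z - a) / (z - c) = exp (g1 z)"
    using log_quotient_exists[OF K ab(1)] by blast
  obtain g2 where g2: "continuous_on K g2" "\<And>z. z \<in> K \<Longrightarrow> (z - b) / (z - c) = exp (g2 z)"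
    using log_quotient_exists[OF K ab(2)] by blast
  have "connected_component (- e) a c" "connected_component (- e) b c"
    using nonsep out by (auto simp: connected_iff_connected_component)
  then obtain h1 h2 where h1: "continuous_on e h1" "\<And>z. z \<in> e \<Longrightarrow> (z - a) / (z - c) = exp (h1 z)"
     and h2: "continuous_on e h2" "\<And>z. z \<in> e \<Longrightarrow> (z - b) / (z - c) = exp (h2 z)"
    using log_quotient_exists[OF e] by metis
  let ?w = "2 * of_real pi * \<i> :: complex"
  have pq: "p \<in> K" "p \<in> e" "q \<in> K" "q \<in> e" using Ke by auto
  obtain m1p where m1p: "g1 p = h1 p + of_int m1p * ?w"
    using exp_log_diff g1(2) h1(2) pq by metis
  obtain m1q where m1q: "g1 q = h1 q + of_int m1q * ?w"
    using exp_log_diff g1(2) h1(2) pq by metis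
  obtain m2p where m2p: "g2 p = h2 p + of_int m2p * ?w"
    using exp_log_diff g2(2) h2(2) pq by metis
  obtain m2q where m2q: "g2 q = h2 q + of_int m2q * ?w"
    using exp_log_diff g2(2) h2(2) pq by metis
  obtain i j :: int where ij: "i * (m1p - m1q) + j * (m2p - m2q) = 0" "i \<noteq> 0 \<or> j \<noteq> 0"
  proof (cases "m1p = m1q")
    case True then show ?thesis using that[of 1 0] by auto
  next
    case False then show ?thesis using that[of "m2p - m2q" "-(m1p - m1q)"] by (auto simp: algebra_simps)
  qed
  \<comment> \<open>This shift makes the two branches of \<open>F\<close> agree at \<open>p\<close>;
    by the relation for \<open>i\<close> and \<open>j\<close> it also makes them agree at
    \<open>q\<close>.\<close>
  define s where "s = of_int (i * m1p + j * m2p) * ?w"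
  define F where "F z = (if z \<in> K then of_int i * g1 z + of_int j * g2 z
      else of_int i * h1 z + of_int j * h2 z + s)" for z
  have s': "s = of_int (i * m1q + j * m2q) * ?w"
    using ij(1) by (simp add: s_def algebra_simps flip: of_int_add of_int_mult)
  have contF: "continuous_on X F"
    unfolding F_def X_def
  proof (rule continuous_on_cases)
    show "closed K" "closed e" using K e compact_imp_closed by auto
    show "continuous_on K (\<lambda>z. of_int i * g1 z + of_int j * g2 z)"
      by (intro continuous_intros g1 g2)
    show "continuous_on e (\<lambda>z. of_int i * h1 z + of_int j * h2 z + s)"
      by (intro continuous_intros h1 h2)
    have "of_int i * g1 p + of_int j * g2 p = of_int i * h1 p + of_int j * h2 p + s"
      by (simp add: m1p m2p s_def algebra_simps)
    moreover have "of_int i * g1 q + of_int j * g2 q = of_int i * h1 q + of_int j * h2 q + s"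
      by (simp add: m1q m2q s' algebra_simps)
    ultimately show "\<forall>x. x \<in> K \<and> x \<notin> K \<or> x \<in> e \<and> x \<in> K \<longrightarrow>
        of_int i * g1 x + of_int j * g2 x = of_int i * h1 x + of_int j * h2 x + s"
      using Ke by (metis IntI insertE singletonD)
  qed
  have exps: "exp s = 1" unfolding s_def
    using exp_integer_2pi[of "of_int (i * m1p + j * m2p)"] by (simp add: mult_ac)
  have expF: "exp (F z) = (z - a) powi i * (z - b) powi j * (z - c) powi (- i - j)" if z: "z \<in> X" for z
  proof -
    have "z \<noteq> a" "z \<noteq> b" "z \<noteq> c" using z notX by auto
    have "exp (F z) = ((z - a) / (z - c)) powi i * ((z - b) / (z - c)) powi j"
    proof (cases "z \<in> K")
      case True
      then show ?thesis by (simp add: F_def g1 g2 exp_add exp_power_int)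
    next
      case False
      with z have "z \<in> e" by (auto simp: X_def)
      with False show ?thesis by (simp add: F_def h1 h2 exp_add exp_power_int exps)
    qed
    also have "\<dots> = (z - a) powi i * (z - b) powi j * (z - c) powi (- i - j)"
      using \<open>z \<noteq> c\<close> by (simp add: power_int_divide_distrib power_int_diff power_int_minus field_simps)
    finally show ?thesis .
  qed
  have sepX: "\<not> connected_component (- X) a b" "\<not> connected_component (- X) a c"
      "\<not> connected_component (- X) b c" using sep by (auto simp: X_def)
  have sym: "connected_component (- X) x y \<longleftrightarrow> connected_component (- X) y x" for x y
    by (rule connected_component_sym_eq)
  have i0: "bounded (connected_component_set (- X) a) \<Longrightarrow> i = 0"
    by (rule no_log_of_separated_points[OF X notX(1) _ _ _ notX(2,3) contF])
       (use sepX in \<open>auto simp: expF\<close>)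
  have j0: "bounded (connected_component_set (- X) b) \<Longrightarrow> j = 0"
    by (rule no_log_of_separated_points[OF X notX(2) _ _ _ notX(1,3) contF])
       (use sepX sym in \<open>auto simp: expF mult_ac\<close>)
  have k0: "bounded (connected_component_set (- X) c) \<Longrightarrow> - i - j = 0"
    by (rule no_log_of_separated_points[OF X notX(3) _ _ _ notX(1,2) contF])
       (use sepX sym in \<open>auto simp: expF mult_ac\<close>)
  have one: "connected_component (- X) x y"
    if "\<not> bounded (connected_component_set (- X) x)" "\<not> bounded (connected_component_set (- X) y)" for x y
  proof -
    have "connected_component_set (- X) x = connected_component_set (- X) y"
      using cobounded_unique_unbounded_components[of "- X"] X that
      by (metis DIM_complex compact_imp_bounded componentsI connected_component_eq_empty double_complement bounded_empty order_refl)
    then show ?thesis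
      using that by (metis bounded_empty connected_component_eq_empty connected_component_eq_eq)
  qed
  \<comment> \<open>At most one of the three components is unbounded, so at least two of
    \<open>i\<close>, \<open>j\<close>, \<open>- i - j\<close> vanish. Then
    \<open>i = j = 0\<close>, against their choice.\<close>
  show False
    using i0 j0 k0 one sepX ij(2) by (metis add.inverse_neutral diff_0_right diff_0 neg_equal_0_iff_equal)
qed

section \<open>Faces of plane drawings\<close>

text \<open>Such a component would have a finite frontier without being the whole plane, but
  removing finitely many points leaves the plane connected. \<open>many_faces\<close> uses this to
  move sample points off a new arc.\<close>

lemma component_not_subset_compact:
  fixes K e :: "complex set"
  assumes K: "closed K" and e: "compact e" and fin: "finite (K \<inter> e)" and x: "x \<notin> K"
  shows "\<not> connected_component_set (- K) x \<subseteq> e"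
proof
  define W where "W = connected_component_set (- K) x"
  assume "connected_component_set (- K) x \<subseteq> e"
  then have We: "W \<subseteq> e" by (simp add: W_def)
  have xW: "x \<in> W" using x by (simp add: W_def)
  have "frontier W \<subseteq> K"
    unfolding W_def using frontier_of_connected_component_subset[of "-K" x] K
    by (metis frontier_complement frontier_subset_closed subset_trans)
  moreover have "closure W \<subseteq> e" using We e by (simp add: closure_minimal compact_imp_closed)
  ultimately have fr: "frontier W \<subseteq> K \<inter> e" by (auto simp: frontier_def)
  have conn: "connected (- (K \<inter> e))"
    using connected_open_diff_countable[of UNIV "K \<inter> e"] fin
    by (auto simp: countable_finite Compl_eq_Diff_UNIV connected_UNIV)
  have "bounded (e \<union> K \<inter> e)" using e by (simp add: compact_imp_bounded bounded_Int)
  then have "e \<union> K \<inter> e \<noteq> UNIV" using not_bounded_UNIV by metis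
  then obtain y where y: "y \<notin> e" "y \<notin> K \<inter> e" by blast
  have "W \<inter> K = {}" unfolding W_def using connected_component_subset by fastforce
  then have 1: "- (K \<inter> e) \<inter> W \<noteq> {}" using xW by blast
  have 2: "- (K \<inter> e) - W \<noteq> {}" using y We by blast
  show False using connected_Int_frontier[OF conn 1 2] fr by blast
qed

text \<open>The ends of \<open>e\<close> are already joined inside \<open>K\<close>, so
  \<open>e\<close> closes a Jordan curve. Two points near the middle of \<open>e\<close>, one on
  each side, lie in a disc that misses \<open>K\<close> but are separated by the curve.\<close>

lemma arc_splits_component:
  fixes K :: "complex set"
  assumes K: "closed K" and e: "arc e" and Ke: "K \<inter> path_image e = {pathstart e, pathfinish e}"
    and pc: "path_component K (pathstart e) (pathfinish e)"
  obtains a b where "a \<notin> K \<union> path_image e" "b \<notin> K \<union> path_image e" "connected_component (- K) a b"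
    "\<not> connected_component (- (K \<union> path_image e)) a b"
proof -
  have ne: "pathfinish e \<noteq> pathstart e" using e arc_distinct_ends by metis
  obtain g where g: "path g" "path_image g \<subseteq> K" "pathstart g = pathfinish e" "pathfinish g = pathstart e"
    using path_component_sym[OF pc] unfolding path_component_def by blast
  obtain q where q: "arc q" "path_image q \<subseteq> path_image g" "pathstart q = pathfinish e" "pathfinish q = pathstart e"
    using path_contains_arc[OF g(1,3,4) ne] by blast
  let ?J = "path_image (e +++ q)"
  have J: "?J = path_image e \<union> path_image q" using q by (simp add: path_image_join)
  have sub: "path_image e \<inter> path_image q \<subseteq> {pathstart e, pathstart q}"
    using Ke q(2,3) g(2) by auto
  have "simple_path (e +++ q)"
    using simple_path_join_loop[OF e q(1)] q sub by simp
  moreover have "pathfinish (e +++ q) = pathstart (e +++ q)" using q by simp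
  ultimately have io: "frontier (inside ?J) = ?J" "frontier (outside ?J) = ?J"
     "inside ?J \<union> outside ?J = - ?J" "inside ?J \<inter> outside ?J = {}"
     using Jordan_inside_outside[of "e +++ q"] by auto
  let ?z = "e (1/2)"
  have zim: "?z \<in> path_image e" by (simp add: path_image_def)
  have inj: "inj_on e {0..1}" using e by (simp add: arc_def)
  have "?z \<noteq> e 0" "?z \<noteq> e 1" using inj_onD[OF inj, of "1/2" 0] inj_onD[OF inj, of "1/2" 1] by auto
  then have "?z \<notin> K" using zim Ke by (auto simp: pathstart_def pathfinish_def)
  then obtain r where r: "r > 0" "ball ?z r \<inter> K = {}"
    using K by (metis ComplI disjoint_eq_subset_Compl double_complement open_Compl open_contains_ball)
  have "?z \<in> closure (inside ?J)" "?z \<in> closure (outside ?J)"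
    using io J zim by (auto simp: frontier_def)
  then obtain a b where a: "a \<in> inside ?J" "dist a ?z < r" and b: "b \<in> outside ?J" "dist b ?z < r"
    using r(1) unfolding closure_approachable by blast
  have ab: "a \<in> ball ?z r" "b \<in> ball ?z r" using a b by (auto simp: dist_commute)
  have nJ: "a \<notin> ?J" "b \<notin> ?J" using a b io by blast+
  have sub: "- (K \<union> path_image e) \<subseteq> - ?J" using J q(2) g(2) by auto
  show ?thesis
  proof
    show "a \<notin> K \<union> path_image e" "b \<notin> K \<union> path_image e" using ab nJ J r by auto
    show "connected_component (- K) a b"
      unfolding connected_component_def
      by (rule exI[of _ "ball ?z r"]) (use ab r in auto)
    show "\<not> connected_component (- (K \<union> path_image e)) a b"
    proof
      assume "connected_component (- (K \<union> path_image e)) a b"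
      then have "connected_component (- ?J) a b"
        using sub connected_component_of_subset by blast
      then have "b \<in> inside ?J" using inside_same_component a by blast
      then show False using b io by blast
    qed
  qed
qed

section \<open>Euler's inequality and face boundaries\<close>

locale plane_drawing =
  fixes V :: "nat set" and F :: "(nat \<times> nat) set" and p :: "nat \<Rightarrow> complex"
    and c :: "nat \<times> nat \<Rightarrow> real \<Rightarrow> complex"
  assumes finV: "finite V" and FV: "F \<subseteq> V \<times> V"
    and arc: "\<And>u v. (u, v) \<in> F \<Longrightarrow> arc (c (u, v))"
    and start: "\<And>u v. (u, v) \<in> F \<Longrightarrow> pathstart (c (u, v)) = p u"
    and finish: "\<And>u v. (u, v) \<in> F \<Longrightarrow> pathfinish (c (u, v)) = p v"
    and vert: "\<And>u v. (u, v) \<in> F \<Longrightarrow> path_image (c (u, v)) \<inter> p ` V = {p u, p v}"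
    and cross: "\<And>u v u' v'. (u, v) \<in> F \<Longrightarrow> (u', v') \<in> F \<Longrightarrow> (u, v) \<noteq> (u', v') \<Longrightarrow>
       path_image (c (u, v)) \<inter> path_image (c (u', v')) \<subseteq> p ` ({u, v} \<inter> {u', v'})"
begin

definition drawn :: "(nat \<times> nat) set \<Rightarrow> complex set" where
  "drawn T = p ` V \<union> (\<Union>e\<in>T. path_image (c e))"

abbreviation same_face :: "complex \<Rightarrow> complex \<Rightarrow> bool" where
  "same_face \<equiv> connected_component (- drawn F)"

text \<open>The ends of the arc are excluded: many faces may touch an edge at a vertex, but at most
  two can touch it elsewhere.\<close>

definition borders :: "complex \<Rightarrow> (nat \<times> nat) set" where
  "borders a = {e \<in> F. closure (connected_component_set (- drawn F) a) \<inter>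
     (path_image (c e) - {p (fst e), p (snd e)}) \<noteq> {}}"

lemma finF: "finite F"
  using FV finV finite_subset by blast

lemma compact_edge: "e \<in> F \<Longrightarrow> compact (path_image (c e))"
  using arc arc_imp_path compact_path_image by (metis surj_pair)

lemma compact_drawn: "T \<subseteq> F \<Longrightarrow> compact (drawn T)"
  unfolding drawn_def using finV
  by (intro compact_Un compact_UN finite_imp_compact compact_edge finite_subset[OF _ finF]) auto

lemma drawn_insert: "drawn (insert e T) = drawn T \<union> path_image (c e)"
  by (auto simp: drawn_def)

lemma drawn_Int_edge:
  assumes "T \<subseteq> F" "(u, v) \<in> F" "(u, v) \<notin> T"
  shows "drawn T \<inter> path_image (c (u, v)) = {p u, p v}"
proof
  have uv: "u \<in> V" "v \<in> V" using assms(2) FV by auto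
  have "path_image (c e) \<inter> path_image (c (u, v)) \<subseteq> {p u, p v}" if "e \<in> T" for e
  proof -
    obtain u' v' where e: "e = (u', v')" by fastforce
    show ?thesis using cross[of u' v' u v] that assms unfolding e by fastforce
  qed
  then show "drawn T \<inter> path_image (c (u, v)) \<subseteq> {p u, p v}"
    using vert[OF assms(2)] unfolding drawn_def by blast
  show "{p u, p v} \<subseteq> drawn T \<inter> path_image (c (u, v))"
    using vert[OF assms(2)] uv by (auto simp: drawn_def)
qed

text \<open>\<open>P\<close> contains at most one point of each face and \<open>Q\<close> at least one vertex of each connected
  component of the drawing of \<open>T\<close>.\<close>

definition euler_witness :: "(nat \<times> nat) set \<Rightarrow> complex set \<Rightarrow> nat set \<Rightarrow> bool" where
  "euler_witness T P Q \<longleftrightarrow> finite P \<and> P \<inter> drawn T = {} \<and>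
     (\<forall>a\<in>P. \<forall>b\<in>P. a \<noteq> b \<longrightarrow> \<not> connected_component (- drawn T) a b) \<and> Q \<subseteq> V \<and>
     (\<forall>v\<in>V. \<exists>q\<in>Q. path_component (drawn T) (p v) (p q)) \<and>
     card T + 1 + card Q \<le> card P + card V"

text \<open>One half of Euler's formula, by adding edges one at a time: an edge inside a connected
  piece creates a face, an edge between two pieces merges them.\<close>

lemma many_faces:
  assumes "T \<subseteq> F"
  shows "\<exists>P Q. euler_witness T P Q"
  using finite_subset[OF assms finF] assms
proof (induction T rule: finite_induct)
  case empty
  have "bounded (p ` V)" using finV by (simp add: finite_imp_bounded)
  then have "p ` V \<noteq> UNIV" using not_bounded_UNIV by metis
  then obtain a where a: "a \<notin> p ` V" by blast
  have "path_component (p ` V) (p v) (p v)" if "v \<in> V" for v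
    using that by (simp add: path_component_refl_eq)
  then show ?case
    using a by (intro exI[of _ "{a}"] exI[of _ V]) (auto simp: drawn_def euler_witness_def)
next
  case (insert e T)
  obtain u v where e: "e = (u, v)" by fastforce
  have uvF: "(u, v) \<in> F" and TF: "T \<subseteq> F" using insert.prems e by auto
  have uv: "u \<in> V" "v \<in> V" using uvF FV by auto
  define K where "K = drawn T"
  define A where "A = path_image (c (u, v))"
  have K: "compact K" "closed K" using compact_drawn[OF TF] compact_imp_closed by (auto simp: K_def)
  have KA: "K \<inter> A = {p u, p v}" using drawn_Int_edge[OF TF uvF] insert.hyps e by (simp add: K_def A_def)
  have compA: "compact A" using compact_edge[OF uvF] by (simp add: A_def)
  have dr: "drawn (insert e T) = K \<union> A" by (simp add: drawn_insert e K_def A_def)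
  obtain P Q where PQ: "euler_witness T P Q" using insert.IH[OF TF] by blast
  have P: "finite P" "P \<inter> K = {}"
      "\<And>a b. a \<in> P \<Longrightarrow> b \<in> P \<Longrightarrow> a \<noteq> b \<Longrightarrow> \<not> connected_component (- K) a b"
    and Q: "Q \<subseteq> V" "\<And>v. v \<in> V \<Longrightarrow> \<exists>q\<in>Q. path_component K (p v) (p q)"
    and card: "card T + 1 + card Q \<le> card P + card V"
    using PQ by (simp_all add: euler_witness_def K_def)
  \<comment> \<open>A point of \<open>P\<close> may lie on the new arc; it is replaced by a point of
    the same face off the arc.\<close>
  have "\<exists>y. y \<notin> A \<and> connected_component (- K) x y" if "x \<in> P" for x
    using component_not_subset_compact[OF K(2) compA _, of x] that P(2) KA by auto
  then obtain f where f: "\<And>x. x \<in> P \<Longrightarrow> f x \<notin> A" "\<And>x. x \<in> P \<Longrightarrow> connected_component (- K) x (f x)"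
    by metis
  have fsep: "\<not> connected_component (- K) (f a) (f b)" if "a \<in> P" "b \<in> P" "a \<noteq> b" for a b
    using f(2) P(3)[OF that] that by (meson connected_component_sym connected_component_trans)
  have fK: "f a \<notin> K" if "a \<in> P" for a
    using f(2)[OF that] by (meson ComplD connected_component_in)
  have injf: "inj_on f P"
    using fsep fK by (metis ComplI connected_component_refl inj_onI)
  define P' where "P' = f ` P"
  have P': "finite P'" "P' \<inter> (K \<union> A) = {}" "card P' = card P"
    using P(1) f fK injf by (auto simp: P'_def card_image)
  have sepP': "\<not> connected_component (- K) a b" if "a \<in> P'" "b \<in> P'" "a \<noteq> b" for a b
    using that fsep unfolding P'_def by blast
  have mono: "connected_component (- (K \<union> A)) a b \<Longrightarrow> connected_component (- K) a b" for a b
    by (erule connected_component_of_subset) auto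
  have pmono: "path_component K x y \<Longrightarrow> path_component (K \<union> A) x y" for x y
    by (erule path_component_of_subset[rotated]) auto
  show ?case
  proof (cases "path_component K (p u) (p v)")
    case True
    obtain a b where ab: "a \<notin> K \<union> A" "b \<notin> K \<union> A" "connected_component (- K) a b"
      "\<not> connected_component (- (K \<union> A)) a b"
      using arc_splits_component[OF K(2) arc[OF uvF]] KA True start[OF uvF] finish[OF uvF]
      unfolding A_def by metis
    \<comment> \<open>Only the sample point of the face being split, if there is one, is dropped;
      \<open>a\<close> and \<open>b\<close> take its place.\<close>
    define P0 where "P0 = {x \<in> P'. \<not> connected_component (- K) a x}"
    define P2 where "P2 = insert a (insert b P0)"
    have "card (P' - P0) \<le> 1"
    proof -
      have "x = y" if "x \<in> P' - P0" "y \<in> P' - P0" for x y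
        using that sepP'[of x y] unfolding P0_def
        by (metis (no_types, lifting) Diff_iff connected_component_sym connected_component_trans mem_Collect_eq)
      then have "\<exists>x. P' - P0 \<subseteq> {x}" by blast
      then obtain x where "P' - P0 \<subseteq> {x}" by blast
      then show ?thesis using card_mono[of "{x}" "P' - P0"] by simp
    qed
    moreover have "card P' = card P0 + card (P' - P0)"
      using P'(1) by (metis P0_def card_Diff_subset card_mono finite_subset le_add_diff_inverse mem_Collect_eq subsetI)
    moreover have "card P2 = card P0 + 2"
    proof -
      have "a \<noteq> b" using ab by auto
      moreover have "a \<notin> P0" "b \<notin> P0"
        using ab by (auto simp: P0_def)
      moreover have "finite P0" using P'(1) by (simp add: P0_def)
      ultimately show ?thesis by (simp add: P2_def)
    qed
    ultimately have cP2: "card P + 1 \<le> card P2" using P'(3) by linarith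
    have "\<not> connected_component (- (K \<union> A)) x y" if "x \<in> P2" "y \<in> P2" "x \<noteq> y" for x y
    proof -
      have 1: "\<not> connected_component (- (K \<union> A)) a x" if "x \<in> P0" for x
        using that mono by (auto simp: P0_def)
      have 2: "\<not> connected_component (- (K \<union> A)) b x" if "x \<in> P0" for x
        using that mono ab(3) by (metis (mono_tags, lifting) P0_def connected_component_trans mem_Collect_eq)
      have 3: "\<not> connected_component (- (K \<union> A)) x y" if "x \<in> P0" "y \<in> P0" "x \<noteq> y" for x y
        using that sepP' mono by (auto simp: P0_def)
      show ?thesis
        using that 1 2 3 ab(4) unfolding P2_def by (metis connected_component_sym insertE)
    qed
    moreover have "finite P2" "P2 \<inter> (K \<union> A) = {}"
      using P' ab by (auto simp: P2_def P0_def)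
    moreover have "\<forall>v\<in>V. \<exists>q\<in>Q. path_component (K \<union> A) (p v) (p q)"
      using Q(2) pmono by blast
    moreover have "card (insert e T) + 1 + card Q \<le> card P2 + card V"
      using card cP2 insert.hyps by simp
    ultimately show ?thesis using Q(1)
      by (intro exI[of _ P2] exI[of _ Q]) (simp add: euler_witness_def dr)
  next
    case False
    obtain q1 where q1: "q1 \<in> Q" "path_component K (p u) (p q1)" using Q(2) uv by blast
    obtain q2 where q2: "q2 \<in> Q" "path_component K (p v) (p q2)" using Q(2) uv by blast
    have "q1 \<noteq> q2" using q1 q2 False by (meson path_component_sym path_component_trans)
    define Q' where "Q' = Q - {q2}"
    have "path_component A (p u) (p v)"
      unfolding path_component_def A_def
      using arc[OF uvF] start[OF uvF] finish[OF uvF] arc_imp_path by blast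
    then have uvc: "path_component (K \<union> A) (p u) (p v)"
      by (rule path_component_of_subset[rotated]) auto
    have "\<exists>q\<in>Q'. path_component (K \<union> A) (p w) (p q)" if w: "w \<in> V" for w
    proof -
      obtain q where q: "q \<in> Q" "path_component K (p w) (p q)" using Q(2)[OF w] by blast
      show ?thesis
      proof (cases "q = q2")
        case True
        have "path_component (K \<union> A) (p w) (p q1)"
          using pmono[OF q(2)] pmono[OF q2(2)] pmono[OF q1(2)] uvc True
          by (meson path_component_sym path_component_trans)
        then show ?thesis using q1(1) \<open>q1 \<noteq> q2\<close> by (auto simp: Q'_def)
      next
        case False
        then show ?thesis using q pmono by (auto simp: Q'_def)
      qed
    qed
    moreover have "card Q = card Q' + 1"
      using card_Suc_Diff1[OF finite_subset[OF Q(1) finV] q2(1)] by (simp add: Q'_def)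
    moreover have "Q' \<subseteq> V" using Q(1) by (auto simp: Q'_def)
    moreover have "\<forall>a\<in>P'. \<forall>b\<in>P'. a \<noteq> b \<longrightarrow> \<not> connected_component (- (K \<union> A)) a b"
      using sepP' mono by blast
    ultimately show ?thesis
      using P' card insert.hyps
      by (intro exI[of _ P'] exI[of _ Q']) (auto simp: euler_witness_def dr)
  qed
qed

text \<open>Once \<open>e\<close> is erased, all three faces lie in the one component that contains
  the open arc of \<open>e\<close>. Putting \<open>e\<close> back splits this component into at most
  two parts.\<close>

lemma edge_borders_at_most_two:
  assumes eF: "e \<in> F" and inb: "e \<in> borders x" "e \<in> borders y" "e \<in> borders z"
    and out: "x \<notin> drawn F" "y \<notin> drawn F" "z \<notin> drawn F"
    and sep: "\<not> same_face x y" "\<not> same_face x z" "\<not> same_face y z"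
  shows False
proof -
  obtain u v where e: "e = (u, v)" by fastforce
  have uvF: "(u, v) \<in> F" using eF e by simp
  define K where "K = drawn (F - {e})"
  define A where "A = path_image (c e)"
  have K: "compact K" unfolding K_def by (rule compact_drawn) auto
  have KA: "K \<inter> A = {p u, p v}" unfolding K_def A_def e
    by (rule drawn_Int_edge) (use uvF in auto)
  have dr: "drawn F = K \<union> A"
    using drawn_insert[of e "F - {e}"] eF by (simp add: K_def A_def insert_absorb)
  define O' where "O' = A - {p u, p v}"
  have arce: "arc (c e)" using arc[OF uvF] e by simp
  have "O' = c e ` {0<..<1}"
  proof -
    have inje: "inj_on (c e) {0..1}" using arce by (simp add: arc_def)
    have "p u = c e 0" "p v = c e 1"
      using start[OF uvF] finish[OF uvF] e by (auto simp: pathstart_def pathfinish_def)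
    moreover have "{0..1::real} = {0<..<1} \<union> {0, 1}" by auto
    ultimately have "A = c e ` {0<..<1} \<union> {p u, p v}" unfolding A_def path_image_def by auto
    moreover have "c e 0 \<notin> c e ` {0<..<1}" "c e 1 \<notin> c e ` {0<..<1}"
      using inj_onD[OF inje] by fastforce+
    ultimately show ?thesis using \<open>p u = c e 0\<close> \<open>p v = c e 1\<close> by (auto simp: O'_def)
  qed
  moreover have "continuous_on {0<..<1} (c e)"
    using arce by (meson arc_def continuous_on_subset greaterThanLessThan_subseteq_atLeastAtMost_iff order_refl path_def)
  ultimately have connO: "connected O'"
    using connected_continuous_image connected_Ioo by metis
  have O'K: "O' \<subseteq> - K" using KA by (auto simp: O'_def)
  have near: "\<exists>s\<in>O'. connected_component (- K) x s" if b: "e \<in> borders x" and o: "x \<notin> drawn F" for x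
  proof -
    obtain s where s: "s \<in> O'" "s \<in> closure (connected_component_set (- drawn F) x)"
      using b by (auto simp: borders_def O'_def A_def e)
    obtain r where r: "r > 0" "ball s r \<subseteq> - K"
      using s(1) O'K K by (meson compact_imp_closed open_Compl open_contains_ball subsetD)
    obtain t where t: "connected_component (- drawn F) x t" "dist t s < r"
      using s(2) r(1) unfolding closure_approachable by blast
    have "connected_component (- K) x t"
      using t(1) by (rule connected_component_of_subset) (auto simp: dr)
    moreover have "connected_component (- K) t s"
      unfolding connected_component_def
      by (rule exI[of _ "ball s r"]) (use r t in \<open>auto simp: dist_commute\<close>)
    ultimately show ?thesis using s(1) connected_component_trans by metis
  qed
  have all: "connected_component (- K) x y"
    if x: "e \<in> borders x" "x \<notin> drawn F" and y: "e \<in> borders y" "y \<notin> drawn F" for x y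
  proof -
    obtain s t where s: "s \<in> O'" "connected_component (- K) x s" and t: "t \<in> O'" "connected_component (- K) y t"
      using near[OF x] near[OF y] by blast
    have "connected_component (- K) s t"
      unfolding connected_component_def using connO O'K s t by blast
    then show ?thesis using s t by (meson connected_component_sym connected_component_trans)
  qed
  show False
    using arc_splits_into_at_most_two[of K A "p u" "p v" x z y] sep
     K compact_edge[OF eF] KA connected_arc_complement[OF arce] all inb out
    unfolding dr A_def by auto
qed

text \<open>The frontier of the face of \<open>a\<close> consists of points on bordering edges and
  of vertices, and deleting finitely many vertices does not disconnect an open connected set of the
  plane.\<close>

lemma border_separates:
  assumes "a \<notin> drawn F" "b \<notin> drawn F" and sep: "\<not> same_face a b"
  shows "\<not> connected (- (\<Union>e\<in>borders a. path_image (c e)))"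
proof
  define L where "L = (\<Union>e\<in>borders a. path_image (c e))"
  assume "connected (- (\<Union>e\<in>borders a. path_image (c e)))"
  then have conn: "connected (- L)" by (simp add: L_def)
  have bF: "borders a \<subseteq> F" by (auto simp: borders_def)
  have "closed L" unfolding L_def
    by (intro closed_UN ballI compact_imp_closed compact_edge finite_subset[OF bF finF]) (use bF in auto)
  then have conn: "connected (- L - p ` V)"
    using conn finV by (intro connected_open_diff_countable) (auto simp: countable_finite)
  define A where "A = connected_component_set (- drawn F) a"
  have aA: "a \<in> A" "b \<notin> A" using assms by (auto simp: A_def)
  have Ld: "L \<union> p ` V \<subseteq> drawn F" using bF by (auto simp: L_def drawn_def)
  have "closed (drawn F)" using compact_drawn compact_imp_closed by blast
  then have "frontier A \<subseteq> drawn F"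
    unfolding A_def using frontier_of_connected_component_subset[of "- drawn F" a]
    by (metis frontier_complement frontier_subset_closed subset_trans)
  have "frontier A \<subseteq> L \<union> p ` V"
  proof
    fix z assume z: "z \<in> frontier A"
    show "z \<in> L \<union> p ` V"
    proof (cases "z \<in> p ` V")
      case False
      then obtain e where e: "e \<in> F" "z \<in> path_image (c e)"
        using z \<open>frontier A \<subseteq> drawn F\<close> by (auto simp: drawn_def)
      have "fst e \<in> V" "snd e \<in> V" using e(1) FV by auto
      then have "z \<in> path_image (c e) - {p (fst e), p (snd e)}" using e False by auto
      moreover have "z \<in> closure A" using z by (simp add: frontier_def)
      ultimately have "e \<in> borders a" using e(1) by (auto simp: borders_def A_def)
      then show ?thesis using e by (auto simp: L_def)
    qed auto
  qed
  moreover have "(- L - p ` V) \<inter> A \<noteq> {}" "(- L - p ` V) - A \<noteq> {}"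
    using aA Ld assms(1,2) by blast+
  ultimately show False using connected_Int_frontier[OF conn, of A] by blast
qed

text \<open>An edge with a private end \<open>x\<close> meets the other edges at most in its other
  end, so Janiszewski's theorem adds it back without separating the plane.\<close>

lemma leaf_elimination_connected:
  assumes "T \<subseteq> F" and "\<And>T'. T' \<subseteq> T \<Longrightarrow> T' \<noteq> {} \<Longrightarrow> \<exists>x. card {e \<in> T'. x = fst e \<or> x = snd e} = 1"
  shows "connected (- (\<Union>e\<in>T. path_image (c e)))"
  using finite_subset[OF assms(1) finF] assms
proof (induction T rule: finite_psubset_induct)
  case (psubset T)
  show ?case
  proof (cases "T = {}")
    case False
    then obtain x where "card {e \<in> T. x = fst e \<or> x = snd e} = 1" using psubset.prems(2)[of T] by blast
    then obtain e where e: "{e \<in> T. x = fst e \<or> x = snd e} = {e}" using card_1_singletonE by blast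
    define T' where "T' = T - {e}"
    have eT: "e \<in> T" "x = fst e \<or> x = snd e" using e by blast+
    have eF: "e \<in> F" using eT psubset.prems by blast
    obtain y where y: "{fst e, snd e} = {x, y}" using eT by blast
    have T'T: "T' \<subset> T" using eT by (auto simp: T'_def)
    have "connected (- (\<Union>e\<in>T'. path_image (c e)))"
    proof (rule psubset.IH[OF T'T])
      show "T' \<subseteq> F" using T'T psubset.prems(1) by blast
      show "\<exists>x. card {e \<in> T''. x = fst e \<or> x = snd e} = 1" if "T'' \<subseteq> T'" "T'' \<noteq> {}" for T''
        using psubset.prems(2)[of T''] that T'T by blast
    qed
    moreover have "path_image (c e) \<inter> path_image (c e') \<subseteq> {p y}" if "e' \<in> T'" for e'
    proof -
      have "e' \<in> F" "e' \<noteq> e" "e' \<in> T" using that T'T psubset.prems by (auto simp: T'_def)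
      moreover have "x \<noteq> fst e'" "x \<noteq> snd e'" using e that \<open>e' \<in> T\<close> \<open>e' \<noteq> e\<close> by blast+
      ultimately have "path_image (c e) \<inter> path_image (c e') \<subseteq> p ` ({fst e, snd e} \<inter> {fst e', snd e'})"
        using cross[of "fst e" "snd e" "fst e'" "snd e'"] eF by auto
      also have "\<dots> \<subseteq> {p y}" unfolding y using \<open>x \<noteq> fst e'\<close> \<open>x \<noteq> snd e'\<close> by auto
      finally show ?thesis .
    qed
    then have "path_image (c e) \<inter> (\<Union>e\<in>T'. path_image (c e)) \<subseteq> {p y}" by blast
    then have "connected (path_image (c e) \<inter> (\<Union>e\<in>T'. path_image (c e)))"
      by (metis connected_empty connected_sing subset_singletonD)
    moreover have "closed (\<Union>e\<in>T'. path_image (c e))"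
      using T'T psubset.prems(1)
      by (intro closed_UN ballI compact_imp_closed compact_edge finite_subset[OF _ finF]) auto
    moreover have "connected (- path_image (c e))"
      using connected_arc_complement[of "c e"] arc[of "fst e" "snd e"] eF by simp
    ultimately have "connected (- (path_image (c e) \<union> (\<Union>e\<in>T'. path_image (c e))))"
      using Janiszewski_connected compact_edge[OF eF] by blast
    moreover have "path_image (c e) \<union> (\<Union>e\<in>T'. path_image (c e)) = (\<Union>e\<in>T. path_image (c e))"
      using eT by (auto simp: T'_def)
    ultimately show ?thesis by simp
  qed (simp add: connected_UNIV)
qed

text \<open>If \<open>card V \<le> card F\<close> there are at least two faces, so every border
  separates, is not eliminable leaf by leaf, and contains at least \<open>g\<close> marked edges.
  Each marked edge is counted at most twice, hence \<open>g\<close> times the number of sample faces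
  is at most \<open>2 * card X\<close>. The first alternative covers drawings that may have a single
  face.\<close>

theorem euler_bound:
  assumes X: "X \<subseteq> F" and V: "V \<noteq> {}"
    and leaf: "\<And>T. T \<subseteq> F \<Longrightarrow> T \<noteq> {} \<Longrightarrow> card (T \<inter> X) < g \<Longrightarrow> \<exists>x. card {e \<in> T. x = fst e \<or> x = snd e} = 1"
  shows "card F < card V \<or> g * (card F + 2) \<le> g * card V + 2 * card X"
proof (rule disjCI[THEN disj_commute[THEN iffD1]])
  assume "\<not> card F < card V"
  then have mn: "card V \<le> card F" by simp
  obtain P Q where PQ: "euler_witness F P Q" using many_faces by blast
  have P: "finite P" "P \<inter> drawn F = {}"
      "\<And>a b. a \<in> P \<Longrightarrow> b \<in> P \<Longrightarrow> a \<noteq> b \<Longrightarrow> \<not> same_face a b"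
    and Q: "Q \<subseteq> V" "\<And>v. v \<in> V \<Longrightarrow> \<exists>q\<in>Q. path_component (drawn F) (p v) (p q)"
    and cardP: "card F + 1 + card Q \<le> card P + card V"
    using PQ by (simp_all add: euler_witness_def)
  have "Q \<noteq> {}" using Q(2) V by blast
  then have "card Q \<ge> 1" using finite_subset[OF Q(1) finV] by (simp add: Suc_leI card_gt_0_iff)
  with cardP have cP: "card F + 2 \<le> card P + card V" by simp
  have big: "g \<le> card (borders a \<inter> X)" if a: "a \<in> P" for a
  proof (rule ccontr)
    assume small: "\<not> g \<le> card (borders a \<inter> X)"
    have "card (P - {a}) \<ge> 1" using cP mn a P(1) by simp
    then have "P - {a} \<noteq> {}" by (metis card.empty not_one_le_zero)
    then obtain b where b: "b \<in> P" "b \<noteq> a" by blast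
    have bF: "borders a \<subseteq> F" by (auto simp: borders_def)
    have "connected (- (\<Union>e\<in>borders a. path_image (c e)))"
    proof (rule leaf_elimination_connected[OF bF])
      fix T' assume T': "T' \<subseteq> borders a" "T' \<noteq> {}"
      have "card (T' \<inter> X) \<le> card (borders a \<inter> X)"
        using T' bF finF by (intro card_mono) (auto intro: finite_subset)
      then show "\<exists>x. card {e \<in> T'. x = fst e \<or> x = snd e} = 1"
        using leaf[of T'] T' bF small by (meson le_trans not_le subset_trans)
    qed
    then show False using border_separates[of a b] a b P by blast
  qed
  have two: "card {a \<in> P. e \<in> borders a} \<le> 2" if e: "e \<in> X" for e
  proof (rule ccontr)
    assume "\<not> ?thesis"
    then have "3 \<le> card {a \<in> P. e \<in> borders a}" by simp
    then obtain S where S: "S \<subseteq> {a \<in> P. e \<in> borders a}" "card S = 3"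
      using obtain_subset_with_card_n by metis
    then obtain x y z where "S = {x, y, z}" "x \<noteq> y" "x \<noteq> z" "y \<noteq> z"
      by (auto simp: numeral_3_eq_3 card_Suc_eq)
    then show False
      using edge_borders_at_most_two[of e x y z] S P X e by blast
  qed
  have "g * card P \<le> (\<Sum>a\<in>P. card (borders a \<inter> X))"
    using sum_bounded_below[of P g "\<lambda>a. card (borders a \<inter> X)"] big by (simp add: mult.commute)
  also have "\<dots> = (\<Sum>a\<in>P. \<Sum>e\<in>X. of_bool (e \<in> borders a))"
    using finite_subset[OF X finF] by (intro sum.cong refl) (simp add: sum_of_bool_eq Int_def conj_commute)
  also have "\<dots> = (\<Sum>e\<in>X. \<Sum>a\<in>P. of_bool (e \<in> borders a))" by (rule sum.swap)
  also have "\<dots> = (\<Sum>e\<in>X. card {a \<in> P. e \<in> borders a})"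
    using P(1) by (intro sum.cong refl) (simp add: sum_of_bool_eq Int_def)
  also have "\<dots> \<le> 2 * card X"
    using sum_bounded_above[of X "\<lambda>e. card {a \<in> P. e \<in> borders a}" 2] two by (simp add: mult.commute)
  finally have "g * card P \<le> 2 * card X" .
  moreover have "g * (card F + 2) \<le> g * (card P + card V)" using cP by (rule mult_le_mono2)
  ultimately show "g * (card F + 2) \<le> g * card V + 2 * card X" by (simp add: algebra_simps)
qed

end

section \<open>Sparsity of planar graphs\<close>

lemma other_edge_if_no_leaf:
  assumes "finite T" and "\<nexists>x. card {e \<in> T. x = fst e \<or> x = snd e} = 1"
    and "e \<in> T" "x = fst e \<or> x = snd e"
  obtains e' where "e' \<in> T" "e' \<noteq> e" "x = fst e' \<or> x = snd e'"
proof -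
  let ?I = "{e \<in> T. x = fst e \<or> x = snd e}"
  have "?I \<noteq> {e}" using assms(2) by (metis is_singletonI is_singleton_altdef)
  moreover have "e \<in> ?I" using assms by simp
  ultimately show ?thesis using that by blast
qed

lemma finite_neighbours:
  assumes "simple_graph V E"
  shows "finite (E `` {v})"
  by (rule finite_subset[of _ V]) (use assms in \<open>auto simp: simple_graph_def\<close>)

text \<open>\<open>planar\<close> constrains curves only for edges written with the smaller end
  first, whereas applications direct edges between vertex classes. Sorting the ends is injective on
  \<open>F\<close> because no edge occurs in both directions.\<close>

lemma planar_oriented_bound:
  assumes G: "simple_graph V E" "planar V E" and Y: "Y \<subseteq> V" "Y \<noteq> {}"
    and F: "F \<subseteq> E \<inter> Y \<times> Y" and orient: "\<And>u v. (u, v) \<in> F \<Longrightarrow> (v, u) \<notin> F" and X: "X \<subseteq> F"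
    and leaf: "\<And>T. T \<subseteq> F \<Longrightarrow> T \<noteq> {} \<Longrightarrow> card (T \<inter> X) < g \<Longrightarrow> \<exists>x. card {e \<in> T. x = fst e \<or> x = snd e} = 1"
  shows "card F < card Y \<or> g * (card F + 2) \<le> g * card Y + 2 * card X"
proof -
  define drawing :: "(nat \<Rightarrow> complex) \<Rightarrow> (nat \<times> nat \<Rightarrow> real \<Rightarrow> complex) \<Rightarrow> bool" where
    "drawing p c \<longleftrightarrow> inj_on p V \<and>
      (\<forall>(u, v)\<in>E. u < v \<longrightarrow>
          arc (c (u, v)) \<and> pathstart (c (u, v)) = p u \<and> pathfinish (c (u, v)) = p v \<and>
          path_image (c (u, v)) \<inter> p ` V = {p u, p v}) \<and>
      (\<forall>(u, v)\<in>E. \<forall>(u', v')\<in>E. u < v \<longrightarrow> u' < v' \<longrightarrow> (u, v) \<noteq> (u', v') \<longrightarrow>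
          path_image (c (u, v)) \<inter> path_image (c (u', v')) \<subseteq> p ` ({u, v} \<inter> {u', v'}))" for p c
  have "\<exists>p c. drawing p c" using G(2) unfolding planar_def drawing_def .
  then obtain p c where "drawing p c" by blast
  note pc = this[unfolded drawing_def]
  have P1: "arc (c (u, v)) \<and> pathstart (c (u, v)) = p u \<and> pathfinish (c (u, v)) = p v \<and>
          path_image (c (u, v)) \<inter> p ` V = {p u, p v}" if "(u, v) \<in> E" "u < v" for u v
    using bspec[OF conjunct1[OF conjunct2[OF pc]] that(1)] that(2) by simp
  have P2: "path_image (c (u, v)) \<inter> path_image (c (u', v')) \<subseteq> p ` ({u, v} \<inter> {u', v'})"
    if "(u, v) \<in> E" "(u', v') \<in> E" "u < v" "u' < v'" "(u, v) \<noteq> (u', v')" for u v u' v'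
  proof -
    have "\<forall>(u', v')\<in>E. u < v \<longrightarrow> u' < v' \<longrightarrow> (u, v) \<noteq> (u', v') \<longrightarrow>
          path_image (c (u, v)) \<inter> path_image (c (u', v')) \<subseteq> p ` ({u, v} \<inter> {u', v'})"
      using bspec[OF conjunct2[OF conjunct2[OF pc]] that(1)] by simp
    from bspec[OF this that(2)] that(3-5) show ?thesis by simp
  qed
  have sg: "finite V" "E \<subseteq> V \<times> V" "sym E" "\<And>x. (x, x) \<notin> E" using G(1) by (auto simp: simple_graph_def)
  define nm where "nm e = (min (fst e) (snd e), max (fst e) (snd e))" for e :: "nat \<times> nat"
  define F' where "F' = nm ` F"
  have injn: "inj_on nm F"
  proof (rule inj_onI)
    fix e e' assume ee: "e \<in> F" "e' \<in> F" "nm e = nm e'"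
    obtain u v u' v' where e: "e = (u, v)" "e' = (u', v')" by fastforce
    show "e = e'" using ee orient[of u v] orient[of u' v'] unfolding nm_def e
      by (auto simp: min_def max_def split: if_splits)
  qed
  have F': "(u, v) \<in> E \<and> u < v \<and> u \<in> Y \<and> v \<in> Y" if uv: "(u, v) \<in> F'" for u v
  proof -
    obtain a b where ab: "(a, b) \<in> F" "(u, v) = nm (a, b)" using uv by (auto simp: F'_def)
    have "(a, b) \<in> E" "(b, a) \<in> E" "a \<noteq> b" "a \<in> Y" "b \<in> Y" using ab(1) F sg by (auto dest: symD)
    then show ?thesis using ab(2) by (auto simp: nm_def min_def max_def)
  qed
  have fst_snd_nm: "x = fst (nm e) \<or> x = snd (nm e) \<longleftrightarrow> x = fst e \<or> x = snd e" for x e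
    by (auto simp: nm_def min_def max_def)
  interpret plane_drawing Y F' p c
  proof
    show "finite Y" using Y sg finite_subset by blast
    show "F' \<subseteq> Y \<times> Y" using F' by auto
    fix u v assume uv: "(u, v) \<in> F'"
    note uv' = F'[OF uv]
    show "arc (c (u, v))" "pathstart (c (u, v)) = p u" "pathfinish (c (u, v)) = p v"
      using P1[of u v] uv' by auto
    have "path_image (c (u, v)) \<inter> p ` V = {p u, p v}" using P1[of u v] uv' by auto
    then show "path_image (c (u, v)) \<inter> p ` Y = {p u, p v}" using Y uv' by blast
    fix u' v' assume "(u', v') \<in> F'" "(u, v) \<noteq> (u', v')"
    then show "path_image (c (u, v)) \<inter> path_image (c (u', v')) \<subseteq> p ` ({u, v} \<inter> {u', v'})"
      using P2[of u v u' v'] uv' F'[of u' v'] by blast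
  qed
  have "card F' < card Y \<or> g * (card F' + 2) \<le> g * card Y + 2 * card (nm ` X)"
  proof (rule euler_bound)
    show "nm ` X \<subseteq> F'" using X by (auto simp: F'_def)
    show "Y \<noteq> {}" by fact
    fix T assume T: "T \<subseteq> F'" "T \<noteq> {}" "card (T \<inter> nm ` X) < g"
    obtain T0 where T0: "T0 \<subseteq> F" "T = nm ` T0" using T(1) unfolding F'_def by (meson subset_imageE)
    have injT: "inj_on nm T0" using injn T0 inj_on_subset by blast
    have "nm ` (T0 \<inter> X) = T \<inter> nm ` X"
      unfolding T0(2) using inj_on_image_Int[OF injn T0(1) X] by simp
    then have "card (T0 \<inter> X) < g"
      using T(3) card_image[OF inj_on_subset[OF injT Int_lower1, of X]] by simp
    moreover have "T0 \<noteq> {}" using T T0 by auto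
    ultimately obtain x where x: "card {e \<in> T0. x = fst e \<or> x = snd e} = 1"
      using leaf[OF T0(1)] by blast
    have "{e \<in> T. x = fst e \<or> x = snd e} = nm ` {e \<in> T0. x = fst e \<or> x = snd e}"
    proof -
      have "{e \<in> nm ` T0. P e} = nm ` {e \<in> T0. P (nm e)}" for P by auto
      then show ?thesis unfolding T0(2) by (simp only: fst_snd_nm)
    qed
    then have "card {e \<in> T. x = fst e \<or> x = snd e} = 1"
      using x card_image[OF inj_on_subset[OF injT], of "{e \<in> T0. x = fst e \<or> x = snd e}"] by simp
    then show "\<exists>x. card {e \<in> T. x = fst e \<or> x = snd e} = 1" by blast
  qed
  moreover have "card F' = card F" using injn by (simp add: F'_def card_image)
  moreover have "card (nm ` X) = card X" using inj_on_subset[OF injn X] by (rule card_image)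
  ultimately show ?thesis by simp
qed

text \<open>Euler's inequality with \<open>g = 4\<close> and all edges marked: a cycle in a
  bipartite graph has at least four edges.\<close>

lemma bipartite_planar_edges:
  assumes G: "simple_graph V E" "planar V E" and bip: "bipartite V E" and Y: "Y \<subseteq> V"
    and F: "F \<subseteq> E \<inter> Y \<times> Y" and orient: "\<And>u v. (u, v) \<in> F \<Longrightarrow> (v, u) \<notin> F"
  shows "card F \<le> 2 * card Y"
proof (cases "Y = {}")
  case True
  then show ?thesis using F by simp
next
  case False
  have sg: "finite V" "E \<subseteq> V \<times> V" "sym E" "\<And>x. (x, x) \<notin> E" using G(1) by (auto simp: simple_graph_def)
  obtain A where A: "\<And>u v. (u, v) \<in> E \<Longrightarrow> u \<in> A \<longleftrightarrow> v \<notin> A" using bip unfolding bipartite_def by fast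
  have finF: "finite F" using F sg Y by (meson finite_SigmaI finite_subset le_inf_iff)
  have "card F < card Y \<or> 4 * (card F + 2) \<le> 4 * card Y + 2 * card F"
  proof (rule planar_oriented_bound[OF G Y False F orient order_refl])
    fix T assume T: "T \<subseteq> F" "T \<noteq> {}" "card (T \<inter> F) < 4"
    have finT: "finite T" using T finF finite_subset by blast
    show "\<exists>x. card {e \<in> T. x = fst e \<or> x = snd e} = 1"
    proof (rule ccontr)
      assume noleaf: "\<nexists>x. card {e \<in> T. x = fst e \<or> x = snd e} = 1"
      \<comment> \<open>Continuing from both ends of one edge gives a path \<open>v'\<close>,
        \<open>u\<close>, \<open>v\<close>, \<open>u'\<close>; the two colours force the next edge
        at \<open>v'\<close> to be a fourth one.\<close>
      obtain u v where uv: "(u, v) \<in> T" using T(2) by auto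
      obtain e1 where e1: "e1 \<in> T" "e1 \<noteq> (u, v)" "u = fst e1 \<or> u = snd e1"
        using other_edge_if_no_leaf[OF finT noleaf uv, of u] by auto
      obtain e2 where e2: "e2 \<in> T" "e2 \<noteq> (u, v)" "v = fst e2 \<or> v = snd e2"
        using other_edge_if_no_leaf[OF finT noleaf uv, of v] by auto
      define v' where "v' = (if u = fst e1 then snd e1 else fst e1)"
      define u' where "u' = (if v = fst e2 then snd e2 else fst e2)"
      have edge: "(a, b) \<in> E \<and> (b, a) \<in> E" if "(a, b) \<in> T" for a b
        using that T(1) F sg(3) by (auto dest: symD)
      have E1: "e1 = (u, v') \<or> e1 = (v', u)" and E2: "e2 = (v, u') \<or> e2 = (u', v)"
        using e1 e2 by (auto simp: v'_def u'_def prod_eq_iff)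
      have col: "u \<in> A \<longleftrightarrow> v \<notin> A" "u \<in> A \<longleftrightarrow> v' \<notin> A" "v \<in> A \<longleftrightarrow> u' \<notin> A"
        using A edge uv e1(1) e2(1) E1 E2 by blast+
      have ne: "v' \<noteq> v" "u' \<noteq> u" using E1 E2 e1 e2 uv T(1) orient by blast+
      obtain e3 where e3: "e3 \<in> T" "e3 \<noteq> e1" "v' = fst e3 \<or> v' = snd e3"
        using other_edge_if_no_leaf[OF finT noleaf e1(1), of v'] E1 by (metis fst_conv snd_conv)
      have "e1 \<noteq> e2" using E1 E2 col ne by auto
      moreover have "e3 \<noteq> (u, v)" using e3(3) col ne by auto
      moreover have "e3 \<noteq> e2" using e3(3) E2 col ne by auto
      ultimately have "card {(u, v), e1, e2, e3} = 4" using e1 e2 e3 by auto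
      moreover have "{(u, v), e1, e2, e3} \<subseteq> T" using uv e1 e2 e3 by auto
      ultimately have "4 \<le> card T" using card_mono[OF finT] by metis
      then show False using T by (simp add: Int_absorb2)
    qed
  qed
  then show ?thesis by arith
qed

text \<open>\<open>U\<close> and \<open>X\<close> may overlap, and an edge inside the overlap is
  counted in both directions. The edge bound is therefore applied to the union and once more to the
  intersection, whose sizes add up to \<open>card U + card X\<close>.\<close>

lemma bipartite_planar_cross_edges:
  assumes G: "simple_graph V E" "planar V E" and bip: "bipartite V E" and UX: "U \<subseteq> V" "X \<subseteq> V"
  shows "card (E \<inter> U \<times> X) \<le> 2 * card U + 2 * card X"
proof -
  have sg: "finite V" "E \<subseteq> V \<times> V" "sym E" "\<And>x. (x, x) \<notin> E" using G(1) by (auto simp: simple_graph_def)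
  have fin: "finite U" "finite X" using UX sg finite_subset by blast+
  define L where "L = {(u, v). (u, v) \<in> E \<and> u < v}"
  have finL: "finite L" unfolding L_def
    by (rule finite_subset[of _ "V \<times> V"]) (use sg in auto)
  have "E \<inter> U \<times> X = (L \<inter> U \<times> X) \<union> prod.swap ` (L \<inter> X \<times> U)"
  proof -
    have "(u, v) \<in> E \<inter> U \<times> X \<longleftrightarrow> (u, v) \<in> L \<inter> U \<times> X \<or> (v, u) \<in> L \<inter> X \<times> U" for u v
      using sg(3,4) by (auto simp: L_def dest: symD) (metis linorder_neqE_nat)
    moreover have "(u, v) \<in> prod.swap ` A \<longleftrightarrow> (v, u) \<in> A" for u v and A :: "(nat \<times> nat) set"
      by (metis (no_types, lifting) image_iff prod.swap_def swap_swap fst_conv snd_conv)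
    ultimately show ?thesis by (auto simp: set_eq_iff simp del: Int_iff)
  qed
  then have "card (E \<inter> U \<times> X) \<le> card (L \<inter> U \<times> X) + card (prod.swap ` (L \<inter> X \<times> U))"
    by (simp add: card_Un_le)
  also have "\<dots> \<le> card (L \<inter> U \<times> X) + card (L \<inter> X \<times> U)"
    using finL by (simp add: card_image_le)
  also have "\<dots> = card (L \<inter> U \<times> X \<union> L \<inter> X \<times> U) + card ((L \<inter> U \<times> X) \<inter> (L \<inter> X \<times> U))"
    using finL by (intro card_Un_Int) auto
  also have "\<dots> \<le> 2 * card (U \<union> X) + 2 * card (U \<inter> X)"
  proof (rule add_mono)
    show "card (L \<inter> U \<times> X \<union> L \<inter> X \<times> U) \<le> 2 * card (U \<union> X)"
      by (rule bipartite_planar_edges[OF G bip]) (use UX in \<open>auto simp: L_def\<close>)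
    show "card ((L \<inter> U \<times> X) \<inter> (L \<inter> X \<times> U)) \<le> 2 * card (U \<inter> X)"
      by (rule bipartite_planar_edges[OF G bip]) (use UX in \<open>auto simp: L_def\<close>)
  qed
  also have "\<dots> = 2 * card U + 2 * card X"
    using card_Un_Int[OF fin] by simp
  finally show ?thesis .
qed

text \<open>The edge bound gives \<open>3 * card W \<le> 2 * (3 + card W)\<close>.\<close>

lemma no_K37:
  assumes G: "simple_graph V E" "planar V E" and bip: "bipartite V E"
    and d: "u \<noteq> v" "u \<noteq> a" "v \<noteq> a" and W: "W \<subseteq> E `` {u} \<inter> E `` {v} \<inter> E `` {a}"
  shows "card W \<le> 6"
proof (cases "W = {}")
  case False
  have sg: "finite V" "E \<subseteq> V \<times> V" "sym E" "\<And>x. (x, x) \<notin> E" using G(1) by (auto simp: simple_graph_def)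
  have fin: "finite W" using W finite_neighbours[OF G(1)] by (meson finite_subset le_inf_iff)
  have "card ({u, v, a} \<times> W) \<le> 2 * card ({u, v, a} \<union> W)"
  proof (rule bipartite_planar_edges[OF G bip])
    show "{u, v, a} \<union> W \<subseteq> V" using W False sg(2) by auto
    show "{u, v, a} \<times> W \<subseteq> E \<inter> ({u, v, a} \<union> W) \<times> ({u, v, a} \<union> W)" using W by auto
    show "(y, x) \<notin> {u, v, a} \<times> W" if "(x, y) \<in> {u, v, a} \<times> W" for x y using that W sg(4) by auto
  qed
  moreover have "card ({u, v, a} \<union> W) \<le> 3 + card W"
    using card_Un_le[of "{u, v, a}" W] d by simp
  moreover have "card ({u, v, a} \<times> W) = 3 * card W" using d by (simp add: card_cartesian_product)
  ultimately show ?thesis by linarith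
qed simp

text \<open>A star minor: every \<open>w\<close> is contracted into its dominator \<open>dm w\<close>, so \<open>s\<close> acquires one edge for
  each element of \<open>dm ` E `` {s}\<close>.\<close>

lemma star_minor_bound:
  assumes G: "simple_graph V E" "planar V E"
    and S: "S \<subseteq> V" and D: "D \<subseteq> V" and SD: "S \<inter> D = {}"
    and indep: "\<And>s. s \<in> S \<Longrightarrow> E `` {s} \<inter> S = {}"
    and dm: "\<And>s w. s \<in> S \<Longrightarrow> (s, w) \<in> E \<Longrightarrow> dm w \<in> D \<and> (dm w = w \<or> (w, dm w) \<in> E)"
    and dmD: "\<And>w. w \<in> D \<Longrightarrow> dm w = w"
    and h: "\<And>s. s \<in> S \<Longrightarrow> h \<le> card (dm ` (E `` {s}))"
  shows "h * card S \<le> 3 * (card D + card S)"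
proof (cases "S = {}")
  case False
  have sg: "finite V" "E \<subseteq> V \<times> V" "sym E" "\<And>x. (x, x) \<notin> E" using G(1) by (auto simp: simple_graph_def)
  have fin: "finite S" "finite D" using S D sg finite_subset by blast+
  define pick where "pick s d = (SOME w. (s, w) \<in> E \<and> dm w = d)" for s d
  have pick: "(s, pick s d) \<in> E \<and> dm (pick s d) = d" if "d \<in> dm ` (E `` {s})" for s d
    unfolding pick_def by (rule someI_ex) (use that in auto)
  define I where "I = (SIGMA s:S. dm ` (E `` {s}))"
  define X where "X = (\<lambda>(s, d). (s, pick s d)) ` I"
  have finE: "finite (E `` {s})" for s using finite_neighbours[OF G(1)] .
  have X: "s \<in> S \<and> (s, w) \<in> E \<and> w = pick s (dm w)" if "(s, w) \<in> X" for s w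
    using that pick unfolding X_def I_def by fastforce
  have Xuniq: "w = w'" if "(s, w) \<in> X" "(s, w') \<in> X" "dm w = dm w'" for s w w'
    using X that by metis
  have cX: "card X = (\<Sum>s\<in>S. card (dm ` (E `` {s})))"
  proof -
    have "inj_on (\<lambda>(s, d). (s, pick s d)) I"
      by (rule inj_on_inverseI[where g = "\<lambda>(s, w). (s, dm w)"]) (auto simp: I_def pick)
    then show ?thesis unfolding X_def I_def using fin finE by (simp add: card_image)
  qed
  have finX: "finite X" unfolding X_def I_def using fin finE by blast
  define W where "W = snd ` X - D"
  have finW: "finite W" using finX by (simp add: W_def)
  have WV: "W \<subseteq> V" using X sg(2) by (force simp: W_def)
  have WS: "W \<inter> S = {}" using X indep by (force simp: W_def)
  have Wdm: "dm w \<in> D \<and> (w, dm w) \<in> E" if w: "w \<in> W" for w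
  proof -
    obtain s where s: "(s, w) \<in> X" "w \<notin> D" using w by (auto simp: W_def)
    then show ?thesis using X[OF s(1)] dm[of s w] by auto
  qed
  \<comment> \<open>The contracted edges, left unmarked. There is one for each vertex of
    \<open>W\<close>, so they cancel against \<open>W\<close> in Euler's inequality.\<close>
  define St where "St = (\<lambda>w. (w, dm w)) ` W"
  define F where "F = X \<union> St"
  define Y where "Y = D \<union> S \<union> W"
  have XS: "X \<inter> St = {}" using X WS by (auto simp: St_def)
  have cF: "card F = card X + card W"
  proof -
    have "card St = card W" unfolding St_def by (intro card_image inj_onI) auto
    then show ?thesis using finX finW XS by (simp add: F_def card_Un_disjoint St_def)
  qed
  have cY: "card Y = card D + card S + card W"
    using fin finW SD WS unfolding Y_def
    by (subst card_Un_disjoint, auto simp: W_def card_Un_disjoint Int_commute)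
  have XF: "X \<subseteq> E \<inter> Y \<times> Y" using X by (force simp: Y_def W_def)
  have StF: "St \<subseteq> E \<inter> Y \<times> Y" using Wdm by (auto simp: St_def Y_def)
  have "card F < card Y \<or> 3 * (card F + 2) \<le> 3 * card Y + 2 * card X"
  proof (rule planar_oriented_bound[OF G])
    show "Y \<subseteq> V" using S D WV by (auto simp: Y_def)
    show "Y \<noteq> {}" using False by (auto simp: Y_def)
    show "F \<subseteq> E \<inter> Y \<times> Y" using XF StF by (auto simp: F_def)
    show "X \<subseteq> F" by (auto simp: F_def)
    show "(v, u) \<notin> F" if "(u, v) \<in> F" for u v
    proof
      assume vu: "(v, u) \<in> F"
      have "u \<in> S \<or> u \<in> W" "v \<in> S \<or> v \<in> W" using that vu X by (auto simp: F_def St_def)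
      moreover have "v \<in> W \<or> v \<in> D" "u \<in> W \<or> u \<in> D"
        using that vu Wdm by (auto simp: F_def St_def W_def image_iff) (metis snd_conv)+
      moreover have "W \<inter> D = {}" by (auto simp: W_def)
      ultimately have "u \<in> W" "v \<in> W" using WS SD by auto
      then have "(u, v) \<notin> X" "(u, v) \<notin> St" using X WS Wdm \<open>W \<inter> D = {}\<close> by (auto simp: St_def)
      then show False using that by (auto simp: F_def)
    qed
    fix T assume T: "T \<subseteq> F" "T \<noteq> {}" "card (T \<inter> X) < 3"
    have finT: "finite T" using T finX finW finite_subset by (auto simp: F_def St_def)
    show "\<exists>x. card {e \<in> T. x = fst e \<or> x = snd e} = 1"
    proof (rule ccontr)
      assume noleaf: "\<nexists>x. card {e \<in> T. x = fst e \<or> x = snd e} = 1"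
      note other = other_edge_if_no_leaf[OF finT noleaf]
      \<comment> \<open>A vertex of \<open>W\<close> has only one star edge; in a set without leaves
        another edge meets it, which must be marked.\<close>
      have fromW: "\<exists>s. (s, w) \<in> T \<inter> X" if wd: "(w, d) \<in> T \<inter> St" for w d
      proof -
        obtain e where e: "e \<in> T" "e \<noteq> (w, d)" "w = fst e \<or> w = snd e"
          using other[of "(w, d)" w] wd by auto
        have w: "w \<in> W" "d = dm w" using wd by (auto simp: St_def)
        have "e \<notin> St"
        proof
          assume "e \<in> St"
          then obtain w' where w': "w' \<in> W" "e = (w', dm w')" by (auto simp: St_def)
          then have "w \<noteq> dm w'" using Wdm[OF w'(1)] w by (auto simp: W_def)
          then show False using w' e w by auto
        qed
        then have eX: "e \<in> X" using e T by (auto simp: F_def)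
        have "w \<noteq> fst e" using eX X[of "fst e" "snd e"] w WS by auto
        then have "e = (fst e, w)" using e by auto
        then show ?thesis using eX e(1) by (metis IntI)
      qed
      obtain s w where sw: "(s, w) \<in> T \<inter> X"
      proof -
        obtain e where e: "e \<in> T" using T by blast
        show ?thesis
        proof (cases "e \<in> X")
          case True then show ?thesis using e that by (metis IntI surj_pair)
        next
          case False
          then have "e \<in> T \<inter> St" using e T by (auto simp: F_def)
          then show ?thesis using fromW that by (metis surj_pair)
        qed
      qed
      have sS: "s \<in> S" using X sw by auto
      obtain e2 where e2: "e2 \<in> T" "e2 \<noteq> (s, w)" "s = fst e2 \<or> s = snd e2"
        using other[of "(s, w)" s] sw by auto
      have snd: "snd e \<notin> S" if "e \<in> F" for e
      proof (cases "e \<in> X")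
        case True
        then have "(fst e, snd e) \<in> X" by simp
        then have "fst e \<in> S" "snd e \<in> E `` {fst e}" using X by blast+
        then show ?thesis using indep by blast
      next
        case False
        then have "e \<in> St" using that by (auto simp: F_def)
        then show ?thesis using Wdm SD by (auto simp: St_def)
      qed
      have "s = fst e2" using e2 snd[of e2] T sS by blast
      then obtain w2 where w2: "e2 = (s, w2)" "w2 \<noteq> w" using e2 by (metis prod.collapse)
      have "e2 \<notin> St" using w2 sS WS by (auto simp: St_def)
      then have e2X: "(s, w2) \<in> T \<inter> X" using e2 w2 T by (auto simp: F_def)
      have dne: "dm w2 \<noteq> dm w" using Xuniq[of s w2 w] e2X sw w2 by auto
      \<comment> \<open>Two marked edges leave \<open>s\<close>, towards different dominators. Going
        on from \<open>w\<close>, possibly through the dominator \<open>dm w\<close>, the absence of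
        leaves leads to a marked edge of another vertex of \<open>S\<close>, the third one.\<close>
      have "\<exists>s' w'. (s', w') \<in> T \<inter> X \<and> s' \<noteq> s"
      proof -
        have atD: ?thesis if e: "e \<in> T" and d: "snd e = dm w" and new: "e \<noteq> (s, w)" "e \<noteq> (w, dm w)"  for e
        proof (cases "e \<in> X")
          case True
          have "dm w \<in> D" using dm[OF sS] X sw by blast
          then have "dm (snd e) = dm w" using dmD d by auto
          moreover have "fst e \<noteq> s" if "dm (snd e) = dm w"
          proof
            assume "fst e = s"
            then have "e = (s, snd e)" by auto
            then have "snd e = w" using Xuniq[of s "snd e" w] True sw that by auto
            then show False using new \<open>e = (s, snd e)\<close> by simp
          qed
          ultimately have "fst e \<noteq> s" by blast
          then show ?thesis using e True by (metis IntI prod.collapse)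
        next
          case False
          then have st: "e \<in> T \<inter> St" using e T by (auto simp: F_def)
          then obtain w' where w': "e = (w', dm w')" "w' \<in> W" by (auto simp: St_def)
          have dmw': "dm w' = dm w" using w' d by simp
          obtain s' where s': "(s', w') \<in> T \<inter> X" using fromW[of w' "dm w'"] st w' by auto
          have "s' \<noteq> s"
          proof
            assume "s' = s"
            then have "w' = w" using Xuniq[of s w' w] s' sw dmw' by auto
            then show False using new w' by simp
          qed
          then show ?thesis using s' by blast
        qed
        obtain e where e: "e \<in> T" "e \<noteq> (s, w)" "w = fst e \<or> w = snd e"
          using other[of "(s, w)" w] sw by auto
        show ?thesis
        proof (cases "w = snd e")
          case True
          show ?thesis
          proof (cases "e \<in> X")
            case eX: True
            have "fst e \<noteq> s" using True e by auto
            then show ?thesis using eX e by (metis IntI prod.collapse)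
          next
            case False
            then have "e \<in> St" using e T by (auto simp: F_def)
            then have "w \<in> D" using True Wdm by (auto simp: St_def)
            moreover then have "w \<notin> W" by (simp add: W_def)
            moreover have "fst e \<in> W" using \<open>e \<in> St\<close> by (auto simp: St_def)
            ultimately show ?thesis using atD[of e] e True dmD[of w] by (metis fst_conv)
          qed
        next
          case False
          then have wf: "w = fst e" using e by blast
          have "w \<notin> S" using snd[of "(s, w)"] sw T by auto
          then have "e \<notin> X" using wf X[of w "snd e"] by auto
          then have "e \<in> St" using e T by (auto simp: F_def)
          then have ew: "e = (w, dm w)" and wW: "w \<in> W" using wf by (auto simp: St_def)
          obtain e' where e': "e' \<in> T" "e' \<noteq> e" "dm w = fst e' \<or> dm w = snd e'"
            using other[OF e(1), of "dm w"] ew by auto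
          have dD: "dm w \<in> D" using Wdm wW by auto
          have "fst e' \<in> S \<or> fst e' \<in> W" using e' T X[of "fst e'" "snd e'"] by (auto simp: F_def St_def)
          then have "dm w \<noteq> fst e'" using dD SD by (auto simp: W_def)
          moreover have "e' \<noteq> (s, w)" using e' wW dD \<open>dm w \<noteq> fst e'\<close> by (auto simp: W_def)
          ultimately show ?thesis using atD[of e'] e' ew by auto
        qed
      qed
      then obtain s' w' where s': "(s', w') \<in> T \<inter> X" "s' \<noteq> s" by blast
      have "card {(s, w), (s, w2), (s', w')} = 3" using w2 s' by auto
      moreover have "{(s, w), (s, w2), (s', w')} \<subseteq> T \<inter> X" using sw e2X s' by auto
      ultimately have "3 \<le> card (T \<inter> X)" using finT by (metis card_mono finite_Int)
      then show False using T by simp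
    qed
  qed
  then have "card X \<le> 3 * (card D + card S)" using cF cY by arith
  moreover have "h * card S \<le> card X"
    using sum_bounded_below[of S h "\<lambda>s. card (dm ` (E `` {s}))"] h unfolding cX by (simp add: mult.commute)
  ultimately show ?thesis by linarith
qed simp

text \<open>Each \<open>u\<close> subdivides an edge between its two neighbours in \<open>R\<close>,
  and different traces exclude parallel edges, so \<open>C\<close> is the edge set of a planar graph
  on \<open>R\<close>. Only one half of each subdivided edge is marked, and
  \<open>g = 3\<close>.\<close>

lemma two_trace_bound:
  assumes G: "simple_graph V E" "planar V E" and R: "R \<subseteq> V" and C: "C \<subseteq> V" and CR: "C \<inter> R = {}"
    and two: "\<And>u. u \<in> C \<Longrightarrow> card (E `` {u} \<inter> R) = 2" and inj: "inj_on (\<lambda>u. E `` {u} \<inter> R) C"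
  shows "card C \<le> 3 * card R"
proof (cases "C = {}")
  case False
  have sg: "finite V" "E \<subseteq> V \<times> V" "sym E" "\<And>x. (x, x) \<notin> E" using G(1) by (auto simp: simple_graph_def)
  have fin: "finite C" "finite R" using C R sg finite_subset by blast+
  have "\<exists>a b. E `` {u} \<inter> R = {a, b} \<and> a \<noteq> b" if "u \<in> C" for u
    using two[OF that] by (auto simp: card_2_iff)
  then obtain a b where ab: "\<And>u. u \<in> C \<Longrightarrow> E `` {u} \<inter> R = {a u, b u}" "\<And>u. u \<in> C \<Longrightarrow> a u \<noteq> b u"
    by metis
  have abR: "a u \<in> R" "b u \<in> R" "(u, a u) \<in> E" "(u, b u) \<in> E" if "u \<in> C" for u using ab(1)[OF that] by auto
  define X where "X = (\<lambda>u. (u, a u)) ` C"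
  define F where "F = X \<union> (\<lambda>u. (u, b u)) ` C"
  have cX: "card X = card C" unfolding X_def by (intro card_image inj_onI) auto
  have "card ((\<lambda>u. (u, b u)) ` C) = card C" by (intro card_image inj_onI) auto
  moreover have "X \<inter> (\<lambda>u. (u, b u)) ` C = {}" using ab(2) by (auto simp: X_def)
  ultimately have cF: "card F = 2 * card C" using cX fin by (simp add: F_def card_Un_disjoint X_def)
  have cY: "card (R \<union> C) = card R + card C" using fin CR by (intro card_Un_disjoint) auto
  have Ffst: "u \<in> C" "v \<in> R" "v = a u \<or> v = b u" if "(u, v) \<in> F" for u v
    using that abR by (auto simp: F_def X_def)
  have "card F < card (R \<union> C) \<or> 3 * (card F + 2) \<le> 3 * card (R \<union> C) + 2 * card X"
  proof (rule planar_oriented_bound[OF G])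
    show "R \<union> C \<subseteq> V" using R C by auto
    show "R \<union> C \<noteq> {}" using False by auto
    show "F \<subseteq> E \<inter> (R \<union> C) \<times> (R \<union> C)" using abR by (auto simp: F_def X_def)
    show "X \<subseteq> F" by (auto simp: F_def)
    show "(v, u) \<notin> F" if "(u, v) \<in> F" for u v using Ffst[OF that] Ffst[of v u] CR by blast
    fix T assume T: "T \<subseteq> F" "T \<noteq> {}" "card (T \<inter> X) < 3"
    have finT: "finite T" using T fin finite_subset by (auto simp: F_def X_def)
    show "\<exists>x. card {e \<in> T. x = fst e \<or> x = snd e} = 1"
    proof (rule ccontr)
      assume noleaf: "\<nexists>x. card {e \<in> T. x = fst e \<or> x = snd e} = 1"
      note other = other_edge_if_no_leaf[OF finT noleaf]
      have both: "(u, a u) \<in> T \<and> (u, b u) \<in> T" if uv: "(u, v) \<in> T" for u v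
      proof -
        have u: "u \<in> C" "v = a u \<or> v = b u" using Ffst uv T by blast+
        obtain e where e: "e \<in> T" "e \<noteq> (u, v)" "u = fst e \<or> u = snd e" using other[OF uv, of u] by auto
        obtain x y where xy: "e = (x, y)" by fastforce
        have "y \<in> R" "y = a x \<or> y = b x" using Ffst[of x y] e T xy by blast+
        then have "x = u" using e xy u CR by auto
        then show ?thesis using e uv u xy \<open>y = a x \<or> y = b x\<close> by auto
      qed
      obtain u v where uv: "(u, v) \<in> T" using T by auto
      have uC: "u \<in> C" using Ffst uv T by blast
      have step: "\<exists>u'. u' \<noteq> u \<and> u' \<in> C \<and> (u', x) \<in> T" if ux: "(u, x) \<in> T" for x
      proof -
        obtain e where e: "e \<in> T" "e \<noteq> (u, x)" "x = fst e \<or> x = snd e" using other[OF ux, of x] by auto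
        obtain y z where yz: "e = (y, z)" by fastforce
        have "x \<in> R" "y \<in> C" using Ffst ux e T yz by blast+
        then show ?thesis using e yz CR by auto
      qed
      obtain u1 where u1: "u1 \<noteq> u" "u1 \<in> C" "(u1, a u) \<in> T" using step both[OF uv] by blast
      obtain u2 where u2: "u2 \<noteq> u" "u2 \<in> C" "(u2, b u) \<in> T" using step both[OF uv] by blast
      have "u1 \<noteq> u2"
      proof
        assume eq: "u1 = u2"
        have "a u = a u1 \<or> a u = b u1" "b u = a u1 \<or> b u = b u1" using Ffst u1 u2 T eq by blast+
        then have "{a u, b u} = {a u1, b u1}" using ab(2)[OF uC] by auto
        then have "u = u1" using inj uC u1 ab(1) by (metis inj_onD)
        then show False using u1 by simp
      qed
      then have "card {(u, a u), (u1, a u1), (u2, a u2)} = 3" using u1 u2 by auto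
      moreover have "{(u, a u), (u1, a u1), (u2, a u2)} \<subseteq> T \<inter> X"
        using both uv u1 u2 uC by (auto simp: X_def)
      ultimately have "3 \<le> card (T \<inter> X)" using finT by (metis card_mono finite_Int)
      then show False using T by simp
    qed
  qed
  then show ?thesis unfolding cX cY cF by arith
qed simp

section \<open>Covering programs in constantly many rounds\<close>

text \<open>A covering LP with constraint sets \<open>Q\<close> is solved by a multiplicative-weights scheme in units of
  \<open>1/N\<close>. A constraint loses weight by a factor \<open>\<beta>\<close> with each unit it receives and is dropped once it
  is covered; a variable is raised as long as the remaining weight of its constraints is within
  \<open>1 - \<eta>\<close> of an upper bound that decays over the phases.\<close>

definition lp_weight :: "real \<Rightarrow> nat \<Rightarrow> (nat \<Rightarrow> nat) \<Rightarrow> nat set \<Rightarrow> real" where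
  "lp_weight \<beta> N x q = (if sum x q < N then \<beta> ^ sum x q else 0)"

definition lp_load :: "real \<Rightarrow> nat \<Rightarrow> nat set set \<Rightarrow> (nat \<Rightarrow> nat) \<Rightarrow> nat \<Rightarrow> real" where
  "lp_load \<beta> N Q x u = (\<Sum>q\<in>{q \<in> Q. u \<in> q}. lp_weight \<beta> N x q)"

fun lp_run :: "real \<Rightarrow> nat \<Rightarrow> real \<Rightarrow> nat \<Rightarrow> nat set set \<Rightarrow> nat \<Rightarrow> nat \<Rightarrow> nat" where
  "lp_run \<beta> N \<eta> \<Delta> Q 0 u = 0"
| "lp_run \<beta> N \<eta> \<Delta> Q (Suc t) u = lp_run \<beta> N \<eta> \<Delta> Q t u +
     (if lp_load \<beta> N Q (lp_run \<beta> N \<eta> \<Delta> Q t) u \<ge> (1 - \<eta>) * (real \<Delta> * (1 - \<eta>) ^ (t div N)) then 1 else 0)"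

lemma sum_filter_of_bool:
  fixes f :: "'a \<Rightarrow> real"
  assumes "finite A"
  shows "(\<Sum>a\<in>{a \<in> A. P a}. f a) = (\<Sum>a\<in>A. of_bool (P a) * f a)"
  unfolding sum.inter_filter[OF assms] by (intro sum.cong) auto

section \<open>Dual fitting for multiplicative weights\<close>

locale bounded_cover =
  fixes Q :: "nat set set" and \<Delta> L N :: nat and \<beta> \<eta> :: real
  assumes finQ: "finite Q" and finq: "\<And>q. q \<in> Q \<Longrightarrow> finite q" and neq: "\<And>q. q \<in> Q \<Longrightarrow> q \<noteq> {}"
    and cardq: "\<And>q. q \<in> Q \<Longrightarrow> card q \<le> L"
    and deg: "\<And>u. card {q \<in> Q. u \<in> q} \<le> \<Delta>" and \<Delta>: "\<Delta> \<ge> 1" and N: "N > 0"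
    and \<beta>: "0 < \<beta>" "\<beta> < 1" and \<eta>: "0 < \<eta>" "\<eta> < 1"
begin

abbreviation x :: "nat \<Rightarrow> nat \<Rightarrow> nat" where "x t \<equiv> lp_run \<beta> N \<eta> \<Delta> Q t"
abbreviation w :: "nat \<Rightarrow> nat set \<Rightarrow> real" where "w t q \<equiv> lp_weight \<beta> N (x t) q"
abbreviation W :: "nat \<Rightarrow> nat \<Rightarrow> real" where "W t u \<equiv> lp_load \<beta> N Q (x t) u"
abbreviation lam :: "nat \<Rightarrow> real" where "lam t \<equiv> real \<Delta> * (1 - \<eta>) ^ (t div N)"

definition raised :: "nat \<Rightarrow> nat set" where
  "raised t = {u. W t u \<ge> (1 - \<eta>) * lam t}"

lemma x_Suc: "x (Suc t) u = x t u + of_bool (u \<in> raised t)"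
  by (simp add: raised_def)

declare lp_run.simps(2) [simp del]

lemma lam_pos: "lam t > 0" using \<Delta> \<eta> by simp

lemma w_nonneg: "w t q \<ge> 0" using \<beta> by (simp add: lp_weight_def)

lemma w_le_1: "w t q \<le> 1" using \<beta> by (simp add: lp_weight_def power_le_one)

lemma x_mono: "s \<le> t \<Longrightarrow> x s u \<le> x t u"
  by (rule lift_Suc_mono_le[of "\<lambda>t. x t u"]) (simp_all add: x_Suc)

lemma w_antimono: "s \<le> t \<Longrightarrow> w t q \<le> w s q"
proof -
  assume "s \<le> t"
  then have "sum (x s) q \<le> sum (x t) q" by (intro sum_mono x_mono)
  then show ?thesis using \<beta> by (auto simp: lp_weight_def intro: power_decreasing)
qed

lemma W_antimono: "s \<le> t \<Longrightarrow> W t u \<le> W s u"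
  unfolding lp_load_def by (intro sum_mono w_antimono)

lemma W_nonneg: "W t u \<ge> 0"
  unfolding lp_load_def by (intro sum_nonneg w_nonneg)

lemma fin_at: "finite {q \<in> Q. u \<in> q}" using finQ by simp

text \<open>A variable whose load stays above the next bound during a whole phase is raised in all
  of its \<open>N\<close> rounds. It then covers all its constraints alone, and its load is
  0.\<close>

lemma W_le_lam: "W t u \<le> lam t"
proof -
  have phase: "W (k * N) u \<le> real \<Delta> * (1 - \<eta>) ^ k" for k
  proof (induction k)
    case 0
    have "W 0 u \<le> (\<Sum>q\<in>{q \<in> Q. u \<in> q}. 1)" unfolding lp_load_def by (intro sum_mono w_le_1)
    also have "\<dots> \<le> real \<Delta>" using deg by simp
    finally show ?case by (simp only: mult_0 power_0 mult_1_right)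
  next
    case (Suc k)
    show ?case
    proof (rule ccontr)
      assume neg: "\<not> W (Suc k * N) u \<le> real \<Delta> * (1 - \<eta>) ^ Suc k"
      have grow: "j \<le> N \<Longrightarrow> j \<le> x (k * N + j) u" for j
      proof (induction j)
        case (Suc j)
        have "W (Suc k * N) u \<le> W (k * N + j) u" using Suc.prems by (intro W_antimono) auto
        moreover have "(k * N + j) div N = k" using Suc.prems by simp
        ultimately have "u \<in> raised (k * N + j)" using neg by (simp add: raised_def mult_ac)
        then show ?case using Suc by (simp add: x_Suc)
      qed simp
      have "N \<le> sum (x (Suc k * N)) q" if "q \<in> Q" "u \<in> q" for q
      proof -
        have "N \<le> x (Suc k * N) u" using grow[of N] by (simp add: add.commute)
        also have "\<dots> \<le> sum (x (Suc k * N)) q" using that finq by (intro member_le_sum) auto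
        finally show ?thesis .
      qed
      then have "w (Suc k * N) q = 0" if "q \<in> Q" "u \<in> q" for q
        using that by (metis lp_weight_def leD)
      then have "W (Suc k * N) u = 0" unfolding lp_load_def by (intro sum.neutral) blast
      moreover have "real \<Delta> * (1 - \<eta>) ^ Suc k > 0" using \<Delta> \<eta> by simp
      ultimately show False using neg by linarith
    qed
  qed
  have "W t u \<le> W (t div N * N) u" by (intro W_antimono) simp
  also have "\<dots> \<le> lam t" by (rule phase)
  finally show ?thesis .
qed

text \<open>A constraint not yet covered has weight at least \<open>\<beta> ^ N\<close>, which after
  \<open>P\<close> phases exceeds the bound on the load of any of its variables.\<close>

lemma covered:
  assumes T: "real \<Delta> * (1 - \<eta>) ^ P < \<beta> ^ N" and q: "q \<in> Q"
  shows "N \<le> sum (x (N * P)) q"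
proof (rule ccontr)
  assume "\<not> ?thesis"
  then have alive: "sum (x (N * P)) q < N" by simp
  obtain u where u: "u \<in> q" using neq[OF q] by blast
  have "\<beta> ^ N \<le> \<beta> ^ sum (x (N * P)) q" using alive \<beta> by (intro power_decreasing) auto
  also have "\<dots> = w (N * P) q" using alive by (simp add: lp_weight_def)
  also have "\<dots> \<le> W (N * P) u" unfolding lp_load_def
    using q u fin_at w_nonneg by (intro member_le_sum) auto
  also have "\<dots> \<le> lam (N * P)" by (rule W_le_lam)
  also have "\<dots> < \<beta> ^ N" using T N by simp
  finally show False by simp
qed

definition hits :: "nat \<Rightarrow> nat set \<Rightarrow> nat" where
  "hits t q = card (q \<inter> raised t)"

text \<open>The dual solution. A raised variable distributes its cost over its constraints in
  proportion to their weights; its load is at least the denominator, so these shares sum to at least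
  one.\<close>

definition charge :: "nat \<Rightarrow> nat set \<Rightarrow> real" where
  "charge t q = real (hits t q) * w t q / ((1 - \<eta>) * lam t)"

text \<open>The floor keeps the logarithm finite when the load reaches 0. The exponent is
  \<open>N + L\<close> because a constraint with fewer than \<open>N\<close> units may receive
  \<open>L\<close> more in a single round.\<close>

definition potential :: "nat \<Rightarrow> nat \<Rightarrow> real" where
  "potential t u = ln (max (W t u) (\<beta> ^ (N + L)))"

lemma sum_x_Suc:
  assumes "q \<in> Q"
  shows "sum (x (Suc t)) q = sum (x t) q + hits t q"
  using finq[OF assms] by (simp add: x_Suc sum.distrib sum_of_bool_eq hits_def Int_def conj_commute)

lemma hits_le: "q \<in> Q \<Longrightarrow> hits t q \<le> L"
  unfolding hits_def using card_mono[OF finq, of q "q \<inter> raised t"] cardq[of q] by fastforce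

lemma hits_factor:
  assumes "s \<le> L"
  shows "real s * ((1 - \<beta>) * \<beta> ^ L) \<le> 1 - \<beta> ^ s"
proof -
  have "real s * \<beta> ^ L = (\<Sum>i<s. \<beta> ^ L)" by simp
  also have "\<dots> \<le> (\<Sum>i<s. \<beta> ^ i)" using assms \<beta> by (intro sum_mono power_decreasing) auto
  finally have "(1 - \<beta>) * (real s * \<beta> ^ L) \<le> (1 - \<beta>) * (\<Sum>i<s. \<beta> ^ i)"
    using \<beta> by (intro mult_left_mono) auto
  also have "\<dots> = 1 - \<beta> ^ s" using \<beta> by (simp add: geometric_sum field_simps)
  finally show ?thesis by (simp add: mult_ac)
qed

text \<open>The relative loss of load is at most the drop of its logarithm, by
  \<open>1 - y \<le> - ln y\<close>, and \<open>hits_factor\<close> makes the loss linear in the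
  hits. \<open>W'\<close> is the new load before newly covered constraints are dropped; it bounds
  the new load from above and never falls below the floor.\<close>

lemma charge_le_potential_drop:
  "(\<Sum>q\<in>{q \<in> Q. u \<in> q}. charge t q) * ((1 - \<eta>) * ((1 - \<beta>) * \<beta> ^ L)) \<le> potential t u - potential (Suc t) u"
proof (cases "W t u = 0")
  case True
  have w0: "\<forall>q\<in>{q \<in> Q. u \<in> q}. w t q = 0"
    using True w_nonneg fin_at unfolding lp_load_def by (subst (asm) sum_nonneg_eq_0_iff) auto
  then have "(\<Sum>q\<in>{q \<in> Q. u \<in> q}. charge t q) = 0" by (intro sum.neutral) (auto simp: charge_def)
  moreover have "W (Suc t) u = 0" using W_antimono[of t "Suc t" u] W_nonneg[of "Suc t" u] True by simp
  ultimately show ?thesis using True by (simp add: potential_def)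
next
  case False
  let ?A = "{q \<in> Q. u \<in> q}"
  define W' where "W' = (\<Sum>q\<in>?A. w t q * \<beta> ^ hits t q)"
  have Wpos: "W t u > 0" using False W_nonneg[of t u] by simp
  obtain q where q: "q \<in> ?A" "w t q \<noteq> 0"
    using False unfolding lp_load_def by (meson sum.neutral)
  have "\<beta> ^ N \<le> w t q" using q \<beta> by (auto simp: lp_weight_def intro: power_decreasing split: if_splits)
  also have "\<dots> \<le> W t u" unfolding lp_load_def using q fin_at w_nonneg by (intro member_le_sum) auto
  finally have WN: "\<beta> ^ N \<le> W t u" .
  have "\<beta> ^ L * W t u = (\<Sum>q\<in>?A. w t q * \<beta> ^ L)"
    unfolding lp_load_def by (simp add: sum_distrib_left mult_ac)
  also have "\<dots> \<le> W'" unfolding W'_def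
    using hits_le \<beta> w_nonneg by (intro sum_mono mult_left_mono power_decreasing) auto
  finally have W'L: "\<beta> ^ L * W t u \<le> W'" .
  moreover have "\<beta> ^ L * \<beta> ^ N \<le> \<beta> ^ L * W t u" using WN \<beta> by (intro mult_left_mono) auto
  ultimately have W'ge: "\<beta> ^ (N + L) \<le> W'" by (simp add: power_add mult_ac)
  moreover have "\<beta> ^ (N + L) > 0" using \<beta> by simp
  ultimately have W'pos: "W' > 0" by linarith
  have "W (Suc t) u \<le> W'"
    unfolding lp_load_def W'_def
  proof (intro sum_mono)
    fix q assume q: "q \<in> ?A"
    show "w (Suc t) q \<le> w t q * \<beta> ^ hits t q"
      using \<beta> q by (auto simp: lp_weight_def sum_x_Suc power_add)
  qed
  then have "max (W (Suc t) u) (\<beta> ^ (N + L)) \<le> W'" using W'ge by simp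
  then have p1: "potential (Suc t) u \<le> ln W'"
    unfolding potential_def using \<beta> by (subst ln_le_cancel_iff) (auto simp: W'pos less_max_iff_disj)
  have p0: "ln (W t u) \<le> potential t u"
    unfolding potential_def using Wpos by (subst ln_le_cancel_iff) (auto simp: less_max_iff_disj)
  have "(\<Sum>q\<in>?A. charge t q) * ((1 - \<eta>) * ((1 - \<beta>) * \<beta> ^ L))
      = (\<Sum>q\<in>?A. w t q * (real (hits t q) * ((1 - \<beta>) * \<beta> ^ L))) / lam t"
    unfolding charge_def sum_distrib_right sum_divide_distrib
    using lam_pos[of t] \<eta> \<Delta> by (intro sum.cong refl) (simp add: field_simps)
  also have "\<dots> \<le> (\<Sum>q\<in>?A. w t q * (1 - \<beta> ^ hits t q)) / lam t"
    using lam_pos[of t] hits_le by (intro divide_right_mono sum_mono mult_left_mono hits_factor w_nonneg) auto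
  also have "(\<Sum>q\<in>?A. w t q * (1 - \<beta> ^ hits t q)) = W t u - W'"
    unfolding W'_def lp_load_def by (simp add: right_diff_distrib sum_subtractf)
  also have "(W t u - W') / lam t \<le> (W t u - W') / W t u"
  proof (rule divide_left_mono)
    have "W' \<le> W t u" unfolding W'_def lp_load_def
      using w_nonneg \<beta> by (intro sum_mono) (simp add: mult_left_le power_le_one)
    then show "0 \<le> W t u - W'" by simp
    show "W t u \<le> lam t" by (rule W_le_lam)
    show "0 < lam t * W t u" using lam_pos[of t] Wpos by simp
  qed
  also have "\<dots> = 1 - W' / W t u" using Wpos by (simp add: field_simps)
  also have "\<dots> \<le> - ln (W' / W t u)" using ln_le_minus_one[of "W' / W t u"] Wpos W'pos by simp
  also have "\<dots> = ln (W t u) - ln W'" using Wpos W'pos by (simp add: ln_div)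
  also have "\<dots> \<le> potential t u - potential (Suc t) u" using p0 p1 by simp
  finally show ?thesis .
qed

lemma total_charge_le:
  "(\<Sum>q\<in>{q \<in> Q. u \<in> q}. \<Sum>t<T. charge t q) * ((1 - \<eta>) * ((1 - \<beta>) * \<beta> ^ L))
     \<le> ln (real \<Delta>) + real (N + L) * ln (1 / \<beta>)"
proof -
  have "(\<Sum>q\<in>{q \<in> Q. u \<in> q}. \<Sum>t<T. charge t q) * ((1 - \<eta>) * ((1 - \<beta>) * \<beta> ^ L))
     = (\<Sum>t<T. (\<Sum>q\<in>{q \<in> Q. u \<in> q}. charge t q) * ((1 - \<eta>) * ((1 - \<beta>) * \<beta> ^ L)))"
    by (subst sum.swap) (simp add: sum_distrib_right)
  also have "\<dots> \<le> (\<Sum>t<T. potential t u - potential (Suc t) u)"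
    by (intro sum_mono charge_le_potential_drop)
  also have "\<dots> = potential 0 u - potential T u" by (rule sum_lessThan_telescope')
  also have "potential 0 u \<le> ln (real \<Delta>)"
  proof -
    have "W 0 u \<le> real \<Delta>" using W_le_lam[of 0 u] by simp
    moreover have "\<beta> ^ (N + L) \<le> real \<Delta>" using \<beta> \<Delta> power_le_one[of \<beta> "N + L"] by linarith
    ultimately show ?thesis unfolding potential_def
      using \<beta> \<Delta> by (subst ln_le_cancel_iff) (auto simp: less_max_iff_disj)
  qed
  also have "ln (real \<Delta>) - potential T u \<le> ln (real \<Delta>) + real (N + L) * ln (1 / \<beta>)"
  proof -
    have "ln (\<beta> ^ (N + L)) \<le> potential T u" unfolding potential_def
      using \<beta> by (subst ln_le_cancel_iff) (auto simp: less_max_iff_disj)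
    then show ?thesis using \<beta> by (simp add: ln_realpow ln_div)
  qed
  finally show ?thesis by simp
qed

lemma raised_subset: "raised t \<subseteq> \<Union>Q"
proof
  fix u assume u: "u \<in> raised t"
  have "0 < (1 - \<eta>) * lam t" using lam_pos[of t] \<eta> by simp
  then have "W t u \<noteq> 0" using u by (auto simp: raised_def)
  then have "{q \<in> Q. u \<in> q} \<noteq> {}" unfolding lp_load_def by (metis sum.empty)
  then show "u \<in> \<Union>Q" by blast
qed

lemma fin_support: "finite (\<Union>Q)" using finQ finq by blast

lemma raised_le_charge: "real (card (raised t)) \<le> (\<Sum>q\<in>Q. charge t q)"
proof -
  have fr: "finite (raised t)" using raised_subset fin_support finite_subset by blast
  have pos: "0 < (1 - \<eta>) * lam t" using lam_pos[of t] \<eta> by simp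
  have "real (card (raised t)) = (\<Sum>u\<in>raised t. 1)" by simp
  also have "\<dots> \<le> (\<Sum>u\<in>raised t. W t u / ((1 - \<eta>) * lam t))"
    using pos by (intro sum_mono) (auto simp: raised_def)
  also have "\<dots> = (\<Sum>u\<in>raised t. \<Sum>q\<in>Q. of_bool (u \<in> q) * (w t q / ((1 - \<eta>) * lam t)))"
    unfolding lp_load_def sum_filter_of_bool[OF finQ] sum_divide_distrib by simp
  also have "\<dots> = (\<Sum>q\<in>Q. \<Sum>u\<in>raised t. of_bool (u \<in> q) * (w t q / ((1 - \<eta>) * lam t)))"
    by (rule sum.swap)
  also have "\<dots> = (\<Sum>q\<in>Q. charge t q)"
  proof (intro sum.cong refl)
    fix q
    have "(\<Sum>u\<in>raised t. of_bool (u \<in> q) :: real) = real (hits t q)"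
      using fr by (simp add: sum_of_bool_eq hits_def Int_def conj_commute)
    then show "(\<Sum>u\<in>raised t. of_bool (u \<in> q) * (w t q / ((1 - \<eta>) * lam t))) = charge t q"
      unfolding charge_def by (simp only: flip: sum_distrib_right) simp
  qed
  finally show ?thesis .
qed

lemma total_x_eq: "(\<Sum>u\<in>\<Union>Q. x T u) = (\<Sum>t<T. card (raised t))"
proof (induction T)
  case (Suc T)
  have "\<Union>Q \<inter> raised T = raised T" using raised_subset by blast
  then show ?case using Suc fin_support by (simp add: x_Suc sum.distrib sum_of_bool_eq Int_def conj_commute)
qed simp

lemma x_outside: "u \<notin> \<Union>Q \<Longrightarrow> x t u = 0"
proof (induction t)
  case (Suc t)
  then have "u \<notin> raised t" using raised_subset by blast
  then show ?case using Suc by (simp add: x_Suc)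
qed simp

text \<open>Weak duality: every constraint contains a member of \<open>Z\<close>, and the charge
  collected at each member is bounded by the telescoping potential.\<close>

lemma total_x_le:
  assumes "finite Z" and Z: "\<And>q. q \<in> Q \<Longrightarrow> Z \<inter> q \<noteq> {}"
  shows "real (\<Sum>u\<in>\<Union>Q. x T u) * ((1 - \<eta>) * ((1 - \<beta>) * \<beta> ^ L))
    \<le> real (card Z) * (ln (real \<Delta>) + real (N + L) * ln (1 / \<beta>))"
proof -
  let ?k = "(1 - \<eta>) * ((1 - \<beta>) * \<beta> ^ L)"
  define y where "y q = (\<Sum>t<T. charge t q)" for q
  have ynn: "y q \<ge> 0" for q unfolding y_def charge_def
    using w_nonneg lam_pos \<eta> by (intro sum_nonneg divide_nonneg_nonneg mult_nonneg_nonneg) (auto simp: less_imp_le)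
  have kpos: "?k \<ge> 0" using \<eta> \<beta> by simp
  have "real (\<Sum>u\<in>\<Union>Q. x T u) = (\<Sum>t<T. real (card (raised t)))" by (simp add: total_x_eq)
  also have "\<dots> \<le> (\<Sum>t<T. \<Sum>q\<in>Q. charge t q)" by (intro sum_mono raised_le_charge)
  also have "\<dots> = (\<Sum>q\<in>Q. y q)" unfolding y_def by (rule sum.swap)
  also have "\<dots> \<le> (\<Sum>q\<in>Q. \<Sum>u\<in>Z. of_bool (u \<in> q) * y q)"
  proof (intro sum_mono)
    fix q assume "q \<in> Q"
    then obtain u where "u \<in> Z" "u \<in> q" using Z by blast
    then show "y q \<le> (\<Sum>u\<in>Z. of_bool (u \<in> q) * y q)"
      using member_le_sum[of u Z "\<lambda>u. of_bool (u \<in> q) * y q"] ynn assms(1) by simp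
  qed
  also have "\<dots> = (\<Sum>u\<in>Z. \<Sum>q\<in>Q. of_bool (u \<in> q) * y q)" by (rule sum.swap)
  also have "\<dots> = (\<Sum>u\<in>Z. \<Sum>q\<in>{q \<in> Q. u \<in> q}. y q)"
    unfolding sum_filter_of_bool[OF finQ] ..
  finally have "real (\<Sum>u\<in>\<Union>Q. x T u) * ?k \<le> (\<Sum>u\<in>Z. \<Sum>q\<in>{q \<in> Q. u \<in> q}. y q) * ?k"
    using kpos by (rule mult_right_mono)
  also have "\<dots> = (\<Sum>u\<in>Z. (\<Sum>q\<in>{q \<in> Q. u \<in> q}. y q) * ?k)" by (rule sum_distrib_right)
  also have "\<dots> \<le> (\<Sum>u\<in>Z. ln (real \<Delta>) + real (N + L) * ln (1 / \<beta>))"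
    unfolding y_def by (intro sum_mono total_charge_le)
  finally show ?thesis by simp
qed

end

lemma lp_parameters_exist:
  fixes \<epsilon> :: real and \<Delta> L :: nat
  assumes "\<epsilon> > 0" "\<Delta> \<ge> 1"
  obtains \<beta> \<eta> :: real and N P :: nat where "0 < \<beta>" "\<beta> < 1" "0 < \<eta>" "\<eta> < 1" "N > 0"
    "real \<Delta> * (1 - \<eta>) ^ P < \<beta> ^ N"
    "ln (real \<Delta>) + real (N + L) * ln (1 / \<beta>) \<le> (1 + \<epsilon>) * real N * ((1 - \<eta>) * ((1 - \<beta>) * \<beta> ^ L))"
proof -
  \<comment> \<open>Chosen to make \<open>(1 + \<epsilon>) * \<beta> ^ (L + 2)\<close> exceed 1. Of
    these factors \<beta>, \<open>L\<close> occur in the goal, one is \<open>1 - \<eta>\<close>, and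
    one pays for \<open>ln (1 / \<beta>) \<le> (1 - \<beta>) / \<beta>\<close>. Taking
    \<open>L + 3\<close> here leaves strict room.\<close>
  define \<delta> where "\<delta> = \<epsilon> / ((1 + \<epsilon>) * real (L + 3))"
  define \<beta> where "\<beta> = 1 - \<delta>"
  have \<delta>: "0 < \<delta>" "\<delta> < 1" 
  proof -
    show "0 < \<delta>" using assms(1) by (simp add: \<delta>_def)
    have "\<epsilon> < (1 + \<epsilon>) * 1" by simp
    also have "\<dots> \<le> (1 + \<epsilon>) * real (L + 3)" using assms(1) by (intro mult_left_mono) auto
    finally show "\<delta> < 1" using assms(1) by (simp add: \<delta>_def)
  qed
  have \<beta>: "0 < \<beta>" "\<beta> < 1" using \<delta> by (auto simp: \<beta>_def)
  have "1 - real (L + 2) * \<delta> \<le> \<beta> ^ (L + 2)"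
    using Bernoulli_inequality[of "- \<delta>" "L + 2"] \<delta> by (simp add: \<beta>_def)
  moreover have "1 / (1 + \<epsilon>) < 1 - real (L + 2) * \<delta>"
  proof -
    have "real (L + 2) * \<delta> < real (L + 3) * \<delta>" using \<delta> by simp
    also have "\<dots> = \<epsilon> / (1 + \<epsilon>)" using assms(1) by (simp add: \<delta>_def)
    also have "\<dots> = 1 - 1 / (1 + \<epsilon>)" using assms(1) by (simp add: field_simps)
    finally show ?thesis by simp
  qed
  ultimately have "1 / (1 + \<epsilon>) < \<beta> ^ (L + 2)" by linarith
  then have key: "1 < (1 + \<epsilon>) * \<beta> ^ (L + 2)" using assms(1)
    by (simp only: pos_divide_less_eq mult.commute)
  define a where "a = (1 + \<epsilon>) * (\<beta> * ((1 - \<beta>) * \<beta> ^ L)) - ln (1 / \<beta>)"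
  have "ln (1 / \<beta>) \<le> 1 / \<beta> - 1" using \<beta> by (intro ln_le_minus_one) simp
  also have "\<dots> = (1 - \<beta>) / \<beta>" using \<beta> by (simp add: field_simps)
  also have "\<dots> < (1 - \<beta>) / \<beta> * ((1 + \<epsilon>) * \<beta> ^ (L + 2))"
    using key \<beta> by (metis mult.right_neutral mult_less_cancel_left_pos diff_gt_0_iff_gt divide_pos_pos)
  also have "\<dots> = (1 + \<epsilon>) * (\<beta> * ((1 - \<beta>) * \<beta> ^ L))" using \<beta> by (simp add: power2_eq_square power_add)
  finally have apos: "a > 0" by (simp add: a_def)
  \<comment> \<open>The strict gain \<open>a\<close> per unit of \<open>N\<close> absorbs the terms
    that do not grow with \<open>N\<close>.\<close>
  obtain N :: nat where Na: "real N * a > ln (real \<Delta>) + real L * ln (1 / \<beta>)" 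
    using apos reals_Archimedean3 by blast
  have "ln (1 / \<beta>) \<ge> 0" using \<beta> by (intro ln_ge_zero) simp
  then have "ln (real \<Delta>) + real L * ln (1 / \<beta>) \<ge> 0" using assms(2) by simp
  then have N: "N > 0" using Na by (cases N) auto
  have "\<beta> ^ N / real \<Delta> > 0" using \<beta> assms(2) by simp
  then obtain P where P: "\<beta> ^ P < \<beta> ^ N / real \<Delta>" using \<beta> real_arch_pow_inv by blast
  show ?thesis
  proof (rule that[of \<beta> "1 - \<beta>" N P])
    show "real \<Delta> * (1 - (1 - \<beta>)) ^ P < \<beta> ^ N" using P assms(2) by (simp add: field_simps)
    show "ln (real \<Delta>) + real (N + L) * ln (1 / \<beta>) \<le> (1 + \<epsilon>) * real N * ((1 - (1 - \<beta>)) * ((1 - \<beta>) * \<beta> ^ L))"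
      using Na by (simp add: a_def algebra_simps)
  qed (use \<beta> N in auto)
qed

definition bounded_hypergraph :: "nat \<Rightarrow> nat \<Rightarrow> nat set set \<Rightarrow> bool" where
  "bounded_hypergraph \<Delta> L Q \<longleftrightarrow> finite Q \<and> (\<forall>q\<in>Q. finite q \<and> q \<noteq> {} \<and> card q \<le> L) \<and>
     (\<forall>u. card {q \<in> Q. u \<in> q} \<le> \<Delta>)"

text \<open>Values are in units of \<open>1/N\<close>. The comparison is with integral hitting sets,
  since \<open>Z\<close> will be derived from a dominating set.\<close>

definition lp_approximates :: "real \<Rightarrow> nat \<Rightarrow> nat \<Rightarrow> nat \<Rightarrow> (nat set set \<Rightarrow> nat \<Rightarrow> nat) \<Rightarrow> bool" where
  "lp_approximates \<epsilon> \<Delta> L N f \<longleftrightarrow> N > 0 \<and> (\<forall>Q. bounded_hypergraph \<Delta> L Q \<longrightarrow>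
     (\<forall>q\<in>Q. N \<le> sum (f Q) q) \<and> (\<forall>u. u \<notin> \<Union>Q \<longrightarrow> f Q u = 0) \<and>
     (\<forall>Z. finite Z \<longrightarrow> (\<forall>q\<in>Q. Z \<inter> q \<noteq> {}) \<longrightarrow>
        real (\<Sum>u\<in>\<Union>Q. f Q u) \<le> (1 + \<epsilon>) * real N * real (card Z)))"

lemma lp_run_approximates:
  fixes \<epsilon> :: real and \<Delta> L :: nat
  assumes "\<epsilon> > 0" "\<Delta> \<ge> 1"
  obtains \<beta> \<eta> :: real and N T :: nat where
    "lp_approximates \<epsilon> \<Delta> L N (\<lambda>Q. lp_run \<beta> N \<eta> \<Delta> Q T)"
proof -
  obtain \<beta> \<eta> :: real and N P :: nat where par: "0 < \<beta>" "\<beta> < 1" "0 < \<eta>" "\<eta> < 1" "N > 0"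
    "real \<Delta> * (1 - \<eta>) ^ P < \<beta> ^ N"
    "ln (real \<Delta>) + real (N + L) * ln (1 / \<beta>) \<le> (1 + \<epsilon>) * real N * ((1 - \<eta>) * ((1 - \<beta>) * \<beta> ^ L))"
    using lp_parameters_exist[OF assms] by blast
  have "lp_approximates \<epsilon> \<Delta> L N (\<lambda>Q. lp_run \<beta> N \<eta> \<Delta> Q (N * P))"
    unfolding lp_approximates_def
  proof (intro conjI allI impI ballI)
    show "N > 0" by fact
    fix Q :: "nat set set"
    assume Q: "bounded_hypergraph \<Delta> L Q"
    interpret bounded_cover Q \<Delta> L N \<beta> \<eta>
      using Q par assms by unfold_locales (auto simp: bounded_hypergraph_def)
    show "N \<le> sum (lp_run \<beta> N \<eta> \<Delta> Q (N * P)) q" if "q \<in> Q" for q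
      using covered[OF par(6) that] .
    show "lp_run \<beta> N \<eta> \<Delta> Q (N * P) u = 0" if "u \<notin> \<Union>Q" for u
      using x_outside[OF that] .
    fix Z :: "nat set" assume Z: "finite Z" "\<forall>q\<in>Q. Z \<inter> q \<noteq> {}"
    let ?k = "(1 - \<eta>) * ((1 - \<beta>) * \<beta> ^ L)"
    have kpos: "?k > 0" using par by simp
    have "real (\<Sum>u\<in>\<Union>Q. x (N * P) u) * ?k \<le> real (card Z) * (ln (real \<Delta>) + real (N + L) * ln (1 / \<beta>))"
      using Z by (intro total_x_le) auto
    also have "\<dots> \<le> real (card Z) * ((1 + \<epsilon>) * real N * ?k)" using par(7) by (rule mult_left_mono) simp
    also have "\<dots> = (1 + \<epsilon>) * real N * real (card Z) * ?k" by (simp only: mult_ac)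
    finally show "real (\<Sum>u\<in>\<Union>Q. lp_run \<beta> N \<eta> \<Delta> Q (N * P) u) \<le> (1 + \<epsilon>) * real N * real (card Z)"
      using kpos by (simp only: mult_le_cancel_right_pos)
  qed
  then show ?thesis by (rule that)
qed

section \<open>Locality\<close>

definition nbh :: "(nat \<times> nat) set \<Rightarrow> nat \<Rightarrow> nat set" where
  "nbh E v = insert v (E `` {v})"

definition same_view :: "nat \<Rightarrow> nat \<Rightarrow> nat set \<Rightarrow> (nat \<times> nat) set \<Rightarrow> nat set \<Rightarrow> (nat \<times> nat) set \<Rightarrow> bool" where
  "same_view r v V E V' E' \<longleftrightarrow> simple_graph V E \<and> simple_graph V' E' \<and> v \<in> V \<and> v \<in> V' \<and>
     local_view V E r v = local_view V' E' r v"

lemma ball_subset: "simple_graph V E \<Longrightarrow> v \<in> V \<Longrightarrow> ball_graph V E r v \<subseteq> V"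
proof (induction r)
  case (Suc r)
  then show ?case by (auto simp: ball_graph_def simple_graph_def Id_on_def)
qed (auto simp: ball_graph_def)

lemma ball_add:
  "y \<in> ball_graph V E j v \<Longrightarrow> z \<in> ball_graph V E s y \<Longrightarrow> z \<in> ball_graph V E (j + s) v"
  unfolding ball_graph_def by (simp add: relpow_add) blast

lemma ball_Suc_mono: "simple_graph V E \<Longrightarrow> v \<in> V \<Longrightarrow> ball_graph V E r v \<subseteq> ball_graph V E (Suc r) v"
  using ball_subset[of V E v r] by (auto simp: ball_graph_def Id_on_def)

lemma ball_mono:
  assumes "simple_graph V E" "v \<in> V" "r \<le> s"
  shows "ball_graph V E r v \<subseteq> ball_graph V E s v"
  using assms(3) by (induction rule: dec_induct) (use ball_Suc_mono[OF assms(1,2)] in blast)+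

lemma same_viewD:
  assumes "same_view r v V E V' E'"
  shows "simple_graph V E" "simple_graph V' E'" "v \<in> V" "v \<in> V'"
    "ball_graph V E r v = ball_graph V' E' r v"
    "E \<inter> (ball_graph V E r v \<times> ball_graph V E r v) = E' \<inter> (ball_graph V E r v \<times> ball_graph V E r v)"
  using assms by (auto simp: same_view_def local_view_def Let_def)

lemma same_view_sym: "same_view r v V E V' E' \<Longrightarrow> same_view r v V' E' V E"
  by (auto simp: same_view_def)

text \<open>A walk of \<open>s\<close> steps from \<open>y\<close> stays in the ball around
  \<open>v\<close>, where both graphs have the same edges.\<close>

lemma sub_ball_subset:
  assumes sv: "same_view r v V E V' E'" and y: "y \<in> ball_graph V E j v" and js: "j + s \<le> r"
  shows "ball_graph V E s y \<subseteq> ball_graph V' E' s y"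
  using js
proof (induction s)
  case 0
  then show ?case by (simp add: ball_graph_def)
next
  case (Suc s)
  note D = same_viewD[OF sv]
  show ?case
  proof
    fix u assume "u \<in> ball_graph V E (Suc s) y"
    then obtain z where z: "z \<in> ball_graph V E s y" "(z, u) \<in> Id_on V \<union> E" by (auto simp: ball_graph_def)
    have z': "z \<in> ball_graph V' E' s y" using Suc z by auto
    have "z \<in> ball_graph V E (j + s) v" using ball_add[OF y z(1)] .
    moreover from this have "u \<in> ball_graph V E (Suc (j + s)) v" using z(2) by (auto simp: ball_graph_def)
    ultimately have B: "z \<in> ball_graph V E r v" "u \<in> ball_graph V E r v"
      using ball_mono[OF D(1,3), of "j + s" r] ball_mono[OF D(1,3), of "Suc (j + s)" r] Suc.prems
      by auto
    then have "u \<in> V'" using ball_subset[OF D(2,4)] D(5) by blast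
    moreover have "(z, u) \<in> E' \<or> z = u" using z(2) B D(6) by blast
    ultimately have "(z, u) \<in> Id_on V' \<union> E'" by auto
    then show "u \<in> ball_graph V' E' (Suc s) y" using z' by (auto simp: ball_graph_def)
  qed
qed

text \<open>The ball of radius \<open>r\<close> around a neighbour is contained in the ball of
  radius \<open>r + 1\<close> around \<open>v\<close>: learning a neighbour's result costs one
  round.\<close>

lemma same_view_neighbours:
  assumes sv: "same_view (Suc r) v V E V' E'"
  shows "nbh E v = nbh E' v" "\<And>u. u \<in> nbh E v \<Longrightarrow> same_view r u V E V' E'"
proof -
  note D = same_viewD[OF sv]
  let ?B = "ball_graph V E (Suc r) v"
  have b1: "nbh E v \<subseteq> ball_graph V E 1 v" if "v \<in> V" for V E by (auto simp: nbh_def ball_graph_def that)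
  have nb: "nbh E v \<subseteq> ?B" using b1[OF D(3)] ball_mono[OF D(1,3), of 1 "Suc r"] by auto
  have nb': "nbh E' v \<subseteq> ?B" using b1[OF D(4)] ball_mono[OF D(2,4), of 1 "Suc r"] D(5) by auto
  show eq: "nbh E v = nbh E' v" using nb nb' D(6) unfolding nbh_def by blast
  fix u assume u: "u \<in> nbh E v"
  have uV: "u \<in> V" "u \<in> V'"
    using nb ball_subset[OF D(1,3)] nb' ball_subset[OF D(2,4)] u eq D(5) by blast+
  have u1: "u \<in> ball_graph V E 1 v" "u \<in> ball_graph V' E' 1 v"
    using b1[OF D(3), of E] b1[OF D(4), of E'] u eq by auto
  have Br: "ball_graph V E r u = ball_graph V' E' r u"
    using sub_ball_subset[OF sv u1(1), of r] sub_ball_subset[OF same_view_sym[OF sv] u1(2), of r] by auto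
  have "ball_graph V E r u \<subseteq> ?B" using ball_add[OF u1(1)] by auto
  then have "E \<inter> (ball_graph V E r u \<times> ball_graph V E r u) = E' \<inter> (ball_graph V E r u \<times> ball_graph V E r u)"
    using D(6) by blast
  then show "same_view r u V E V' E'"
    using D uV Br by (simp add: same_view_def local_view_def Let_def)
qed

text \<open>One radius serves all graphs, which expresses a constant number of rounds. The value
  type is free so that intermediate results can be sets or numbers.\<close>

definition is_local :: "(nat set \<Rightarrow> (nat \<times> nat) set \<Rightarrow> nat \<Rightarrow> 'a) \<Rightarrow> bool" where
  "is_local f \<longleftrightarrow> (\<exists>r. \<forall>V E V' E' v. same_view r v V E V' E' \<longrightarrow> f V E v = f V' E' v)"

lemma is_local_const: "is_local (\<lambda>V E v. c v)"
  by (auto simp: is_local_def)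

lemma same_view_Suc: "same_view (Suc r) v V E V' E' \<Longrightarrow> same_view r v V E V' E'"
  using same_view_neighbours(2)[of r v V E V' E' v] by (simp add: nbh_def)

lemma same_view_mono:
  assumes "same_view s v V E V' E'" "r \<le> s"
  shows "same_view r v V E V' E'"
  using assms(2,1) by (induction rule: dec_induct) (auto dest: same_view_Suc)

lemma is_local_Pair:
  assumes "is_local f" "is_local g"
  shows "is_local (\<lambda>V E v. (f V E v, g V E v))"
proof -
  obtain r s where "\<forall>V E V' E' v. same_view r v V E V' E' \<longrightarrow> f V E v = f V' E' v"
    "\<forall>V E V' E' v. same_view s v V E V' E' \<longrightarrow> g V E v = g V' E' v"
    using assms unfolding is_local_def by metis
  then have "\<forall>V E V' E' v. same_view (max r s) v V E V' E' \<longrightarrow> (f V E v, g V E v) = (f V' E' v, g V' E' v)"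
    using same_view_mono[of "max r s"] by (metis max.cobounded1 max.cobounded2)
  then show ?thesis unfolding is_local_def by blast
qed

text \<open>Every rule of the algorithm inspects at most two steps, so each application adds two to
  the radius.\<close>

lemma is_localI2:
  assumes f: "is_local f"
    and g: "\<And>V E V' E' v. simple_graph V E \<Longrightarrow> simple_graph V' E' \<Longrightarrow> v \<in> V \<Longrightarrow> v \<in> V' \<Longrightarrow>
      nbh E v = nbh E' v \<Longrightarrow> (\<And>w. w \<in> nbh E v \<Longrightarrow> nbh E w = nbh E' w) \<Longrightarrow>
      (\<And>w u. w \<in> nbh E v \<Longrightarrow> u \<in> nbh E w \<Longrightarrow> f V E u = f V' E' u) \<Longrightarrow> g V E v = g V' E' v"
  shows "is_local g"
proof -
  obtain r where r: "\<And>V E V' E' v. same_view r v V E V' E' \<Longrightarrow> f V E v = f V' E' v"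
    using f unfolding is_local_def by blast
  have "g V E v = g V' E' v" if sv: "same_view (Suc (Suc r)) v V E V' E'" for V E V' E' v
    using same_view_neighbours[OF sv] same_view_neighbours[of r _ V E V' E'] r
    by (intro g same_viewD[OF sv]) blast+
  then show ?thesis unfolding is_local_def by blast
qed

lemma nbh_eq_neighbours:
  assumes "simple_graph V E" "simple_graph V' E'" "nbh E v = nbh E' v"
  shows "E `` {v} = E' `` {v}"
proof -
  have "v \<notin> E `` {v}" "v \<notin> E' `` {v}" using assms(1,2) by (auto simp: simple_graph_def)
  then show ?thesis using assms(3) unfolding nbh_def by (simp add: insert_ident)
qed

text \<open>One round at \<open>u\<close> reads only the constraints containing \<open>u\<close> and
  the values on them, all within two steps by \<open>near\<close>.\<close>

lemma is_local_lp_run: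
  assumes inc: "is_local (\<lambda>V E u. {q \<in> Q V E. u \<in> q})"
    and near: "\<And>V E u q. simple_graph V E \<Longrightarrow> u \<in> V \<Longrightarrow> q \<in> Q V E \<Longrightarrow> u \<in> q \<Longrightarrow> q \<subseteq> (\<Union>w\<in>nbh E u. nbh E w)"
  shows "is_local (\<lambda>V E u. lp_run \<beta> N \<eta> \<Delta> (Q V E) t u)"
proof (induction t)
  case 0
  then show ?case using is_local_const[of "\<lambda>_. 0"] by simp
next
  case (Suc t)
  show ?case
  proof (rule is_localI2[OF is_local_Pair[OF Suc.IH inc]])
    fix V E V' E' v
    assume *: "simple_graph V E" "v \<in> V" "\<And>w u. w \<in> nbh E v \<Longrightarrow> u \<in> nbh E w \<Longrightarrow>
       (lp_run \<beta> N \<eta> \<Delta> (Q V E) t u, {q \<in> Q V E. u \<in> q}) = (lp_run \<beta> N \<eta> \<Delta> (Q V' E') t u, {q \<in> Q V' E'. u \<in> q})"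
    have vv: "v \<in> nbh E v" by (simp add: nbh_def)
    have Qeq: "{q \<in> Q V E. v \<in> q} = {q \<in> Q V' E'. v \<in> q}" and xeq: "lp_run \<beta> N \<eta> \<Delta> (Q V E) t v = lp_run \<beta> N \<eta> \<Delta> (Q V' E') t v"
      using *(3)[OF vv vv] by auto
    have "lp_weight \<beta> N (lp_run \<beta> N \<eta> \<Delta> (Q V E) t) q = lp_weight \<beta> N (lp_run \<beta> N \<eta> \<Delta> (Q V' E') t) q"
      if "q \<in> {q \<in> Q V E. v \<in> q}" for q
    proof -
      have "q \<subseteq> (\<Union>w\<in>nbh E v. nbh E w)" using near[OF *(1,2)] that by blast
      then have "sum (lp_run \<beta> N \<eta> \<Delta> (Q V E) t) q = sum (lp_run \<beta> N \<eta> \<Delta> (Q V' E') t) q"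
        using *(3) by (intro sum.cong) blast+
      then show ?thesis by (simp add: lp_weight_def)
    qed
    then have "lp_load \<beta> N (Q V E) (lp_run \<beta> N \<eta> \<Delta> (Q V E) t) v = lp_load \<beta> N (Q V' E') (lp_run \<beta> N \<eta> \<Delta> (Q V' E') t) v"
      unfolding lp_load_def Qeq[symmetric] by (intro sum.cong) auto
    then show "lp_run \<beta> N \<eta> \<Delta> (Q V E) (Suc t) v = lp_run \<beta> N \<eta> \<Delta> (Q V' E') (Suc t) v"
      by (simp add: xeq)
  qed
qed

lemma is_local_algorithm:
  assumes "is_local f"
  shows "\<exists>r A. \<forall>V E. simple_graph V E \<longrightarrow> local_output A r V E = {v \<in> V. f V E v}"
proof -
  obtain r where r: "\<And>V E V' E' v. same_view r v V E V' E' \<Longrightarrow> f V E v = f V' E' v"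
    using assms unfolding is_local_def by blast
  \<comment> \<open>A view is accepted if some graph showing it accepts its centre; by locality
    every such graph gives the same answer.\<close>
  define A where "A view \<longleftrightarrow> (\<exists>V E v. simple_graph V E \<and> v \<in> V \<and> view = local_view V E r v \<and> f V E v)" for view
  have "A (local_view V E r v) \<longleftrightarrow> f V E v" if G: "simple_graph V E" "v \<in> V" for V E v
  proof
    assume "A (local_view V E r v)"
    then obtain V' E' v' where *: "simple_graph V' E'" "v' \<in> V'" "local_view V E r v = local_view V' E' r v'" "f V' E' v'"
      unfolding A_def by blast
    then have "v' = v" by (simp add: local_view_def Let_def)
    then show "f V E v" using * r[of v V E V' E'] G by (simp add: same_view_def)
  qed (use that A_def in blast)
  then have "\<forall>V E. simple_graph V E \<longrightarrow> local_output A r V E = {v \<in> V. f V E v}"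
    by (auto simp: local_output_def)
  then show ?thesis by blast
qed

section \<open>The algorithm\<close>

text \<open>\<open>hard\<close>, \<open>picked\<close>, \<open>crowded\<close>, \<open>big\<close> and \<open>leftover\<close> vertices are put into the dominating set in this
  order; \<open>open1\<close>, \<open>open2\<close>, \<open>open3\<close> are the vertices still undominated after the first three steps.
  Twins, that is, vertices with the same trace on \<open>open2\<close>, are represented by the one of least identifier.\<close>

locale domination_algorithm =
  fixes k T L M N1 T1 N2 T2 :: nat and \<beta>1 \<eta>1 \<beta>2 \<eta>2 :: real
begin

text \<open>\<open>v\<close> itself is excluded, as it dominates its whole neighbourhood alone.
  Drawing \<open>A\<close> from two steps around \<open>v\<close> makes the test local.\<close>

definition hard :: "(nat \<times> nat) set \<Rightarrow> nat \<Rightarrow> bool" where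
  "hard E v \<longleftrightarrow> \<not> (\<exists>A. A \<subseteq> (\<Union>w\<in>E `` {v}. nbh E w) - {v} \<and> card A \<le> k \<and> (\<forall>w\<in>E `` {v}. A \<inter> nbh E w \<noteq> {}))"

definition open1 :: "(nat \<times> nat) set \<Rightarrow> nat \<Rightarrow> bool" where
  "open1 E v \<longleftrightarrow> (\<forall>u\<in>nbh E v. \<not> hard E u)"

text \<open>Hardness of \<open>v\<close> is tested inside the counted set, so that it is looked up
  only for vertices two steps from \<open>u\<close>.\<close>

definition partners :: "(nat \<times> nat) set \<Rightarrow> nat \<Rightarrow> nat set" where
  "partners E u = {v. v \<noteq> u \<and> \<not> hard E u \<and> T \<le> card {w \<in> E `` {u}. v \<in> E `` {w} \<and> \<not> hard E v \<and> open1 E w}}"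

definition pairs :: "(nat \<times> nat) set \<Rightarrow> nat set set" where
  "pairs E = {{u, v} | u v. v \<in> partners E u}"

definition x1 :: "(nat \<times> nat) set \<Rightarrow> nat \<Rightarrow> nat" where
  "x1 E = lp_run \<beta>1 N1 \<eta>1 k (pairs E) T1"

text \<open>Threshold rounding for vertex cover: one member of a covered pair carries at least half
  of \<open>N1\<close>.\<close>

definition picked :: "(nat \<times> nat) set \<Rightarrow> nat \<Rightarrow> bool" where
  "picked E u \<longleftrightarrow> N1 \<le> 2 * x1 E u"

definition open2 :: "(nat \<times> nat) set \<Rightarrow> nat \<Rightarrow> bool" where
  "open2 E v \<longleftrightarrow> (\<forall>u\<in>nbh E v. \<not> hard E u \<and> \<not> picked E u)"

definition trace :: "(nat \<times> nat) set \<Rightarrow> nat \<Rightarrow> nat set" where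
  "trace E u = {v \<in> nbh E u. open2 E v}"

text \<open>Twins with a nonempty trace are at most two steps apart, so the local minimum is the
  minimum of the whole class.\<close>

definition rep :: "(nat \<times> nat) set \<Rightarrow> nat \<Rightarrow> bool" where
  "rep E u \<longleftrightarrow> trace E u \<noteq> {} \<and> (\<forall>w\<in>nbh E u. \<forall>u'\<in>nbh E w. trace E u' = trace E u \<longrightarrow> u \<le> u')"

definition crowded :: "(nat \<times> nat) set \<Rightarrow> nat \<Rightarrow> bool" where
  "crowded E v \<longleftrightarrow> open2 E v \<and> L < card {u \<in> nbh E v. rep E u}"

definition open3 :: "(nat \<times> nat) set \<Rightarrow> nat \<Rightarrow> bool" where
  "open3 E v \<longleftrightarrow> open2 E v \<and> (\<forall>u\<in>nbh E v. \<not> crowded E u)"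

definition demands :: "nat set \<Rightarrow> (nat \<times> nat) set \<Rightarrow> nat set set" where
  "demands V E = {{u \<in> nbh E v. rep E u} | v. v \<in> V \<and> open3 E v}"

definition x2 :: "nat set \<Rightarrow> (nat \<times> nat) set \<Rightarrow> nat \<Rightarrow> nat" where
  "x2 V E = lp_run \<beta>2 N2 \<eta>2 M (demands V E) T2"

text \<open>With threshold \<open>t * N2\<close>, big vertices cost a factor \<open>1 / t\<close>
  and leftover ones \<open>2 / (1 - 3 * t)\<close>, as computed in \<open>lp_rounding\<close>; the
  two agree at \<open>t = 1 / 5\<close>.\<close>

definition big :: "nat set \<Rightarrow> (nat \<times> nat) set \<Rightarrow> nat \<Rightarrow> bool" where
  "big V E u \<longleftrightarrow> N2 \<le> 5 * x2 V E u"

definition leftover :: "nat set \<Rightarrow> (nat \<times> nat) set \<Rightarrow> nat \<Rightarrow> bool" where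
  "leftover V E v \<longleftrightarrow> open3 E v \<and> (\<forall>u\<in>nbh E v. \<not> big V E u)"

definition chosen :: "nat set \<Rightarrow> (nat \<times> nat) set \<Rightarrow> nat \<Rightarrow> bool" where
  "chosen V E v \<longleftrightarrow> hard E v \<or> picked E v \<or> crowded E v \<or> big V E v \<or> leftover V E v"

section \<open>Locality and correctness of the rules\<close>

lemma nbh_sym: "simple_graph V E \<Longrightarrow> u \<in> nbh E v \<longleftrightarrow> v \<in> nbh E u"
  by (auto simp: nbh_def simple_graph_def dest: symD)

lemma nbh_subset: "simple_graph V E \<Longrightarrow> v \<in> V \<Longrightarrow> nbh E v \<subseteq> V"
  by (auto simp: nbh_def simple_graph_def)

lemma nbh_self: "v \<in> nbh E v"
  by (simp add: nbh_def)

lemma is_local_hard: "is_local (\<lambda>V E. hard E)"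
proof (rule is_localI2[OF is_local_const[of "\<lambda>v. v"]])
  fix V E V' E' v
  assume *: "simple_graph V E" "simple_graph V' E'" "nbh E v = nbh E' v" "\<And>w. w \<in> nbh E v \<Longrightarrow> nbh E w = nbh E' w"
  have N: "E `` {v} = E' `` {v}" using nbh_eq_neighbours[OF *(1,2,3)] .
  have W: "nbh E' w = nbh E w" if "w \<in> E `` {v}" for w using *(4)[of w] that by (simp add: nbh_def)
  have 1: "nbh E' ` (E `` {v}) = nbh E ` (E `` {v})" using W by (intro image_cong) auto
  have 2: "(\<forall>w\<in>E `` {v}. A \<inter> nbh E' w \<noteq> {}) \<longleftrightarrow> (\<forall>w\<in>E `` {v}. A \<inter> nbh E w \<noteq> {})" for A using W by auto
  show "hard E v = hard E' v" unfolding hard_def N[symmetric] 1 2 ..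
qed

lemma is_local_open1: "is_local (\<lambda>V E. open1 E)"
  by (rule is_localI2[OF is_local_hard]) (use nbh_self in \<open>auto simp: open1_def\<close>)

lemma partners_sym: "simple_graph V E \<Longrightarrow> T > 0 \<Longrightarrow> v \<in> partners E u \<Longrightarrow> u \<in> partners E v"
proof -
  assume G: "simple_graph V E" and T: "T > 0" and v: "v \<in> partners E u"
  let ?S = "{w \<in> E `` {u}. v \<in> E `` {w} \<and> \<not> hard E v \<and> open1 E w}"
  have "T \<le> card ?S" using v unfolding partners_def by blast
  then have "?S \<noteq> {}" using T by (metis card.empty not_le)
  then have "\<not> hard E v" by blast
  moreover have "?S \<subseteq> {w \<in> E `` {v}. u \<in> E `` {w} \<and> \<not> hard E u \<and> open1 E w}"
    using G v by (auto simp: simple_graph_def partners_def dest: symD)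
  then have "card ?S \<le> card {w \<in> E `` {v}. u \<in> E `` {w} \<and> \<not> hard E u \<and> open1 E w}"
    by (intro card_mono finite_subset[OF _ finite_neighbours[OF G, of v]]) auto
  ultimately show ?thesis using v by (auto simp: partners_def)
qed

lemma partners_near: "T > 0 \<Longrightarrow> v \<in> partners E u \<Longrightarrow> v \<in> (\<Union>w\<in>nbh E u. nbh E w)"
proof -
  assume T: "T > 0" and v: "v \<in> partners E u"
  then have "T \<le> card {w \<in> E `` {u}. v \<in> E `` {w} \<and> \<not> hard E v \<and> open1 E w}"
    unfolding partners_def by blast
  then have "{w \<in> E `` {u}. v \<in> E `` {w} \<and> \<not> hard E v \<and> open1 E w} \<noteq> {}"
    using T by (metis card.empty not_le)
  then show ?thesis by (auto simp: nbh_def)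
qed

lemma pairs_at: "simple_graph V E \<Longrightarrow> T > 0 \<Longrightarrow> {q \<in> pairs E. u \<in> q} = (\<lambda>v. {u, v}) ` partners E u"
  using partners_sym unfolding pairs_def by fastforce

lemma is_local_partners: "is_local (\<lambda>V E. partners E)"
proof (rule is_localI2[OF is_local_Pair[OF is_local_hard is_local_open1]])
  fix V E V' E' u
  assume *: "simple_graph V E" "simple_graph V' E'" "nbh E u = nbh E' u" "\<And>w. w \<in> nbh E u \<Longrightarrow> nbh E w = nbh E' w"
    "\<And>w v. w \<in> nbh E u \<Longrightarrow> v \<in> nbh E w \<Longrightarrow> (hard E v, open1 E v) = (hard E' v, open1 E' v)"
  have N: "E `` {u} = E' `` {u}" using nbh_eq_neighbours[OF *(1,2,3)] .
  have Nw: "E `` {w} = E' `` {w}" if "w \<in> nbh E u" for w using nbh_eq_neighbours[OF *(1,2) *(4)[OF that]] .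
  have hu: "hard E u = hard E' u" using *(5)[of u u] nbh_self by auto
  have "{w \<in> E `` {u}. v \<in> E `` {w} \<and> \<not> hard E v \<and> open1 E w} = {w \<in> E' `` {u}. v \<in> E' `` {w} \<and> \<not> hard E' v \<and> open1 E' w}" for v
  proof -
    have "v \<in> E `` {w} \<and> \<not> hard E v \<and> open1 E w \<longleftrightarrow> v \<in> E' `` {w} \<and> \<not> hard E' v \<and> open1 E' w" if w: "w \<in> E `` {u}" for w
    proof -
      have w': "w \<in> nbh E u" using w by (simp add: nbh_def)
      have "open1 E w = open1 E' w" using *(5)[OF w' nbh_self] by simp
      moreover have "hard E v = hard E' v" if "v \<in> E `` {w}" using *(5)[OF w', of v] that by (simp add: nbh_def)
      ultimately show ?thesis using Nw[OF w'] by blast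
    qed
    then show ?thesis unfolding N[symmetric] by blast
  qed
  then show "partners E u = partners E' u" unfolding partners_def hu by simp
qed

lemma is_local_x1:
  assumes "T > 0"
  shows "is_local (\<lambda>V E. x1 E)"
  unfolding x1_def
proof (rule is_local_lp_run)
  show "is_local (\<lambda>V E u. {q \<in> pairs E. u \<in> q})"
  proof (rule is_localI2[OF is_local_partners])
    fix V E V' E' v
    assume *: "simple_graph V E" "simple_graph V' E'"
      "\<And>w u. w \<in> nbh E v \<Longrightarrow> u \<in> nbh E w \<Longrightarrow> partners E u = partners E' u"
    show "{q \<in> pairs E. v \<in> q} = {q \<in> pairs E'. v \<in> q}"
      unfolding pairs_at[OF *(1) assms] pairs_at[OF *(2) assms] *(3)[OF nbh_self nbh_self] ..
  qed
  fix V E u q assume "simple_graph V E" "q \<in> pairs E" "u \<in> q"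
  then obtain v where "v \<in> partners E u" "q = {u, v}" using pairs_at[of V E u] assms by blast
  then show "q \<subseteq> (\<Union>w\<in>nbh E u. nbh E w)" using partners_near[OF assms] nbh_self by fastforce
qed

lemma is_local_picked: "T > 0 \<Longrightarrow> is_local (\<lambda>V E. picked E)"
proof (rule is_localI2[OF is_local_x1])
  fix V E V' E' v
  assume *: "\<And>w u. w \<in> nbh E v \<Longrightarrow> u \<in> nbh E w \<Longrightarrow> x1 E u = x1 E' u"
  show "picked E v = picked E' v" unfolding picked_def *[OF nbh_self nbh_self] ..
qed auto

lemma is_local_open2: "T > 0 \<Longrightarrow> is_local (\<lambda>V E. open2 E)"
  by (rule is_localI2[OF is_local_Pair[OF is_local_hard is_local_picked]])
    (use nbh_self in \<open>auto simp: open2_def\<close>)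

lemma is_local_trace: "T > 0 \<Longrightarrow> is_local (\<lambda>V E. trace E)"
  by (rule is_localI2[OF is_local_open2]) (use nbh_self in \<open>auto simp: trace_def\<close>)

lemma is_local_rep:
  assumes "T > 0"
  shows "is_local (\<lambda>V E. rep E)"
proof (rule is_localI2[OF is_local_trace[OF assms]])
  fix V E V' E' u
  assume *: "nbh E u = nbh E' u" "\<And>w. w \<in> nbh E u \<Longrightarrow> nbh E w = nbh E' w"
    "\<And>w v. w \<in> nbh E u \<Longrightarrow> v \<in> nbh E w \<Longrightarrow> trace E v = trace E' v"
  have "trace E u = trace E' u" using *(3) nbh_self by blast
  then show "rep E u = rep E' u" unfolding rep_def using * by auto
qed

lemma is_local_crowded: "T > 0 \<Longrightarrow> is_local (\<lambda>V E. crowded E)"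
proof (rule is_localI2[OF is_local_Pair[OF is_local_open2 is_local_rep]])
  fix V E V' E' u
  assume *: "nbh E u = nbh E' u" 
    "\<And>w v. w \<in> nbh E u \<Longrightarrow> v \<in> nbh E w \<Longrightarrow> (open2 E v, rep E v) = (open2 E' v, rep E' v)"
  have "{v \<in> nbh E u. rep E v} = {v \<in> nbh E' u. rep E' v}" using * nbh_self by auto
  moreover have "open2 E u = open2 E' u" using *(2)[of u u] nbh_self by auto
  ultimately show "crowded E u = crowded E' u" by (simp add: crowded_def)
qed auto

lemma is_local_open3: "T > 0 \<Longrightarrow> is_local (\<lambda>V E. open3 E)"
proof (rule is_localI2[OF is_local_Pair[OF is_local_open2 is_local_crowded]])
  fix V E V' E' v
  assume *: "nbh E v = nbh E' v"
    "\<And>w u. w \<in> nbh E v \<Longrightarrow> u \<in> nbh E w \<Longrightarrow> (open2 E u, crowded E u) = (open2 E' u, crowded E' u)"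
  have "open2 E v = open2 E' v" using *(2)[OF nbh_self nbh_self] by simp
  then show "open3 E v = open3 E' v" unfolding open3_def using * nbh_self by auto
qed auto

lemma demands_at:
  assumes "simple_graph V E" "u \<in> V"
  shows "{q \<in> demands V E. u \<in> q} = (\<lambda>v. {u \<in> nbh E v. rep E u}) ` {v \<in> nbh E u. open3 E v \<and> rep E u}"
  using nbh_sym[OF assms(1), of u] nbh_subset[OF assms] unfolding demands_def by auto

lemma is_local_x2:
  assumes T: "T > 0"
  shows "is_local x2"
  unfolding x2_def
proof (rule is_local_lp_run)
  show "is_local (\<lambda>V E u. {q \<in> demands V E. u \<in> q})"
  proof (rule is_localI2[OF is_local_Pair[OF is_local_open3[OF T] is_local_rep[OF T]]])
    fix V E V' E' u
    assume *: "simple_graph V E" "simple_graph V' E'" "u \<in> V" "u \<in> V'" "nbh E u = nbh E' u"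
      "\<And>w. w \<in> nbh E u \<Longrightarrow> nbh E w = nbh E' w"
      "\<And>w v. w \<in> nbh E u \<Longrightarrow> v \<in> nbh E w \<Longrightarrow> (open3 E v, rep E v) = (open3 E' v, rep E' v)"
    have "{u \<in> nbh E v. rep E u} = {u \<in> nbh E' v. rep E' u}" if "v \<in> nbh E u" for v
      using *(6)[OF that] *(7)[OF that] by auto
    moreover have "{v \<in> nbh E u. open3 E v \<and> rep E u} = {v \<in> nbh E' u. open3 E' v \<and> rep E' u}"
      using *(5) *(7) nbh_self by blast
    ultimately show "{q \<in> demands V E. u \<in> q} = {q \<in> demands V' E'. u \<in> q}"
      unfolding demands_at[OF *(1,3)] demands_at[OF *(2,4)] by (intro image_cong) auto
  qed
  fix V E u q assume "simple_graph V E" "u \<in> V" "q \<in> demands V E" "u \<in> q"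
  then have "q \<in> (\<lambda>v. {u \<in> nbh E v. rep E u}) ` {v \<in> nbh E u. open3 E v \<and> rep E u}"
    using demands_at by blast
  then show "q \<subseteq> (\<Union>w\<in>nbh E u. nbh E w)" by blast
qed

lemma is_local_chosen:
  assumes T: "T > 0"
  shows "is_local chosen"
proof (rule is_localI2[OF is_local_Pair[OF is_local_hard is_local_Pair[OF is_local_picked[OF T]
      is_local_Pair[OF is_local_crowded[OF T] is_local_Pair[OF is_local_x2[OF T] is_local_open3[OF T]]]]]])
  fix V E V' E' u
  assume *: "nbh E u = nbh E' u"
     "\<And>w v. w \<in> nbh E u \<Longrightarrow> v \<in> nbh E w \<Longrightarrow> (hard E v, picked E v, crowded E v, x2 V E v, open3 E v) =
        (hard E' v, picked E' v, crowded E' v, x2 V' E' v, open3 E' v)"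
  have "big V E v = big V' E' v" if "v \<in> nbh E u" for v
    using *(2)[OF that nbh_self] by (simp add: big_def)
  then show "chosen V E u = chosen V' E' u"
    using *(1) *(2)[OF nbh_self nbh_self] nbh_self[of u E] unfolding chosen_def leftover_def by auto
qed

lemma chosen_dominating:
  assumes G: "simple_graph V E"
  shows "dominating_set V E {v \<in> V. chosen V E v}"
  unfolding dominating_set_def
proof (intro conjI ballI)
  fix v assume v: "v \<in> V"
  have "\<exists>u\<in>nbh E v. chosen V E u"
  proof (rule ccontr)
    assume no: "\<not> ?thesis"
    then have "open2 E v" by (auto simp: open2_def chosen_def)
    moreover then have "open3 E v" using no by (auto simp: open3_def chosen_def)
    ultimately have "leftover V E v" using no by (auto simp: leftover_def chosen_def)
    then show False using no nbh_self by (auto simp: chosen_def)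
  qed
  then obtain u where "u \<in> nbh E v" "chosen V E u" by blast
  then show "v \<in> {v \<in> V. chosen V E v} \<or> (\<exists>u\<in>{v \<in> V. chosen V E v}. (v, u) \<in> E)"
    using v G by (auto simp: nbh_def simple_graph_def)
qed auto

end

section \<open>The approximation ratio\<close>

text \<open>Rounding in the style of Bansal and Umboh. Slicing \<open>x\<close> into its superlevel sets replaces the
  orientation of out-degree two that sparsity provides.\<close>

lemma lp_rounding:
  fixes x :: "nat \<Rightarrow> nat"
  assumes G: "simple_graph V E" "planar V E" and bip: "bipartite V E"
    and R: "R \<subseteq> V" and cov: "\<And>v. v \<in> R \<Longrightarrow> N \<le> sum x (nbh E v)"
    and H: "H = {u \<in> V. N \<le> 5 * x u}" and U: "U = {v \<in> R. nbh E v \<inter> H = {}}"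
  shows "N * (card H + card U) \<le> 5 * sum x V"
proof (cases "U = {}")
  case True
  have finV: "finite V" using G(1) by (simp add: simple_graph_def)
  have "N * card H = (\<Sum>u\<in>H. N)" by simp
  also have "\<dots> \<le> (\<Sum>u\<in>H. 5 * x u)" using H by (intro sum_mono) auto
  also have "\<dots> \<le> (\<Sum>u\<in>V. 5 * x u)" using H finV by (intro sum_mono2) auto
  finally show ?thesis using True by (simp add: sum_distrib_left)
next
  case False
  have sg: "finite V" "E \<subseteq> V \<times> V" "\<And>x. (x, x) \<notin> E" using G(1) by (auto simp: simple_graph_def)
  define W where "W = V - H"
  have UV: "U \<subseteq> V" using U R by auto
  have fin: "finite U" "finite W" "finite H" using UV sg H by (auto intro: finite_subset simp: W_def)
  have nbW: "nbh E v \<subseteq> W" if "v \<in> U" for v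
  proof -
    have "nbh E v \<subseteq> V" using that UV sg by (auto simp: nbh_def)
    then show ?thesis using that U by (auto simp: W_def)
  qed
  have UW: "U \<subseteq> W" using nbW by (auto simp: nbh_def)
  \<comment> \<open>The largest integer strictly below \<open>N / 5\<close>, hence the largest value
    outside \<open>H\<close>, provided that \<open>N > 0\<close>.\<close>
  define m where "m = (N - 1) div 5"
  have "N > 0"
  proof (rule ccontr)
    assume "\<not> N > 0"
    then have "H = V" using H by auto
    then show False using UW False by (auto simp: W_def)
  qed
  then have m5: "5 * m \<le> N" by (simp add: m_def)
  have xm: "x u \<le> m" if "u \<in> W" for u
  proof -
    have "5 * x u \<le> N - 1" using that H by (auto simp: W_def)
    then show ?thesis unfolding m_def by (metis div_le_mono nonzero_mult_div_cancel_left zero_neq_numeral)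
  qed
  have slices: "x u = (\<Sum>j<m. of_bool (j < x u))" if "u \<in> W" for u
  proof -
    have "{..<m} \<inter> {j. j < x u} = {..<x u}" using xm[OF that] by auto
    then show ?thesis by (simp add: sum_of_bool_eq)
  qed
  have "(\<Sum>v\<in>U. \<Sum>u\<in>E `` {v}. x u) = (\<Sum>v\<in>U. \<Sum>u\<in>E `` {v}. \<Sum>j<m. of_bool (j < x u))"
    using nbW by (intro sum.cong refl slices) (auto simp: nbh_def)
  also have "\<dots> = (\<Sum>v\<in>U. \<Sum>j<m. \<Sum>u\<in>E `` {v}. of_bool (j < x u))"
    by (intro sum.cong refl sum.swap)
  also have "\<dots> = (\<Sum>j<m. \<Sum>v\<in>U. \<Sum>u\<in>E `` {v}. of_bool (j < x u))" by (rule sum.swap)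
  also have "\<dots> \<le> (\<Sum>j<m. 2 * card U + 2 * card {u \<in> W. j < x u})"
  proof (intro sum_mono)
    fix j
    have "(\<Sum>v\<in>U. \<Sum>u\<in>E `` {v}. of_bool (j < x u)) = (\<Sum>v\<in>U. card {u \<in> E `` {v}. j < x u})"
      using finite_neighbours[OF G(1)] by (intro sum.cong refl) (simp add: sum_of_bool_eq Int_def)
    also have "\<dots> = card (SIGMA v:U. {u \<in> E `` {v}. j < x u})"
      by (intro card_SigmaI[symmetric] fin ballI finite_subset[OF _ finite_neighbours[OF G(1)]]) auto
    also have "(SIGMA v:U. {u \<in> E `` {v}. j < x u}) = E \<inter> U \<times> {u \<in> W. j < x u}"
      using nbW by (auto simp: nbh_def)
    also have "card \<dots> \<le> 2 * card U + 2 * card {u \<in> W. j < x u}"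
      by (rule bipartite_planar_cross_edges[OF G bip UV]) (auto simp: W_def)
    finally show "(\<Sum>v\<in>U. \<Sum>u\<in>E `` {v}. of_bool (j < x u)) \<le> 2 * card U + 2 * card {u \<in> W. j < x u}" .
  qed
  also have "\<dots> = 2 * m * card U + 2 * (\<Sum>j<m. card {u \<in> W. j < x u})"
    by (simp add: sum.distrib sum_distrib_left)
  also have "(\<Sum>j<m. card {u \<in> W. j < x u}) = (\<Sum>j<m. \<Sum>u\<in>W. of_bool (j < x u))"
    using fin by (intro sum.cong refl) (simp add: sum_of_bool_eq Int_def)
  also have "\<dots> = (\<Sum>u\<in>W. \<Sum>j<m. of_bool (j < x u))" by (rule sum.swap)
  also have "\<dots> = sum x W" by (intro sum.cong refl slices[symmetric])
  finally have nb: "(\<Sum>v\<in>U. \<Sum>u\<in>E `` {v}. x u) \<le> 2 * m * card U + 2 * sum x W" .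
  have "N * card U = (\<Sum>v\<in>U. N)" by simp
  also have "\<dots> \<le> (\<Sum>v\<in>U. sum x (nbh E v))" using U cov by (intro sum_mono) auto
  also have "\<dots> = sum x U + (\<Sum>v\<in>U. \<Sum>u\<in>E `` {v}. x u)"
    using sg(3) finite_neighbours[OF G(1)] by (simp add: nbh_def sum.distrib)
  also have "sum x U \<le> m * card U" using sum_bounded_above[of U x m] xm UW by (auto simp: mult.commute)
  \<comment> \<open>Each uncovered vertex contributes one \<open>m\<close> for its own value and two
    through the slices at its neighbours.\<close>
  finally have main: "N * card U \<le> 3 * (m * card U) + 2 * sum x W" using nb by linarith
  have "5 * (m * card U) \<le> N * card U" using m5 by (simp flip: mult.assoc)
  with main have NU: "N * card U \<le> 5 * sum x W" by linarith
  have "N * card H = (\<Sum>u\<in>H. N)" by simp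
  also have "\<dots> \<le> (\<Sum>u\<in>H. 5 * x u)" using H by (intro sum_mono) auto
  also have "\<dots> = 5 * sum x H" by (simp add: sum_distrib_left)
  finally have "N * card H \<le> 5 * sum x H" .
  moreover have "sum x V = sum x H + sum x W"
    unfolding W_def using sg H by (subst sum.subset_diff[of H V]) auto
  ultimately show ?thesis using NU by (simp add: distrib_left)
qed

lemma card_le_by_cover:
  assumes "finite A" and X: "\<And>w. w \<in> X \<Longrightarrow> \<exists>a\<in>A. w \<in> f a" and b: "\<And>a. a \<in> A \<Longrightarrow> card (X \<inter> f a) \<le> b"
  shows "card X \<le> card A * b"
proof -
  have "X = (\<Union>a\<in>A. X \<inter> f a)" using X by blast
  then have "card X \<le> (\<Sum>a\<in>A. card (X \<inter> f a))" using card_UN_le[OF assms(1), of "\<lambda>a. X \<inter> f a"] by simp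
  also have "\<dots> \<le> card A * b" using sum_bounded_above[of A "\<lambda>a. card (X \<inter> f a)" b] b by simp
  finally show ?thesis .
qed

text \<open>The 7 in \<open>T\<close> comes from \<open>triple_common\<close>, and
  \<open>k + 1\<close> exceeds the number of vertices needed to dominate the neighbourhood of a
  vertex that is not hard. \<open>M\<close> allows \<open>T\<close> open neighbours for each of
  these \<open>k\<close> helpers, plus the vertex itself. \<open>ke\<close> and \<open>Le\<close>
  are what \<open>many_dominators_bound\<close> and \<open>card_crowded\<close> require.\<close>

locale planar_instance = domination_algorithm +
  fixes e :: real and V :: "nat set" and E :: "(nat \<times> nat) set" and D :: "nat set"
  assumes G: "simple_graph V E" "planar V E" and bip: "bipartite V E" and D: "dominating_set V E D"
    and T: "T = 7 * (k + 1)" and M: "M = k * T + 1"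
    and e: "0 < e" "e \<le> 1" and ke: "6 \<le> e * (real k - 2)" and Le: "7 * real M ^ 2 \<le> e * real (L + 1)"
    and lp1: "lp_approximates e k 2 N1 (\<lambda>Q. lp_run \<beta>1 N1 \<eta>1 k Q T1)"
    and lp2: "lp_approximates e M L N2 (\<lambda>Q. lp_run \<beta>2 N2 \<eta>2 M Q T2)"
begin

section \<open>Cost of each step against a fixed dominating set\<close>

lemma sg: "finite V" "E \<subseteq> V \<times> V" "sym E" "(x, x) \<notin> E"
  using G(1) by (auto simp: simple_graph_def)

lemma finN: "finite (E `` {v})" by (rule finite_neighbours[OF G(1)])

lemma fin_sub: "finite {w \<in> E `` {v}. P w}" by (rule finite_subset[OF _ finN[of v]]) auto

lemma fin_nbh: "finite (nbh E v)" using finN by (simp add: nbh_def)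

lemma E_sym: "(u, v) \<in> E \<longleftrightarrow> (v, u) \<in> E" using sg(3) by (auto dest: symD)

lemma DV: "D \<subseteq> V" "finite D" using D sg(1) finite_subset by (auto simp: dominating_set_def)

definition dm :: "nat \<Rightarrow> nat" where
  "dm w = (if w \<in> D then w else SOME u. u \<in> D \<and> (w, u) \<in> E)"

lemma dm:
  assumes "w \<in> V"
  shows "dm w \<in> D" "dm w = w \<or> (w, dm w) \<in> E" "dm w \<in> nbh E w"
proof -
  have "dm w \<in> D \<and> (dm w = w \<or> (w, dm w) \<in> E)"
  proof (cases "w \<in> D")
    case False
    then have "\<exists>u. u \<in> D \<and> (w, u) \<in> E" using D assms by (auto simp: dominating_set_def)
    from someI_ex[OF this] show ?thesis using False by (simp add: dm_def)
  qed (simp add: dm_def)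
  then show "dm w \<in> D" "dm w = w \<or> (w, dm w) \<in> E" "dm w \<in> nbh E w" by (auto simp: nbh_def)
qed

text \<open>The two colour classes of \<open>S\<close> are independent, so
  \<open>star_minor_bound\<close> applies to each; added up, they give
  \<open>(k + 1) * card S \<le> 6 * card D + 3 * card S\<close>.\<close>

lemma many_dominators_bound:
  assumes S: "S \<subseteq> V" "S \<inter> D = {}" and h: "\<And>s. s \<in> S \<Longrightarrow> k + 1 \<le> card (dm ` (E `` {s}))"
  shows "real (card S) \<le> e * real (card D)"
proof -
  obtain A where A: "\<And>u v. (u, v) \<in> E \<Longrightarrow> u \<in> A \<longleftrightarrow> v \<notin> A" using bip unfolding bipartite_def by fast
  have part: "(k + 1) * card S' \<le> 3 * (card D + card S')" if "S' = S \<inter> A \<or> S' = S - A" for S'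
  proof (rule star_minor_bound[OF G, where dm = dm])
    show "S' \<subseteq> V" "D \<subseteq> V" "S' \<inter> D = {}" using that S DV by auto
    show "E `` {s} \<inter> S' = {}" if "s \<in> S'" for s using that A \<open>S' = S \<inter> A \<or> S' = S - A\<close> by blast
    show "dm w \<in> D \<and> (dm w = w \<or> (w, dm w) \<in> E)" if "(s, w) \<in> E" for s w
      using dm[of w] that sg(2) by auto
    show "dm w = w" if "w \<in> D" for w using that by (simp add: dm_def)
    show "k + 1 \<le> card (dm ` (E `` {s}))" if "s \<in> S'" for s using h that \<open>S' = S \<inter> A \<or> S' = S - A\<close> by blast
  qed
  have "finite S" using S sg finite_subset by blast
  then have cS: "card S = card (S \<inter> A) + card (S - A)"
    by (metis Int_Diff_Un Int_Diff_disjoint card_Un_disjoint finite_Diff finite_Int)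
  have "(k + 1) * card S \<le> 6 * card D + 3 * card S"
    using part[of "S \<inter> A"] part[of "S - A"] unfolding cS by (simp add: algebra_simps)
  then have "real ((k + 1) * card S) \<le> real (6 * card D + 3 * card S)" by (rule of_nat_mono)
  then have a: "(real k - 2) * real (card S) \<le> 6 * real (card D)" by (simp add: algebra_simps)
  have "6 * real (card S) \<le> e * (real k - 2) * real (card S)" using ke by (rule mult_right_mono) simp
  also have "\<dots> = e * ((real k - 2) * real (card S))" by simp
  also have "\<dots> \<le> e * (6 * real (card D))" using a e by (intro mult_left_mono) auto
  finally show ?thesis by simp
qed

text \<open>The dominators of the neighbours of \<open>s\<close> are admissible as the set
  \<open>A\<close> in \<open>hard\<close>, since \<open>s\<close> is not in \<open>D\<close>. A hard
  vertex must therefore see more than \<open>k\<close> of them.\<close>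

lemma hard_outside_D: "real (card {v \<in> V - D. hard E v}) \<le> e * real (card D)"
proof (rule many_dominators_bound)
  fix s assume s: "s \<in> {v \<in> V - D. hard E v}"
  have nV: "E `` {s} \<subseteq> V" using sg(2) by auto
  show "k + 1 \<le> card (dm ` (E `` {s}))"
  proof (rule ccontr)
    assume "\<not> ?thesis"
    then have "card (dm ` (E `` {s})) \<le> k" by simp
    moreover have "dm ` (E `` {s}) \<subseteq> (\<Union>w\<in>E `` {s}. nbh E w) - {s}"
      using dm nV s by blast
    moreover have "\<forall>w\<in>E `` {s}. dm ` (E `` {s}) \<inter> nbh E w \<noteq> {}" using dm nV by blast
    ultimately have "\<not> hard E s" unfolding hard_def by blast
    then show False using s by simp
  qed
qed auto

text \<open>The closed neighbourhood of \<open>a\<close> adds \<open>a\<close> itself to the six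
  vertices allowed by \<open>no_K37\<close>.\<close>

lemma triple_common:
  assumes "u \<noteq> v" "a \<noteq> u" "a \<noteq> v" "X \<subseteq> E `` {u} \<inter> E `` {v} \<inter> nbh E a"
  shows "card X \<le> 7"
proof -
  have "X - {a} \<subseteq> E `` {u} \<inter> E `` {v} \<inter> E `` {a}" using assms(4) by (auto simp: nbh_def)
  then have "card (X - {a}) \<le> 6" using no_K37[OF G bip] assms by metis
  moreover have "card X \<le> Suc (card (X - {a}))"
    by (cases "finite X") (auto simp: card_Suc_Diff1 card_Diff_singleton_if)
  ultimately show ?thesis by linarith
qed

lemma T_pos: "T > 0" using T by simp

lemma partnersD:
  assumes "v \<in> partners E u"
  shows "v \<noteq> u" "\<not> hard E u" "\<not> hard E v" "T \<le> card {w \<in> E `` {u} \<inter> E `` {v}. open1 E w}" "u \<in> V" "v \<in> V"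
proof -
  let ?S = "{w \<in> E `` {u}. v \<in> E `` {w} \<and> \<not> hard E v \<and> open1 E w}"
  have c: "T \<le> card ?S" using assms unfolding partners_def by blast
  then have "?S \<noteq> {}" using T_pos by (metis card.empty not_le)
  then show hv: "\<not> hard E v" "u \<in> V" "v \<in> V" using sg(2) by auto
  show "v \<noteq> u" "\<not> hard E u" using assms by (auto simp: partners_def)
  have "?S = {w \<in> E `` {u} \<inter> E `` {v}. open1 E w}" using hv E_sym by auto
  then show "T \<le> card {w \<in> E `` {u} \<inter> E `` {v}. open1 E w}" using c by simp
qed

lemma not_hardE:
  assumes "\<not> hard E u"
  obtains A where "finite A" "u \<notin> A" "card A \<le> k" "\<And>w. w \<in> E `` {u} \<Longrightarrow> \<exists>a\<in>A. w \<in> nbh E a"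
proof -
  obtain A where A: "A \<subseteq> (\<Union>w\<in>E `` {u}. nbh E w) - {u}" "card A \<le> k" "\<forall>w\<in>E `` {u}. A \<inter> nbh E w \<noteq> {}"
    using assms unfolding hard_def by blast
  have "finite A" by (rule finite_subset[OF A(1)]) (use finN fin_nbh in auto)
  moreover have "\<exists>a\<in>A. w \<in> nbh E a" if "w \<in> E `` {u}" for w
    using A(3) that nbh_sym[OF G(1)] by blast
  ultimately show ?thesis using A that by blast
qed

text \<open>All partners of \<open>u\<close> lie in the set \<open>A\<close> showing that
  \<open>u\<close> is not hard: with a partner outside \<open>A\<close>, each member of
  \<open>A\<close> would account for at most 7 common neighbours, fewer than \<open>T\<close> in
  total.\<close>

lemma card_partners: "card (partners E u) \<le> k"
proof (cases "hard E u")
  case True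
  then show ?thesis by (simp add: partners_def)
next
  case False
  obtain A where A: "finite A" "u \<notin> A" "card A \<le> k" "\<And>w. w \<in> E `` {u} \<Longrightarrow> \<exists>a\<in>A. w \<in> nbh E a"
    using not_hardE[OF False] by blast
  have "partners E u \<subseteq> A"
  proof (rule subsetI, rule ccontr)
    fix v assume v: "v \<in> partners E u" "v \<notin> A"
    note vD = partnersD[OF v(1)]
    let ?X = "E `` {u} \<inter> E `` {v}"
    have "card ?X \<le> card A * 7"
    proof (rule card_le_by_cover[OF A(1), where f = "nbh E"])
      show "\<exists>a\<in>A. w \<in> nbh E a" if "w \<in> ?X" for w using A(4) that by blast
      show "card (?X \<inter> nbh E a) \<le> 7" if "a \<in> A" for a
        by (rule triple_common[of u v a]) (use that v A vD in auto)
    qed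
    moreover have "card {w \<in> ?X. open1 E w} \<le> card ?X" using finN by (intro card_mono) auto
    moreover have "card A * 7 \<le> k * 7" using A(3) by simp
    ultimately have "T \<le> k * 7" using vD(4) by (meson le_trans)
    then show False unfolding T by simp
  qed
  then show ?thesis using A(1,3) card_mono le_trans by blast
qed

lemma pairs_bounded: "bounded_hypergraph k 2 (pairs E)"
  unfolding bounded_hypergraph_def
proof (intro conjI ballI allI)
  have "pairs E \<subseteq> Pow V" using partnersD by (auto simp: pairs_def)
  then show "finite (pairs E)" using sg(1) by (meson finite_Pow_iff finite_subset)
  fix q assume "q \<in> pairs E"
  then obtain u v where "q = {u, v}" by (auto simp: pairs_def)
  then show "finite q" "q \<noteq> {}" "card q \<le> 2" by (auto simp: card_insert_if)
next
  fix u
  have "card ((\<lambda>v. {u, v}) ` partners E u) \<le> card (partners E u)"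
    using partnersD sg(1) by (intro card_image_le) (meson finite_subset subsetI)
  then show "card {q \<in> pairs E. u \<in> q} \<le> k"
    unfolding pairs_at[OF G(1) T_pos] using card_partners le_trans by blast
qed

text \<open>Together with the non-hard part of \<open>D\<close>, these vertices hit every pair of
  partners.\<close>

definition exposed :: "nat set" where
  "exposed = {s \<in> V - D. \<exists>v. v \<notin> D \<and> v \<in> partners E s}"

text \<open>The common neighbours of two partners outside \<open>D\<close> are split among their
  dominators, at most 7 for each, so there are at least \<open>k + 1\<close> dominators.\<close>

lemma card_exposed: "real (card exposed) \<le> e * real (card D)"
proof (rule many_dominators_bound)
  show "exposed \<subseteq> V" "exposed \<inter> D = {}" by (auto simp: exposed_def)
  fix s assume "s \<in> exposed"
  then obtain v where s: "s \<in> V" "s \<notin> D" "v \<notin> D" "v \<in> partners E s" by (auto simp: exposed_def)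
  note vD = partnersD[OF s(4)]
  let ?X = "E `` {s} \<inter> E `` {v}"
  have XV: "?X \<subseteq> V" using sg(2) by auto
  have "card ?X \<le> card (dm ` (E `` {s})) * 7"
  proof (rule card_le_by_cover[where f = "\<lambda>d. {w. dm w = d}"])
    show "finite (dm ` (E `` {s}))" using finN by blast
    show "\<exists>a\<in>dm ` (E `` {s}). w \<in> {w. dm w = a}" if "w \<in> ?X" for w using that by blast
    fix d assume "d \<in> dm ` (E `` {s})"
    then have "d \<in> D" using dm sg(2) by blast
    show "card (?X \<inter> {w. dm w = d}) \<le> 7"
    proof (rule triple_common[of s v d])
      show "s \<noteq> v" "d \<noteq> s" "d \<noteq> v" using vD s \<open>d \<in> D\<close> by auto
      show "?X \<inter> {w. dm w = d} \<subseteq> ?X \<inter> nbh E d" using dm(3) XV nbh_sym[OF G(1)] by blast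
    qed
  qed
  moreover have "card {w \<in> ?X. open1 E w} \<le> card ?X" using finN by (intro card_mono) auto
  ultimately have "T \<le> card (dm ` (E `` {s})) * 7" using vD(4) by (meson le_trans)
  then show "k + 1 \<le> card (dm ` (E `` {s}))" unfolding T by simp
qed

text \<open>Hard members of \<open>D\<close> are already chosen. Partners are not hard, and a vertex
  still open has no hard dominator, so both programs are compared with this part of \<open>D\<close>
  only.\<close>

abbreviation "easyD \<equiv> {d \<in> D. \<not> hard E d}"

lemma card_picked: "real (card {u \<in> V. picked E u}) \<le> 2 * (1 + e) * (real (card easyD) + e * real (card D))"
proof -
  have N1: "N1 > 0" and cov: "\<And>q. q \<in> pairs E \<Longrightarrow> N1 \<le> sum (x1 E) q"
    and out: "\<And>u. u \<notin> \<Union>(pairs E) \<Longrightarrow> x1 E u = 0"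
    and opt: "\<And>Z. finite Z \<Longrightarrow> \<forall>q\<in>pairs E. Z \<inter> q \<noteq> {} \<Longrightarrow>
        real (\<Sum>u\<in>\<Union>(pairs E). x1 E u) \<le> (1 + e) * real N1 * real (card Z)"
    using lp1 pairs_bounded unfolding lp_approximates_def x1_def by blast+
  let ?P = "{u \<in> V. picked E u}" and ?Z = "easyD \<union> exposed"
  have finU: "finite (\<Union>(pairs E))" using pairs_bounded by (auto simp: bounded_hypergraph_def)
  have P: "?P \<subseteq> \<Union>(pairs E)"
  proof (rule subsetI, rule ccontr)
    fix u assume "u \<in> ?P" "u \<notin> \<Union>(pairs E)"
    then show False using out[of u] N1 by (auto simp: picked_def)
  qed
  have finex: "finite exposed" using sg(1) by (simp add: exposed_def)
  have "N1 * card ?P = (\<Sum>u\<in>?P. N1)" by simp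
  also have "\<dots> \<le> (\<Sum>u\<in>?P. 2 * x1 E u)" by (intro sum_mono) (auto simp: picked_def)
  also have "\<dots> \<le> (\<Sum>u\<in>\<Union>(pairs E). 2 * x1 E u)" using P finU by (intro sum_mono2) auto
  also have "\<dots> = 2 * (\<Sum>u\<in>\<Union>(pairs E). x1 E u)" by (simp add: sum_distrib_left)
  finally have "real (N1 * card ?P) \<le> real (2 * (\<Sum>u\<in>\<Union>(pairs E). x1 E u))" by (rule of_nat_mono)
  also have "\<dots> = 2 * real (\<Sum>u\<in>\<Union>(pairs E). x1 E u)" by simp
  also have "\<dots> \<le> 2 * ((1 + e) * real N1 * real (card ?Z))"
  proof (intro mult_left_mono opt)
    show "finite ?Z" using DV(2) finex by simp
    show "\<forall>q\<in>pairs E. ?Z \<inter> q \<noteq> {}"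
    proof
      fix q assume "q \<in> pairs E"
      then obtain u v where q: "q = {u, v}" "v \<in> partners E u" by (auto simp: pairs_def)
      note vD = partnersD[OF q(2)]
      show "?Z \<inter> q \<noteq> {}"
      proof (cases "u \<in> D \<or> v \<in> D")
        case True then show ?thesis using vD q by auto
      next
        case False then have "u \<in> exposed" using vD q by (auto simp: exposed_def)
        then show ?thesis using q by auto
      qed
    qed
  qed simp
  finally have "real N1 * real (card ?P) \<le> real N1 * (2 * (1 + e) * real (card ?Z))" by (simp only: of_nat_mult mult_ac)
  then have "real (card ?P) \<le> 2 * (1 + e) * real (card ?Z)" using N1 by simp
  also have "\<dots> \<le> 2 * (1 + e) * (real (card easyD) + e * real (card D))"
  proof (intro mult_left_mono)
    have "real (card ?Z) \<le> real (card easyD) + real (card exposed)" using card_Un_le[of easyD exposed] by linarith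
    then show "real (card ?Z) \<le> real (card easyD) + e * real (card D)" using card_exposed by linarith
  qed (use e in auto)
  finally show ?thesis .
qed

lemma traceD:
  assumes "v \<in> trace E u"
  shows "\<not> hard E u" "\<not> picked E u"
  using assms nbh_sym[OF G(1), of u v] by (auto simp: trace_def open2_def)

text \<open>A helper \<open>a\<close> sharing more than \<open>T\<close> open vertices with
  \<open>u\<close> would be a partner of \<open>u\<close>. The first program then forces
  \<open>u\<close> or \<open>a\<close> to be picked, which would dominate the vertices they
  share.\<close>

lemma card_trace: "card (trace E u) \<le> M"
proof (cases "trace E u = {}")
  case False
  then have u: "\<not> hard E u" "\<not> picked E u" using traceD by blast+
  obtain A where A: "finite A" "u \<notin> A" "card A \<le> k" "\<And>w. w \<in> E `` {u} \<Longrightarrow> \<exists>a\<in>A. w \<in> nbh E a"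
    using not_hardE[OF u(1)] by blast
  let ?X = "{w \<in> E `` {u}. open2 E w}"
  have "card ?X \<le> card A * T"
  proof (rule card_le_by_cover[OF A(1), where f = "nbh E"])
    show "\<exists>a\<in>A. w \<in> nbh E a" if "w \<in> ?X" for w using A(4) that by blast
    fix a assume a: "a \<in> A"
    show "card (?X \<inter> nbh E a) \<le> T"
    proof (rule ccontr)
      assume big: "\<not> ?thesis"
      have "?X \<inter> nbh E a \<subseteq> insert a (?X \<inter> E `` {a})" by (auto simp: nbh_def)
      then have "card (?X \<inter> nbh E a) \<le> card (insert a (?X \<inter> E `` {a}))" using finN by (intro card_mono) auto
      also have "\<dots> \<le> Suc (card (?X \<inter> E `` {a}))" by (rule card_insert_le_m1[of "Suc n" for n, simplified]) auto
      finally have cT: "T \<le> card (?X \<inter> E `` {a})" using big by linarith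
      then have "?X \<inter> E `` {a} \<noteq> {}" using T_pos by (metis card.empty not_le)
      then obtain w where w: "(u, w) \<in> E" "(a, w) \<in> E" "open2 E w" by auto
      have in_nbh: "u \<in> nbh E w" "a \<in> nbh E w" using w E_sym by (auto simp: nbh_def)
      have a_ok: "\<not> hard E a" "\<not> picked E a" using w(3) in_nbh by (auto simp: open2_def)
      have "?X \<inter> E `` {a} \<subseteq> {w \<in> E `` {u}. a \<in> E `` {w} \<and> \<not> hard E a \<and> open1 E w}"
        using a_ok E_sym by (auto simp: open1_def open2_def)
      then have "card (?X \<inter> E `` {a}) \<le> card {w \<in> E `` {u}. a \<in> E `` {w} \<and> \<not> hard E a \<and> open1 E w}"
        by (intro card_mono finite_subset[OF _ finN[of u]]) auto
      then have part: "a \<in> partners E u" using cT u(1) a A(2) unfolding partners_def by auto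
      then have "{u, a} \<in> pairs E" by (auto simp: pairs_def)
      then have "N1 \<le> sum (x1 E) {u, a}"
        using lp1 pairs_bounded unfolding lp_approximates_def x1_def by blast
      then have "N1 \<le> x1 E u + x1 E a" using a A(2) by (cases "u = a") auto
      then have "picked E u \<or> picked E a" unfolding picked_def by linarith
      then show False using u a_ok by blast
    qed
  qed
  also have "card A * T \<le> k * T" using A(3) by simp
  finally have "card ?X \<le> k * T" .
  moreover have "trace E u \<subseteq> insert u ?X" by (auto simp: trace_def nbh_def)
  then have "card (trace E u) \<le> card (insert u ?X)" by (intro card_mono finite.insertI fin_sub)
  moreover have "card (insert u ?X) \<le> Suc (card ?X)" by (subst card_insert_if[OF fin_sub]) simp
  ultimately show ?thesis using M by simp
qed (simp add: M)

definition R2 :: "nat set" where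
  "R2 = {v \<in> V. open2 E v}"

lemma trace_eq: "u \<in> V \<Longrightarrow> trace E u = nbh E u \<inter> R2"
  using nbh_subset[OF G(1)] by (auto simp: trace_def R2_def)

lemma fin_trace: "finite (trace E u)" using fin_nbh by (simp add: trace_def)

lemma card_R2: "card R2 \<le> M * card D"
proof -
  have "R2 \<subseteq> (\<Union>d\<in>D. trace E d)"
  proof
    fix v assume "v \<in> R2"
    then have v: "v \<in> V" "open2 E v" by (auto simp: R2_def)
    then show "v \<in> (\<Union>d\<in>D. trace E d)"
      using dm[of v] nbh_sym[OF G(1)] by (auto simp: trace_def)
  qed
  then have "card R2 \<le> card (\<Union>d\<in>D. trace E d)" using DV(2) fin_trace by (intro card_mono) auto
  also have "\<dots> \<le> (\<Sum>d\<in>D. card (trace E d))" using DV(2) by (rule card_UN_le)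
  also have "\<dots> \<le> card D * M" using sum_bounded_above[of D "\<lambda>d. card (trace E d)" M] card_trace by simp
  finally show ?thesis by (simp add: mult.commute)
qed

definition C :: "nat set" where
  "C = {u \<in> V. rep E u}"

lemma inj_trace: "inj_on (trace E) C"
proof (rule inj_onI)
  have le: "u \<le> u'" if "u \<in> C" "u' \<in> C" "trace E u = trace E u'" for u u'
  proof -
    obtain w where w: "w \<in> trace E u" using \<open>u \<in> C\<close> by (auto simp: C_def rep_def)
    then have "w \<in> nbh E u" "w \<in> nbh E u'" using that by (auto simp: trace_def)
    then have "u' \<in> nbh E w" using nbh_sym[OF G(1)] by blast
    then show ?thesis using \<open>u \<in> C\<close> \<open>w \<in> nbh E u\<close> that(3) by (auto simp: C_def rep_def)
  qed
  fix u u' assume "u \<in> C" "u' \<in> C" "trace E u = trace E u'"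
  then show "u = u'" using le[of u u'] le[of u' u] by simp
qed

lemma ex_rep:
  assumes "u \<in> V" "trace E u \<noteq> {}"
  obtains u' where "u' \<in> C" "trace E u' = trace E u"
proof -
  let ?S = "{u' \<in> V. trace E u' = trace E u}"
  have fin: "finite ?S" "?S \<noteq> {}" using sg(1) assms by auto
  define m where "m = Min ?S"
  have m: "m \<in> ?S" using Min_in[OF fin] by (simp add: m_def)
  have "rep E m"
    unfolding rep_def
  proof (intro conjI ballI impI)
    show "trace E m \<noteq> {}" using m assms by auto
    fix w u' assume w: "w \<in> nbh E m" "u' \<in> nbh E w" "trace E u' = trace E m"
    then have "u' \<in> V" using m nbh_subset[OF G(1)] by blast
    then have "u' \<in> ?S" using w m by auto
    then show "m \<le> u'" using Min_le[OF fin(1)] by (simp add: m_def)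
  qed
  then show ?thesis using that[of m] m by (auto simp: C_def)
qed

text \<open>The traces are distinct, and 7 = 1 + 1 + 3 + 2: members of \<open>R2\<close>, single
  traces, traces of size two by \<open>two_trace_bound\<close>, and larger ones from
  \<open>3 * card B3 \<le> 2 * card B3 + 2 * card R2\<close>.\<close>

lemma card_C: "card C \<le> 7 * card R2"
proof -
  have fin: "finite C" "finite R2" "R2 \<subseteq> V" "C \<subseteq> V" using sg(1) by (auto simp: C_def R2_def)
  define B where "B i = {u \<in> C - R2. card (trace E u) = i}" for i
  define B3 where "B3 = {u \<in> C - R2. 3 \<le> card (trace E u)}"
  have tr: "trace E u = E `` {u} \<inter> R2" if "u \<in> C - R2" for u
    using that trace_eq[of u] by (auto simp: C_def nbh_def)
  have "card (trace E u) \<noteq> 0" if "u \<in> C" for u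
    using that fin_trace by (auto simp: C_def rep_def)
  then have "card (trace E u) = 1 \<or> card (trace E u) = 2 \<or> 3 \<le> card (trace E u)" if "u \<in> C" for u
  proof -
    have "n \<noteq> 0 \<Longrightarrow> n = 1 \<or> n = 2 \<or> 3 \<le> n" for n :: nat by arith
    then show ?thesis using \<open>u \<in> C\<close> \<open>\<And>u. u \<in> C \<Longrightarrow> card (trace E u) \<noteq> 0\<close> by blast
  qed
  then have "C \<subseteq> R2 \<union> B 1 \<union> B 2 \<union> B3" unfolding B_def B3_def by blast
  then have "card C \<le> card (R2 \<union> B 1 \<union> B 2 \<union> B3)"
    using fin by (intro card_mono) (auto simp: B_def B3_def)
  also have "\<dots> \<le> card R2 + card (B 1) + card (B 2) + card B3"
    by (meson add_le_mono card_Un_le le_trans order_refl)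
  also have "card (B 1) \<le> card R2"
  proof -
    have "trace E ` B 1 \<subseteq> (\<lambda>v. {v}) ` R2"
    proof
      fix t assume "t \<in> trace E ` B 1"
      then obtain u where u: "u \<in> B 1" "t = trace E u" by blast
      then obtain v where "t = {v}" by (auto simp: B_def card_1_singleton_iff)
      then show "t \<in> (\<lambda>v. {v}) ` R2" using u tr by (auto simp: B_def)
    qed
    then have "card (trace E ` B 1) \<le> card ((\<lambda>v. {v}) ` R2)" using fin by (intro card_mono) auto
    also have "\<dots> \<le> card R2" using fin by (intro card_image_le) auto
    finally show ?thesis
      using card_image[OF inj_on_subset[OF inj_trace, of "B 1"]] by (auto simp: B_def)
  qed
  also have "card (B 2) \<le> 3 * card R2"
  proof (rule two_trace_bound[OF G])
    show "R2 \<subseteq> V" "B 2 \<subseteq> V" "B 2 \<inter> R2 = {}" using fin by (auto simp: B_def)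
    show "card (E `` {u} \<inter> R2) = 2" if "u \<in> B 2" for u using that tr by (auto simp: B_def)
    show "inj_on (\<lambda>u. E `` {u} \<inter> R2) (B 2)"
    proof (rule inj_onI)
      fix u u' assume "u \<in> B 2" "u' \<in> B 2" "E `` {u} \<inter> R2 = E `` {u'} \<inter> R2"
      then show "u = u'" using tr inj_onD[OF inj_trace, of u u'] by (auto simp: B_def)
    qed
  qed
  also have "card B3 \<le> 2 * card R2"
  proof -
    have "3 * card B3 \<le> (\<Sum>u\<in>B3. card (E `` {u} \<inter> R2))"
    proof -
      have "3 \<le> card (E `` {u} \<inter> R2)" if "u \<in> B3" for u using that tr[of u] by (simp add: B3_def)
      then show ?thesis
        using sum_bounded_below[of B3 3 "\<lambda>u. card (E `` {u} \<inter> R2)"] by (simp only: of_nat_id mult.commute)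
    qed
    also have "\<dots> = card (SIGMA u:B3. E `` {u} \<inter> R2)"
      using fin by (intro card_SigmaI[symmetric]) (auto simp: B3_def)
    also have "(SIGMA u:B3. E `` {u} \<inter> R2) = E \<inter> B3 \<times> R2" by auto
    also have "card \<dots> \<le> 2 * card B3 + 2 * card R2"
      by (rule bipartite_planar_cross_edges[OF G bip]) (use fin in \<open>auto simp: B3_def\<close>)
    finally show ?thesis by simp
  qed
  finally show ?thesis by simp
qed

text \<open>Incidences between \<open>C\<close> and \<open>R2\<close> are counted twice: at most
  \<open>M\<close> at each representative, at least \<open>L + 1\<close> at each crowded
  vertex.\<close>

lemma card_crowded: "real (card {v \<in> V. crowded E v}) \<le> e * real (card D)"
proof -
  let ?K = "{v \<in> V. crowded E v}"
  have fin: "finite C" "finite R2" using sg(1) by (auto simp: C_def R2_def)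
  have repC: "{u \<in> nbh E v. rep E u} = nbh E v \<inter> C" if "v \<in> V" for v
    using nbh_subset[OF G(1) that] by (auto simp: C_def)
  have "L + 1 \<le> card (nbh E v \<inter> C)" if "v \<in> ?K" for v
    using that repC[of v] by (simp add: crowded_def)
  then have "(L + 1) * card ?K \<le> (\<Sum>v\<in>?K. card (nbh E v \<inter> C))"
    using sum_bounded_below[of ?K "L + 1" "\<lambda>v. card (nbh E v \<inter> C)"] by (simp only: of_nat_id mult.commute)
  also have "\<dots> \<le> (\<Sum>v\<in>R2. card (nbh E v \<inter> C))"
    using fin by (intro sum_mono2) (auto simp: R2_def crowded_def)
  also have "\<dots> = (\<Sum>v\<in>R2. \<Sum>u\<in>C. of_bool (u \<in> nbh E v))"
    using fin by (intro sum.cong refl) (simp add: sum_of_bool_eq Int_def conj_commute)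
  also have "\<dots> = (\<Sum>u\<in>C. \<Sum>v\<in>R2. of_bool (u \<in> nbh E v))" by (rule sum.swap)
  also have "\<dots> = (\<Sum>u\<in>C. card (trace E u))"
  proof (intro sum.cong refl)
    fix u assume "u \<in> C"
    then have "trace E u = R2 \<inter> {v. u \<in> nbh E v}" using trace_eq[of u] nbh_sym[OF G(1), of u] by (auto simp: C_def)
    then show "(\<Sum>v\<in>R2. of_bool (u \<in> nbh E v)) = card (trace E u)" using fin by (simp add: sum_of_bool_eq)
  qed
  also have "\<dots> \<le> card C * M" using sum_bounded_above[of C "\<lambda>u. card (trace E u)" M] card_trace by simp
  also have "\<dots> \<le> 7 * (M * card D) * M"
    using card_C card_R2 by (intro mult_le_mono1) linarith
  finally have "real ((L + 1) * card ?K) \<le> real (7 * (M * card D) * M)" by (rule of_nat_mono)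
  then have "real (L + 1) * real (card ?K) \<le> 7 * real M ^ 2 * real (card D)"
    by (simp only: of_nat_mult of_nat_numeral power2_eq_square mult_ac)
  also have "\<dots> \<le> e * real (L + 1) * real (card D)" using Le by (rule mult_right_mono) simp
  finally have "real (L + 1) * real (card ?K) \<le> real (L + 1) * (e * real (card D))" by (simp only: mult_ac)
  then show ?thesis by (simp only: mult_le_cancel_left_pos of_nat_0_less_iff zero_less_Suc add_gr_0 zero_less_one simp_thms)
qed

lemma demands_bounded: "bounded_hypergraph M L (demands V E)"
  unfolding bounded_hypergraph_def
proof (intro conjI ballI allI)
  have dem: "demands V E = (\<lambda>v. {u \<in> nbh E v. rep E u}) ` {v \<in> V. open3 E v}"
    by (auto simp: demands_def)
  show "finite (demands V E)" unfolding dem using sg(1) by simp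
  fix q assume "q \<in> demands V E"
  then obtain v where v: "v \<in> V" "open3 E v" "q = {u \<in> nbh E v. rep E u}" by (auto simp: demands_def)
  show "finite q" using v fin_nbh by simp
  have "v \<in> trace E v" using v nbh_self by (auto simp: trace_def open3_def)
  then obtain u where u: "u \<in> C" "trace E u = trace E v" using ex_rep[OF v(1)] by blast
  then have "v \<in> nbh E u" using \<open>v \<in> trace E v\<close> by (auto simp: trace_def)
  then show "q \<noteq> {}" using v u nbh_sym[OF G(1)] by (auto simp: C_def)
  have "\<not> crowded E v" using v nbh_self by (auto simp: open3_def)
  then show "card q \<le> L" using v by (auto simp: crowded_def open3_def)
next
  fix u
  show "card {q \<in> demands V E. u \<in> q} \<le> M"
  proof -
    have "{q \<in> demands V E. u \<in> q} \<subseteq> (\<lambda>v. {u \<in> nbh E v. rep E u}) ` trace E u"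
      using nbh_sym[OF G(1), of u] by (auto simp: demands_def trace_def open3_def)
    then have "card {q \<in> demands V E. u \<in> q} \<le> card ((\<lambda>v. {u \<in> nbh E v. rep E u}) ` trace E u)"
      using fin_trace by (intro card_mono) auto
    also have "\<dots> \<le> card (trace E u)" using fin_trace by (rule card_image_le)
    finally show ?thesis using card_trace[of u] by simp
  qed
qed

text \<open>Replacing each member of \<open>easyD\<close> that has a nonempty trace by the
  representative of that trace yields a hitting set for the demands that is no larger.\<close>

lemma card_big_leftover:
  "real (card {u \<in> V. big V E u}) + real (card {v \<in> V. leftover V E v}) \<le> 5 * (1 + e) * real (card easyD)"
proof -
  let ?Q = "demands V E" and ?H = "{u \<in> V. big V E u}" and ?U = "{v \<in> V. leftover V E v}"
  have N2: "N2 > 0" and cov: "\<And>q. q \<in> ?Q \<Longrightarrow> N2 \<le> sum (x2 V E) q"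
    and out: "\<And>u. u \<notin> \<Union>?Q \<Longrightarrow> x2 V E u = 0"
    and opt: "\<And>Z. finite Z \<Longrightarrow> \<forall>q\<in>?Q. Z \<inter> q \<noteq> {} \<Longrightarrow>
        real (\<Sum>u\<in>\<Union>?Q. x2 V E u) \<le> (1 + e) * real N2 * real (card Z)"
    using lp2 demands_bounded unfolding lp_approximates_def x2_def by blast+
  have QV: "\<Union>?Q \<subseteq> V" using nbh_subset[OF G(1)] by (auto simp: demands_def)
  have "N2 * (card ?H + card ?U) \<le> 5 * sum (x2 V E) V"
  proof (rule lp_rounding[OF G bip, where R = "{v \<in> V. open3 E v}"])
    show "?H = {u \<in> V. N2 \<le> 5 * x2 V E u}" by (simp add: big_def)
    show "?U = {v \<in> {v \<in> V. open3 E v}. nbh E v \<inter> ?H = {}}"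
      using nbh_subset[OF G(1)] by (auto simp: leftover_def)
    fix v assume "v \<in> {v \<in> V. open3 E v}"
    then have "{u \<in> nbh E v. rep E u} \<in> ?Q" by (auto simp: demands_def)
    then have "N2 \<le> sum (x2 V E) {u \<in> nbh E v. rep E u}" by (rule cov)
    also have "\<dots> \<le> sum (x2 V E) (nbh E v)" using fin_nbh by (intro sum_mono2) auto
    finally show "N2 \<le> sum (x2 V E) (nbh E v)" .
  qed auto
  also have "sum (x2 V E) V = sum (x2 V E) (\<Union>?Q)"
    using QV sg(1) out by (intro sum.mono_neutral_right) auto
  finally have "real (N2 * (card ?H + card ?U)) \<le> real (5 * sum (x2 V E) (\<Union>?Q))" by (rule of_nat_mono)
  also have "\<dots> = 5 * real (sum (x2 V E) (\<Union>?Q))" by simp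
  also have "\<dots> \<le> 5 * ((1 + e) * real N2 * real (card easyD))"
  proof (rule mult_left_mono)
    have "\<exists>u'. u' \<in> C \<and> trace E u' = trace E d" if "d \<in> D" "trace E d \<noteq> {}" for d
      using ex_rep[of d] that DV by blast
    then obtain r where r: "\<And>d. d \<in> D \<Longrightarrow> trace E d \<noteq> {} \<Longrightarrow> r d \<in> C \<and> trace E (r d) = trace E d"
      by metis
    have "real (sum (x2 V E) (\<Union>?Q)) \<le> (1 + e) * real N2 * real (card (r ` easyD))"
    proof (rule opt)
      show "finite (r ` easyD)" using DV by simp
      show "\<forall>q\<in>?Q. r ` easyD \<inter> q \<noteq> {}"
      proof
        fix q assume "q \<in> ?Q"
        then obtain v where v: "v \<in> V" "open3 E v" "q = {u \<in> nbh E v. rep E u}" by (auto simp: demands_def)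
        have d: "dm v \<in> D" "v \<in> nbh E (dm v)" using dm[OF v(1)] nbh_sym[OF G(1)] by blast+
        have vt: "v \<in> trace E (dm v)" using d v by (auto simp: trace_def open3_def)
        then have "r (dm v) \<in> C" "v \<in> trace E (r (dm v))" using r[OF d(1)] by auto
        then have "r (dm v) \<in> q" using v nbh_sym[OF G(1)] by (auto simp: C_def trace_def)
        moreover have "dm v \<in> easyD" using d traceD[OF vt] by simp
        ultimately show "r ` easyD \<inter> q \<noteq> {}" by blast
      qed
    qed
    also have "\<dots> \<le> (1 + e) * real N2 * real (card easyD)"
      using e DV card_image_le[of easyD r] by (intro mult_left_mono) auto
    finally show "real (sum (x2 V E) (\<Union>?Q)) \<le> (1 + e) * real N2 * real (card easyD)" .
  qed simp
  finally have "real N2 * (real (card ?H) + real (card ?U)) \<le> real N2 * (5 * (1 + e) * real (card easyD))"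
    by (simp only: of_nat_mult of_nat_add mult_ac)
  then show ?thesis using N2 by simp
qed

text \<open>The error 13 is 7 + 4 + 2: the slack of both programs on \<open>easyD\<close>, the
  exceptional vertices of the first three steps, and a term \<open>2 * e * e\<close> bounded by
  \<open>2 * e\<close>.\<close>

theorem chosen_size: "real (card {v \<in> V. chosen V E v}) \<le> (7 + 13 * e) * real (card D)"
proof -
  let ?S = "\<lambda>P. {v \<in> V. P v}"
  define a where "a = real (card {d \<in> D. hard E d})"
  define b where "b = real (card easyD)"
  define n where "n = real (card D)"
  have "card D = card {d \<in> D. hard E d} + card easyD"
    using DV(2) by (subst card_Un_disjoint[symmetric]) (auto intro: arg_cong[where f = card])
  then have n: "n = a + b" by (simp add: a_def b_def n_def)
  have nn: "a \<ge> 0" "b \<ge> 0" "n \<ge> 0" by (auto simp: a_def b_def n_def)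
  have "card (?S (hard E)) \<le> card {d \<in> D. hard E d} + card {v \<in> V - D. hard E v}"
    by (rule order_trans[OF card_mono card_Un_le]) (use sg(1) DV in auto)
  then have 1: "real (card (?S (hard E))) \<le> a + e * n"
    using hard_outside_D by (simp add: a_def n_def)
  have "?S (chosen V E) \<subseteq> ?S (hard E) \<union> ?S (picked E) \<union> ?S (crowded E) \<union> ?S (big V E) \<union> ?S (leftover V E)"
    by (auto simp: chosen_def)
  then have "card (?S (chosen V E)) \<le> card (?S (hard E) \<union> ?S (picked E) \<union> ?S (crowded E) \<union> ?S (big V E) \<union> ?S (leftover V E))"
    using sg(1) by (intro card_mono) auto
  also have "\<dots> \<le> card (?S (hard E)) + card (?S (picked E)) + card (?S (crowded E)) + card (?S (big V E)) + card (?S (leftover V E))"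
    by (meson add_le_mono card_Un_le le_trans order_refl)
  finally have "real (card (?S (chosen V E))) \<le> real (card (?S (hard E))) + real (card (?S (picked E)))
      + real (card (?S (crowded E))) + (real (card (?S (big V E))) + real (card (?S (leftover V E))))"
    by linarith
  also have "\<dots> \<le> (a + e * n) + 2 * (1 + e) * (b + e * n) + e * n + 5 * (1 + e) * b"
    using 1 card_picked card_crowded card_big_leftover by (simp add: b_def n_def)
  also have "\<dots> = a + (7 + 7 * e) * b + (4 * e) * n + 2 * e * (e * n)" by (simp add: algebra_simps)
  also have "\<dots> \<le> (7 + 7 * e) * n + (4 * e) * n + 2 * (e * n)"
  proof -
    have "e * (e * n) \<le> 1 * (e * n)" using e nn by (intro mult_right_mono) auto
    moreover have "a \<le> (7 + 7 * e) * a" using e nn by (simp add: mult_right_mono[of 1 "7 + 7 * e" a, simplified])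
    ultimately show ?thesis using n by (simp add: algebra_simps)
  qed
  also have "\<dots> = (7 + 13 * e) * n" by (simp add: algebra_simps)
  finally show ?thesis by (simp add: n_def)
qed

end

lemma optimal_dominating_set:
  assumes "simple_graph V E"
  obtains D where "dominating_set V E D" "card D = domination_number V E"
proof -
  have fin: "finite {D. dominating_set V E D}"
    by (rule finite_subset[of _ "Pow V"]) (use assms in \<open>auto simp: dominating_set_def simple_graph_def\<close>)
  have "dominating_set V E V" by (auto simp: dominating_set_def)
  then have "domination_number V E \<in> card ` {D. dominating_set V E D}"
    unfolding domination_number_def using fin by (intro Min_in) auto
  then show ?thesis using that by auto
qed

theorem theorem5:
  fixes \<epsilon> :: real
  assumes "\<epsilon> > 0"
  shows "\<exists>(r :: nat) (A :: nat \<times> nat set \<times> (nat \<times> nat) set \<Rightarrow> bool).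
           \<forall>V E. simple_graph V E \<and> bipartite V E \<and> planar V E \<longrightarrow>
             dominating_set V E (local_output A r V E) \<and>
             real (card (local_output A r V E)) \<le> (7 + \<epsilon>) * real (domination_number V E)"
proof -
  define e where "e = min 1 (\<epsilon> / 13)"
  have e: "0 < e" "e \<le> 1" and e_le: "13 * e \<le> \<epsilon>" using assms by (auto simp: e_def)
  obtain k0 :: nat where k0: "6 / e + 2 \<le> real k0" using real_arch_simple by blast
  define k where "k = max 1 k0"
  define T where "T = 7 * (k + 1)"
  define M where "M = k * T + 1"
  obtain L :: nat where L: "7 * real M ^ 2 / e \<le> real L" using real_arch_simple by blast
  have ke: "6 \<le> e * (real k - 2)"
  proof -
    have "6 / e \<le> real k - 2" using k0 by (simp add: k_def)
    then show ?thesis using e by (simp add: field_simps)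
  qed
  have Le: "7 * real M ^ 2 \<le> e * real (L + 1)"
  proof -
    have "7 * real M ^ 2 \<le> e * real L" using L e by (simp add: field_simps)
    also have "\<dots> \<le> e * real (L + 1)" using e by (intro mult_left_mono) auto
    finally show ?thesis .
  qed
  have "k \<ge> 1" "M \<ge> 1" "T > 0" by (auto simp: k_def M_def T_def)
  obtain \<beta>1 \<eta>1 N1 T1 where lp1: "lp_approximates e k 2 N1 (\<lambda>Q. lp_run \<beta>1 N1 \<eta>1 k Q T1)"
    using lp_run_approximates[OF e(1) \<open>k \<ge> 1\<close>, of 2] by blast
  obtain \<beta>2 \<eta>2 N2 T2 where lp2: "lp_approximates e M L N2 (\<lambda>Q. lp_run \<beta>2 N2 \<eta>2 M Q T2)"
    using lp_run_approximates[OF e(1) \<open>M \<ge> 1\<close>, of L] by blast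
  \<comment> \<open>The rules are fixed before any graph is introduced, so the radius and the
    decision function depend only on \<epsilon>.\<close>
  interpret domination_algorithm k T L M N1 T1 N2 T2 \<beta>1 \<eta>1 \<beta>2 \<eta>2 .
  obtain r A where rA: "\<forall>V E. simple_graph V E \<longrightarrow> local_output A r V E = {v \<in> V. chosen V E v}"
    using is_local_algorithm[OF is_local_chosen[OF \<open>T > 0\<close>]] by blast
  show ?thesis
  proof (intro exI[of _ r] exI[of _ A] allI impI)
    fix V E assume G: "simple_graph V E \<and> bipartite V E \<and> planar V E"
    then have sg: "simple_graph V E" by simp
    obtain D where D: "dominating_set V E D" and optD: "card D = domination_number V E"
      using optimal_dominating_set[OF sg] by blast
    interpret planar_instance k T L M N1 T1 N2 T2 \<beta>1 \<eta>1 \<beta>2 \<eta>2 e V E D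
      by unfold_locales (use G D ke Le lp1 lp2 e in \<open>auto simp: k_def T_def M_def\<close>)
    have "real (card {v \<in> V. chosen V E v}) \<le> (7 + 13 * e) * real (card D)" by (rule chosen_size)
    also have "\<dots> \<le> (7 + \<epsilon>) * real (card D)" using e_le by (intro mult_right_mono) auto
    finally show "dominating_set V E (local_output A r V E) \<and>
             real (card (local_output A r V E)) \<le> (7 + \<epsilon>) * real (domination_number V E)"
      unfolding rA[rule_format, OF G(1)] optD using chosen_dominating[OF G(1)] by simp
  qed
qed

end
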